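(* Let $(p_n)_{n\ge 0}$ be a non-decreasing sequence of non-negative real numbers with $P_n=p_0+p_1+\cdots+p_n>0$ for all $n\ge 0$, let $\alpha>1/2$, and let $\omega$ be a positive superharmonic function on the unit disk $\mathbb D$. Then the following are true. (i) If $(p_n)_{n\ge0}$ has finite upper growth rate, i.e. $\limsup_{n\to\infty}\frac{n\,p_n}{P_n}<+\infty$, then $\lim_{n\to\infty}\|N_n^{\alpha}[f]-f\|_{\mathcal D_\omega}=0$ for every $f\in\mathcal D_\omega$. (ii) If additionally the growth condition $$\liminf_{n\to\infty}\frac{P_{n-1}}{P_{2n}}>0$$ is satisfied, then $\lim_{n\to\infty}\|N_n^{\alpha}[f]-f\|_{\mathcal D_\omega}=0$ for every $f\in\mathcal D_\omega$ implies that $(p_n)_{n\ge0}$ has finite lower growth rate, i.e. $\liminf_{n\to\infty}\frac{n\,p_n}{P_n}<+\infty$. Moreover, the inequality $\alpha>1/2$ is sharp.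
   Context: $\mathbb D=\{z\in\mathbb C:|z|<1\}$ and $dA$ is the normalized area measure on $\mathbb D$. A function $\omega:\mathbb D\to(-\infty,+\infty]$ is superharmonic if $-\omega$ is subharmonic, i.e. $\omega$ is lower semicontinuous and for each $z\in\mathbb D$ there is $R>0$ with $\omega(z)\ge\frac1{2\pi}\int_0^{2\pi}\omega(z+re^{i\theta})\,d\theta$ for $0\le r<R$. For a positive superharmonic $\omega$ on $\mathbb D$ and $f$ holomorphic on $\mathbb D$, put $\mathcal D_\omega(f)=\int_{\mathbb D}|f'(z)|^2\omega(z)\,dA(z)$. The weighted Dirichlet space $\mathcal D_\omega$ is the set of all holomorphic $f$ on $\mathbb D$ with $\mathcal D_\omega(f)<+\infty$, with norm given by $\|f\|_{\mathcal D_\omega}^2=|f(0)|^2+\mathcal D_\omega(f)$. For a sequence $(p_n)_{n\ge0}$ of non-negative numbers with all $P_n=p_0+\cdots+p_n>0$ (the sequence determining the Nörlund operator $(Nx)_n=\frac1{P_n}\sum_{k=0}^n p_{n-k}x_k$), a parameter $\alpha>0$, and a holomorphic function $f(z)=\sum_{k=0}^\infty a_kz^k$ on $\mathbb D$, the generalized Nörlund sums of $f$ are $$N_n^{\alpha}[f](z)=\frac1{P_n^{\alpha}}\sum_{k=0}^nP_{n-k}^{\alpha}\,a_kz^k,\qquad n\ge0,$$ where $P_j^\alpha=(P_j)^\alpha$. *)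

theory Defs
  imports "HOL-Complex_Analysis.Complex_Analysis"
begin

definition lsc_on :: "complex set \<Rightarrow> (complex \<Rightarrow> ereal) \<Rightarrow> bool" where
  "lsc_on S \<omega> \<longleftrightarrow> (\<forall>c. openin (top_of_set S) {z \<in> S. c < \<omega> z})"

text \<open>
  The mean over a circle is the integral of the positive part minus that of the
  negative part (\<^const>\<open>e2ennreal\<close> sends negative values to 0). A lower semicontinuous
  function that avoids the value minus infinity is bounded below on a circle, so there
  the second integral is finite and the difference is the usual extended-real integral.
\<close>

definition circle_mean :: "(complex \<Rightarrow> ereal) \<Rightarrow> complex \<Rightarrow> real \<Rightarrow> ereal" where
  "circle_mean \<omega> z r =
     (enn2ereal (\<integral>\<^sup>+\<theta>\<in>{0..2*pi}. e2ennreal (\<omega> (z + of_real r * cis \<theta>)) \<partial>lborel) -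
      enn2ereal (\<integral>\<^sup>+\<theta>\<in>{0..2*pi}. e2ennreal (- \<omega> (z + of_real r * cis \<theta>)) \<partial>lborel))
     / ereal (2 * pi)"

text \<open>The function constantly plus infinity is superharmonic in this sense.\<close>

definition superharmonic_on :: "complex set \<Rightarrow> (complex \<Rightarrow> ereal) \<Rightarrow> bool" where
  "superharmonic_on S \<omega> \<longleftrightarrow>
     (\<forall>z\<in>S. \<omega> z \<noteq> -\<infinity>) \<and> lsc_on S \<omega> \<and>
     (\<forall>z\<in>S. \<exists>R>0. ball z R \<subseteq> S \<and> (\<forall>r. 0 \<le> r \<and> r < R \<longrightarrow> circle_mean \<omega> z r \<le> \<omega> z))"

definition positive_superharmonic :: "(complex \<Rightarrow> ereal) \<Rightarrow> bool" where
  "positive_superharmonic \<omega> \<longleftrightarrow> superharmonic_on (ball 0 1) \<omega> \<and> (\<forall>z\<in>ball 0 1. 0 < \<omega> z)"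

text \<open>
  \<^term>\<open>uniform_measure lborel (ball (0::complex) 1)\<close> is the area measure on the unit disk
  normalized to total mass 1. Products follow the convention that 0 times infinity is 0.
\<close>

definition dirichlet_integral :: "(complex \<Rightarrow> ereal) \<Rightarrow> (complex \<Rightarrow> complex) \<Rightarrow> ennreal" where
  "dirichlet_integral \<omega> f =
     (\<integral>\<^sup>+z. ennreal ((cmod (deriv f z))\<^sup>2) * e2ennreal (\<omega> z) \<partial>uniform_measure lborel (ball 0 1))"

definition dirichlet_space :: "(complex \<Rightarrow> ereal) \<Rightarrow> (complex \<Rightarrow> complex) set" where
  "dirichlet_space \<omega> = {f. f holomorphic_on ball 0 1 \<and> dirichlet_integral \<omega> f < \<infinity>}"

text \<open>The norm is infinite outside the space, so convergence to 0 entails membership.\<close>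

definition dirichlet_norm :: "(complex \<Rightarrow> ereal) \<Rightarrow> (complex \<Rightarrow> complex) \<Rightarrow> ennreal" where
  "dirichlet_norm \<omega> f =
     (if dirichlet_integral \<omega> f = \<infinity> then \<infinity>
      else ennreal (sqrt ((cmod (f 0))\<^sup>2 + enn2real (dirichlet_integral \<omega> f))))"

definition psum :: "(nat \<Rightarrow> real) \<Rightarrow> nat \<Rightarrow> real" where
  "psum p n = (\<Sum>k\<le>n. p k)"

definition norlund_sum ::
  "(nat \<Rightarrow> real) \<Rightarrow> real \<Rightarrow> nat \<Rightarrow> (complex \<Rightarrow> complex) \<Rightarrow> complex \<Rightarrow> complex" where
  "norlund_sum p \<alpha> n f z =
     (\<Sum>k\<le>n. of_real (psum p (n - k) powr \<alpha>) * fps_nth (fps_expansion f 0) k * z ^ k)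
     / of_real (psum p n powr \<alpha>)"

definition norlund_weights :: "(nat \<Rightarrow> real) \<Rightarrow> bool" where
  "norlund_weights p \<longleftrightarrow> mono p \<and> (\<forall>n. 0 \<le> p n) \<and> (\<forall>n. 0 < psum p n)"

definition finite_upper_growth_rate :: "(nat \<Rightarrow> real) \<Rightarrow> bool" where
  "finite_upper_growth_rate p \<longleftrightarrow> limsup (\<lambda>n. ereal (real n * p n / psum p n)) < \<infinity>"

definition finite_lower_growth_rate :: "(nat \<Rightarrow> real) \<Rightarrow> bool" where
  "finite_lower_growth_rate p \<longleftrightarrow> liminf (\<lambda>n. ereal (real n * p n / psum p n)) < \<infinity>"

definition growth_condition :: "(nat \<Rightarrow> real) \<Rightarrow> bool" where
  "growth_condition p \<longleftrightarrow> 0 < liminf (\<lambda>n. ereal (psum p (n - 1) / psum p (2 * n)))"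

definition norlund_converges :: "(nat \<Rightarrow> real) \<Rightarrow> real \<Rightarrow> (complex \<Rightarrow> ereal) \<Rightarrow> bool" where
  "norlund_converges p \<alpha> \<omega> \<longleftrightarrow>
     (\<forall>f\<in>dirichlet_space \<omega>. (\<lambda>n. dirichlet_norm \<omega> (\<lambda>z. norlund_sum p \<alpha> n f z - f z)) \<longlonglongrightarrow> 0)"

end

theory Submission
  imports Defs
begin

text \<open>
  Let \<open>\<omega>\<close> be positive superharmonic. For a polynomial \<open>f\<close> with coefficients \<open>a\<^sub>k\<close> put
  \<open>b\<^sub>k(\<zeta>) = \<Sum>\<^bsub>j>k\<^esub> a\<^sub>j \<zeta>\<^sup>j\<^sup>-\<^sup>k\<^sup>-\<^sup>1\<close>. Then \<open>\<bar>f\<bar>\<^sup>2 + (1 - \<bar>\<zeta>\<bar>\<^sup>2) \<Sum> \<bar>b\<^sub>k\<bar>\<^sup>2\<close> is harmonic, so the second summand is the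
  Green potential of \<open>4 \<bar>f'\<bar>\<^sup>2\<close>. Hence a pointwise bound for \<open>\<Sum> \<bar>b\<^sub>k(\<zeta>)\<bar>\<^sup>2\<close> under a coefficient
  multiplier \<open>c\<close> passes to the weighted Dirichlet integral, by testing \<open>\<omega>\<close> against the difference of
  two such potentials; no Riesz decomposition of \<open>\<omega>\<close> is needed. Since \<open>c\<close> acts on the \<open>b\<^sub>k\<close> by a
  triangular matrix, its norm is at most \<open>sup \<bar>c\<^sub>k\<bar> + (\<Sum> j (c\<^sub>j\<^sub>+\<^sub>1 - c\<^sub>j)\<^sup>2)\<^sup>1\<^sup>/\<^sup>2\<close>. This is bounded for the
  multipliers \<open>(P\<^sub>n\<^sub>-\<^sub>k / P\<^sub>n)\<^sup>\<alpha>\<close> exactly because \<open>\<alpha> > 1/2\<close>, and it tends to 1 for logarithmic cutoffs,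
  which yields the density of polynomials and thus (i). Part (ii) is immediate from monotonicity. For
  \<open>\<alpha> \<le> 1/2\<close> the constant sequence and the Poisson kernel give a counterexample: the Dirichlet integral of
  \<open>(z - 1) g\<close> is then the squared Hardy norm of \<open>g\<close>, on which the multipliers are not uniformly bounded.
\<close>

section \<open>Circle means\<close>

text \<open>The \<open>b\<^sub>k(\<zeta>)\<close> are the coefficients in \<open>z\<close> of the
  difference quotient \<open>(f z - f \<zeta>) / (z - \<zeta>)\<close>, so for
  \<open>\<zeta>\<close> on the unit circle the sum of their squares is the local Dirichlet integral
  of \<open>f\<close> at \<open>\<zeta>\<close>. Testing works because a locally integrable
  superharmonic weight gives the Laplacian of a non-negative, compactly supported function a
  non-positive integral. Two obstacles shape the development. The mean value inequality is given
  only on circles whose admissible radius varies with the centre, without control, while testing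
  averages with one radius at all centres; hence the passage to every circle whose closed disk lies
  in the unit disk. Moreover \<omega> may be infinite on large sets. A non-constant \<open>f\<close>
  of finite Dirichlet integral forces \<omega> to be finite at a dense set of points, and with the
  mean inequality this makes it integrable on smaller disks; constants are treated apart. Uniform
  boundedness of the multipliers yields convergence only together with a dense set on which
  coefficientwise convergence suffices, hence the cutoffs.\<close>

definition circ :: "real measure" where
  "circ = density lborel (\<lambda>t. ennreal (indicator {0..2*pi} t / (2*pi)))"

lemma sets_circ [measurable_cong, simp]: "sets circ = sets borel"
  and space_circ [simp]: "space circ = UNIV"
  by (simp_all add: circ_def)

lemma borel_measurable_cis [measurable]: "cis \<in> borel_measurable borel"
  by (intro borel_measurable_continuous_onI continuous_intros)

lemma nn_integral_circ:
  assumes [measurable]: "f \<in> borel_measurable borel"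
  shows "(\<integral>\<^sup>+t. f t \<partial>circ) = (\<integral>\<^sup>+t\<in>{0..2*pi}. f t \<partial>lborel) / ennreal (2*pi)"
proof -
  have "(\<integral>\<^sup>+t. f t \<partial>circ) = (\<integral>\<^sup>+t. ennreal (1/(2*pi)) * (f t * indicator {0..2*pi} t) \<partial>lborel)"
    unfolding circ_def
    by (subst nn_integral_density) (auto intro!: nn_integral_cong simp: mult_ac split: split_indicator)
  also have "\<dots> = ennreal (1/(2*pi)) * (\<integral>\<^sup>+t\<in>{0..2*pi}. f t \<partial>lborel)"
    by (rule nn_integral_cmult) measurable
  also have "ennreal (1/(2*pi)) = 1 / ennreal (2*pi)"
    by (metis divide_ennreal ennreal_1 pi_gt_zero zero_le_one zero_less_mult_iff zero_less_numeral)
  finally show ?thesis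
    by (metis ennreal_times_divide mult.commute mult.right_neutral)
qed

lemma emeasure_circ: "emeasure circ UNIV = 1"
proof -
  have "emeasure circ UNIV = (\<integral>\<^sup>+t. 1 \<partial>circ)"
    by simp
  also have "\<dots> = (\<integral>\<^sup>+t\<in>{0..2*pi}. 1 \<partial>lborel) / ennreal (2*pi)"
    by (rule nn_integral_circ) simp
  also have "\<dots> = 1"
    by (simp add: ennreal_divide_self)
  finally show ?thesis .
qed

lemma finite_measure_circ: "finite_measure circ"
  by (rule finite_measureI) (simp add: emeasure_circ)

interpretation circ: finite_measure circ
  by (rule finite_measure_circ)

lemma measure_circ [simp]: "measure circ UNIV = 1"
  by (simp add: measure_def emeasure_circ)

lemma integrable_circ_bounded:
  fixes f :: "real \<Rightarrow> 'a::{banach, second_countable_topology}"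
  assumes "f \<in> borel_measurable borel" and "\<And>t. norm (f t) \<le> B"
  shows "integrable circ f"
  by (rule circ.integrable_const_bound[where B=B]) (simp_all add: assms measurable_cong_sets[OF sets_circ refl])

section \<open>Fourier coefficients and Parseval's identity on circles\<close>

lemma integral_circ_cis:
  "(\<integral>t. cis (of_int k * t) \<partial>circ) = (if k = 0 then 1 else 0)"
proof (cases "k = 0")
  case True
  have "(\<integral>t. 1 \<partial>circ) = (1::complex)"
    by (simp only: lebesgue_integral_const space_circ measure_circ scaleR_one)
  then show ?thesis
    by (simp only: True of_int_0 mult_zero_left cis_zero if_True refl)
next
  case False
  have "(\<integral>t. cis (of_int k * t) \<partial>circ)
      = (\<integral>t. (1/(2*pi)) *\<^sub>R (indicator {0..2*pi} t *\<^sub>R cis (of_int k * t)) \<partial>lborel)"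
    unfolding circ_def
    by (subst integral_density) (auto intro!: Bochner_Integration.integral_cong split: split_indicator)
  also have "\<dots> = (1/(2*pi)) *\<^sub>R (\<integral>t. indicator {0..2*pi} t *\<^sub>R cis (of_int k * t) \<partial>lborel)"
    by (rule integral_scaleR_right)
  also have "(\<integral>t. indicator {0..2*pi} t *\<^sub>R cis (of_int k * t) \<partial>lborel)
      = cis (of_int k * (2*pi)) / (\<i> * of_int k) - cis (of_int k * 0) / (\<i> * of_int k)"
  proof (rule integral_FTC_Icc)
    fix t :: real
    define c :: complex where "c = \<i> * of_int k"
    have [simp]: "c \<noteq> 0" using False by (simp add: c_def)
    have "((\<lambda>w. exp (c * w) / c) has_field_derivative exp (c * of_real t))
            (at (of_real t))"
      by (auto intro!: derivative_eq_intros)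
    from has_vector_derivative_real_field[OF this]
    show "((\<lambda>t. cis (of_int k * t) / (\<i> * of_int k)) has_vector_derivative cis (of_int k * t))
            (at t within {0..2*pi})"
      by (simp add: o_def c_def cis_conv_exp mult_ac)
  qed (auto intro!: continuous_intros)
  also have "\<dots> = 0"
    using cis_multiple_2pi[of "of_int k"] by (simp add: mult_ac)
  finally show ?thesis
    using False by simp
qed

lemma abs_summable_cis_bound:
  fixes e :: "nat \<Rightarrow> complex"
  assumes "summable (\<lambda>k. norm (e k))"
  shows "norm (\<Sum>k<n. e k * cis (real k * t)) \<le> (\<Sum>k. norm (e k))"
    and "(\<lambda>n. \<Sum>k<n. e k * cis (real k * t)) \<longlonglongrightarrow> (\<Sum>k. e k * cis (real k * t))"
proof -
  have "norm (\<Sum>k<n. e k * cis (real k * t)) \<le> (\<Sum>k<n. norm (e k))"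
    by (rule order_trans[OF norm_sum]) (simp add: norm_mult)
  also have "\<dots> \<le> (\<Sum>k. norm (e k))"
    using assms by (intro sum_le_suminf) auto
  finally show "norm (\<Sum>k<n. e k * cis (real k * t)) \<le> (\<Sum>k. norm (e k))" .
  have "summable (\<lambda>k. norm (e k * cis (real k * t)))"
    using assms by (simp add: norm_mult)
  then show "(\<lambda>n. \<Sum>k<n. e k * cis (real k * t)) \<longlonglongrightarrow> (\<Sum>k. e k * cis (real k * t))"
    by (rule summable_LIMSEQ[OF summable_norm_cancel])
qed

lemma integral_circ_cis_nat:
  "(\<integral>t. cis (real k * t) \<partial>circ) = (if k = 0 then 1 else 0)"
  using integral_circ_cis[of "int k"] by (simp only: of_int_of_nat_eq of_nat_eq_0_iff)

lemma integrable_circ_cis [simp]: "integrable circ (\<lambda>t. c * cis (a * t))"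
proof (rule integrable_circ_bounded)
  show "norm (c * cis (a * t)) \<le> norm c" for t
    by (simp add: norm_mult)
qed measurable

lemma circ_fourier_mean:
  assumes "summable (\<lambda>k. norm (e k))"
  shows "(\<integral>t. (\<Sum>k. e k * cis (real k * t)) \<partial>circ) = e 0"
proof -
  have "(\<lambda>n. \<integral>t. (\<Sum>k<n. e k * cis (real k * t)) \<partial>circ)
          \<longlonglongrightarrow> (\<integral>t. (\<Sum>k. e k * cis (real k * t)) \<partial>circ)"
  proof (rule integral_dominated_convergence[where w="\<lambda>_. \<Sum>k. norm (e k)"])
    show "(\<lambda>t. \<Sum>k. e k * cis (real k * t)) \<in> borel_measurable circ"
      by measurable
    show "(\<lambda>t. \<Sum>k<n. e k * cis (real k * t)) \<in> borel_measurable circ" for n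
      by measurable
  qed (simp_all add: abs_summable_cis_bound[OF assms])
  moreover have "\<forall>\<^sub>F n in sequentially. (\<integral>t. (\<Sum>k<n. e k * cis (real k * t)) \<partial>circ) = e 0"
    using eventually_gt_at_top[of 0]
  proof eventually_elim
    case (elim n)
    have "(\<integral>t. (\<Sum>k<n. e k * cis (real k * t)) \<partial>circ) = (\<Sum>k<n. if k = 0 then e k else 0)"
      by (subst Bochner_Integration.integral_sum) (auto simp: integral_circ_cis_nat if_distrib cong: if_cong intro!: sum.cong)
    also have "\<dots> = e 0"
      using elim by (simp add: sum.delta)
    finally show ?case .
  qed
  ultimately show ?thesis
    by (intro LIMSEQ_unique[OF _ tendsto_eventually])
qed

lemma circ_parseval_finite:
  "(\<integral>t. (cmod (\<Sum>k<n. e k * cis (real k * t)))\<^sup>2 \<partial>circ) = (\<Sum>k<n. (cmod (e k))\<^sup>2)"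
proof -
  have "complex_of_real (\<integral>t. (cmod (\<Sum>k<n. e k * cis (real k * t)))\<^sup>2 \<partial>circ)
      = (\<integral>t. (\<Sum>j<n. \<Sum>k<n. e j * cnj (e k) * cis (of_int (int j - int k) * t)) \<partial>circ)"
    unfolding integral_complex_of_real[symmetric] complex_norm_square of_real_power[symmetric]
  proof (intro Bochner_Integration.integral_cong refl)
    fix t
    have *: "cis (real j * t) * cis (- (real k * t)) = cis (of_int (int j - int k) * t)" for j k
      by (simp add: cis_mult left_diff_distrib)
    show "(\<Sum>k<n. e k * cis (real k * t)) * cnj (\<Sum>k<n. e k * cis (real k * t))
        = (\<Sum>j<n. \<Sum>k<n. e j * cnj (e k) * cis (of_int (int j - int k) * t))"
      unfolding cnj_sum sum_product complex_cnj_mult cis_cnj *[symmetric]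
      by (intro sum.cong refl) (simp only: mult_ac)
  qed
  also have "\<dots> = (\<Sum>j<n. \<Sum>k<n. if j = k then e j * cnj (e k) else 0)"
    by (simp only: Bochner_Integration.integral_sum Bochner_Integration.integrable_sum integrable_circ_cis
          integral_mult_right_zero integral_circ_cis of_int_eq_0_iff right_minus_eq of_nat_eq_iff if_distrib
          mult_1_right mult_zero_right)
  also have "\<dots> = (\<Sum>k<n. e k * cnj (e k))"
    by (intro sum.cong) (simp_all add: sum.delta)
  also have "\<dots> = complex_of_real (\<Sum>k<n. (cmod (e k))\<^sup>2)"
    by (simp only: complex_norm_square of_real_sum)
  finally show ?thesis
    by (rule of_real_eq_iff[THEN iffD1])
qed

lemma summable_norm_square:
  fixes e :: "nat \<Rightarrow> 'a::real_normed_vector"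
  assumes "summable (\<lambda>k. norm (e k))"
  shows "summable (\<lambda>k. (norm (e k))\<^sup>2)"
proof (rule summable_comparison_test_ev[OF _ assms])
  have "\<forall>\<^sub>F k in sequentially. norm (e k) < 1"
    using summable_LIMSEQ_zero[OF assms] by (intro order_tendstoD) auto
  then show "\<forall>\<^sub>F k in sequentially. norm ((norm (e k))\<^sup>2) \<le> norm (e k)"
    by eventually_elim (auto simp: power2_eq_square mult_left_le)
qed

lemma circ_parseval:
  assumes "summable (\<lambda>k. norm (e k))"
  shows "(\<integral>t. (cmod (\<Sum>k. e k * cis (real k * t)))\<^sup>2 \<partial>circ) = (\<Sum>k. (cmod (e k))\<^sup>2)"
proof -
  have "(\<lambda>n. \<integral>t. (cmod (\<Sum>k<n. e k * cis (real k * t)))\<^sup>2 \<partial>circ)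
          \<longlonglongrightarrow> (\<integral>t. (cmod (\<Sum>k. e k * cis (real k * t)))\<^sup>2 \<partial>circ)"
  proof (rule integral_dominated_convergence[where w="\<lambda>_. (\<Sum>k. norm (e k))\<^sup>2"])
    show "(\<lambda>t. (cmod (\<Sum>k. e k * cis (real k * t)))\<^sup>2) \<in> borel_measurable circ"
      by measurable
    show "(\<lambda>t. (cmod (\<Sum>k<n. e k * cis (real k * t)))\<^sup>2) \<in> borel_measurable circ" for n
      by measurable
    show "AE t in circ. (\<lambda>n. (cmod (\<Sum>k<n. e k * cis (real k * t)))\<^sup>2)
            \<longlonglongrightarrow> (cmod (\<Sum>k. e k * cis (real k * t)))\<^sup>2"
      by (intro AE_I2 tendsto_power tendsto_norm abs_summable_cis_bound[OF assms])
    show "AE t in circ. norm ((cmod (\<Sum>k<n. e k * cis (real k * t)))\<^sup>2) \<le> (\<Sum>k. norm (e k))\<^sup>2" for n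
      using abs_summable_cis_bound(1)[OF assms] by (intro AE_I2) (simp add: power_mono)
  qed simp
  moreover have "(\<lambda>n. \<Sum>k<n. (cmod (e k))\<^sup>2) \<longlonglongrightarrow> (\<Sum>k. (cmod (e k))\<^sup>2)"
    using summable_norm_square[OF assms] by (rule summable_LIMSEQ)
  ultimately show ?thesis
    unfolding circ_parseval_finite by (rule LIMSEQ_unique)
qed

lemma holomorphic_circle_expansion:
  assumes f: "f holomorphic_on ball z R" and c: "norm c < R"
  defines "e \<equiv> \<lambda>k. (deriv ^^ k) f z / fact k * c ^ k"
  shows "summable (\<lambda>k. norm (e k))"
    and "f (z + c * cis t) = (\<Sum>k. e k * cis (real k * t))"
proof -
  \<comment> \<open>Convergence at a radius strictly between \<open>norm c\<close> and
    \<open>R\<close> gives absolute convergence at \<open>c\<close>.\<close>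
  define s where "s = (norm c + R) / 2"
  have s: "norm c < s" "s < R" using c by (auto simp: s_def)
  then have "0 \<le> s" by (meson less_imp_le norm_ge_zero order_trans)
  have "(\<lambda>k. (deriv ^^ k) f z / fact k * (z + of_real s - z) ^ k) sums f (z + of_real s)"
    by (rule holomorphic_power_series[OF f]) (use s \<open>0 \<le> s\<close> in \<open>simp add: dist_norm\<close>)
  then have "summable (\<lambda>k. (deriv ^^ k) f z / fact k * of_real s ^ k)"
    by (simp add: sums_iff)
  then show "summable (\<lambda>k. norm (e k))"
    unfolding e_def by (rule powser_insidea) (use s \<open>0 \<le> s\<close> in simp)
  have "(\<lambda>k. (deriv ^^ k) f z / fact k * (z + c * cis t - z) ^ k) sums f (z + c * cis t)"
    by (rule holomorphic_power_series[OF f]) (use c in \<open>simp add: dist_norm norm_mult\<close>)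
  then show "f (z + c * cis t) = (\<Sum>k. e k * cis (real k * t))"
    by (simp add: sums_iff e_def power_mult_distrib Complex.DeMoivre mult.assoc)
qed

lemma holomorphic_circle_mean:
  assumes "f holomorphic_on ball z R" "norm c < R"
  shows "(\<integral>t. f (z + c * cis t) \<partial>circ) = f z"
  unfolding holomorphic_circle_expansion(2)[OF assms]
  by (subst circ_fourier_mean[OF holomorphic_circle_expansion(1)[OF assms]]) simp

lemma suminf_split2:
  fixes c :: "nat \<Rightarrow> real"
  assumes "summable c"
  shows "suminf c = c 0 + c 1 + (\<Sum>k. c (k + 2))"
  using suminf_split_initial_segment[OF assms, of 2] by (simp add: numeral_2_eq_2)

text \<open>Parseval on the circle of radius \<open>r\<close>: the terms of order 0 and 1 are kept,
  the others are non-negative. With the next lemma this expresses the Laplacian of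
  \<open>\<bar>f\<bar>\<^sup>2\<close> through second-order differences of circle means.\<close>

lemma circle_mean_square_lower:
  assumes f: "f holomorphic_on ball z R" and r: "0 \<le> r" "r < R"
  shows "(cmod (f z))\<^sup>2 + r\<^sup>2 * (cmod (deriv f z))\<^sup>2 \<le> (\<integral>t. (cmod (f (z + of_real r * cis t)))\<^sup>2 \<partial>circ)"
proof -
  have "norm (of_real r :: complex) < R" using r by simp
  note e = holomorphic_circle_expansion[OF f this]
  have "0 \<le> (\<Sum>k. (cmod ((deriv ^^ (k + 2)) f z / fact (k + 2) * of_real r ^ (k + 2)))\<^sup>2)"
    using summable_norm_square[OF e(1)] 
    by (intro suminf_nonneg summable_ignore_initial_segment[where k=2]) auto
  with r show ?thesis
    unfolding e(2) circ_parseval[OF e(1)] suminf_split2[OF summable_norm_square[OF e(1)]]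
    by (simp add: norm_mult power_mult_distrib mult.commute)
qed

text \<open>From order 2 on, Parseval's terms scale by at least \<open>r ^ 4\<close> when passing
  from radius 1 to \<open>r \<le> 1\<close>. The remainder is thus controlled by the mean at radius
  1, uniformly in \<open>z\<close> on bounded sets.\<close>

lemma circle_mean_square_upper:
  assumes f: "f holomorphic_on ball z R" and r: "0 \<le> r" "r \<le> 1" "1 < R"
  shows "(\<integral>t. (cmod (f (z + of_real r * cis t)))\<^sup>2 \<partial>circ)
    \<le> (cmod (f z))\<^sup>2 + r\<^sup>2 * (cmod (deriv f z))\<^sup>2 + r ^ 4 * (\<integral>t. (cmod (f (z + cis t)))\<^sup>2 \<partial>circ)"
proof -
  define e where "e k = (deriv ^^ k) f z / fact k" for k
  have er: "summable (\<lambda>k. norm (e k * of_real r ^ k))"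
    "\<And>t. f (z + of_real r * cis t) = (\<Sum>k. e k * of_real r ^ k * cis (real k * t))"
    using holomorphic_circle_expansion[OF f, of "of_real r", folded e_def] r by auto
  have e1: "summable (\<lambda>k. norm (e k))"
    "\<And>t. f (z + cis t) = (\<Sum>k. e k * cis (real k * t))"
    using holomorphic_circle_expansion[OF f, of 1, folded e_def] r by auto
  note s1 = summable_norm_square[OF e1(1)]
  note sr = summable_norm_square[OF er(1)]
  have "(\<Sum>k. (cmod (e (k + 2) * of_real r ^ (k + 2)))\<^sup>2) \<le> (\<Sum>k. r ^ 4 * (cmod (e (k + 2)))\<^sup>2)"
  proof (rule suminf_le)
    fix k
    have "r ^ (2 * (k + 2)) \<le> r ^ 4"
      by (rule power_decreasing) (use r in auto)
    then show "(cmod (e (k + 2) * of_real r ^ (k + 2)))\<^sup>2 \<le> r ^ 4 * (cmod (e (k + 2)))\<^sup>2"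
      using r mult_right_mono[of "r ^ (2 * (k + 2))" "r ^ 4" "(cmod (e (k + 2)))\<^sup>2"]
      by (simp add: norm_mult norm_power power_mult_distrib power_mult[symmetric] mult.commute del: power_Suc add_2_eq_Suc')
  qed (intro summable_mult summable_ignore_initial_segment[OF s1] summable_ignore_initial_segment[OF sr])+
  also have "\<dots> = r ^ 4 * (\<Sum>k. (cmod (e (k + 2)))\<^sup>2)"
    by (rule suminf_mult) (rule summable_ignore_initial_segment[OF s1])
  also have "\<dots> \<le> r ^ 4 * (\<Sum>k. (cmod (e k))\<^sup>2)"
    using suminf_split2[OF s1] r by (intro mult_left_mono) auto
  finally show ?thesis
    unfolding er(2) e1(2) circ_parseval[OF er(1)] circ_parseval[OF e1(1)] suminf_split2[OF sr]
    using r by (simp add: e_def norm_mult power_mult_distrib mult.commute)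
qed

section \<open>From local to global mean value inequalities\<close>

text \<open>On the circle \<open>z * cnj z = 1\<close>, so splitting off both constant coefficients
  leaves a mixed product of lower degree. The cross terms are polynomials or conjugates of
  polynomials, and a conjugate has the same real part.\<close>

lemma Re_poly_mult_cnj_on_circle:
  fixes p q :: "complex poly"
  shows "\<exists>s. \<forall>z. cmod z = 1 \<longrightarrow> Re (poly p z * cnj (poly q z)) = Re (poly s z)"
proof (induction p arbitrary: q)
  case 0
  then show ?case by (intro exI[of _ 0]) simp
next
  case (pCons a p)
  obtain b q' where q: "q = pCons b q'" by (cases q)
  obtain s where s: "\<And>z. cmod z = 1 \<Longrightarrow> Re (poly p z * cnj (poly q' z)) = Re (poly s z)"
    using pCons.IH[of q'] by blast
  define s' where "s' = [:a * cnj b:] + pCons 0 (smult (cnj a) q') + pCons 0 (smult (cnj b) p) + s"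
  show ?case
  proof (intro exI[of _ s'] allI impI)
    fix z :: complex assume z: "cmod z = 1"
    have zz: "z * cnj z = 1"
      using z by (simp flip: complex_norm_square)
    have "poly (pCons a p) z * cnj (poly q z)
        = a * cnj b + cnj (cnj a * (z * poly q' z)) + cnj b * (z * poly p z)
          + (z * cnj z) * (poly p z * cnj (poly q' z))"
      by (simp add: q algebra_simps)
    then show "Re (poly (pCons a p) z * cnj (poly q z)) = Re (poly s' z)"
      unfolding zz using s[OF z] by (simp add: s'_def algebra_simps)
  qed
qed

lemma real_polynomial_function_on_circle:
  fixes g :: "complex \<Rightarrow> real"
  assumes "real_polynomial_function g"
  shows "\<exists>q. \<forall>z. cmod z = 1 \<longrightarrow> g z = Re (poly q z)"
  using assms
proof induction
  case (linear f)
  \<comment> \<open>A real-linear form is \<open>Re (c * z)\<close> with \<open>Re c = f 1\<close>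
    and \<open>Im c = - f \<i>\<close>.\<close>
  have "f z = Re (poly [:0, Complex (f 1) (- f \<i>):] z)" for z
  proof -
    have "f z = f (Re z *\<^sub>R 1 + Im z *\<^sub>R \<i>)"
      by (rule arg_cong[where f=f]) (simp add: complex_eq_iff)
    also have "\<dots> = Re z * f 1 + Im z * f \<i>"
      using linear by (simp add: bounded_linear.linear linear_add linear_cmul)
    finally show ?thesis by simp
  qed
  then show ?case by blast
next
  case (const c)
  show ?case by (intro exI[of _ "[:of_real c:]"]) simp
next
  case (add f g)
  then obtain p q where "\<forall>z. cmod z = 1 \<longrightarrow> f z = Re (poly p z)" "\<forall>z. cmod z = 1 \<longrightarrow> g z = Re (poly q z)"
    by blast
  then show ?case by (intro exI[of _ "p + q"]) simp
next
  case (mult f g)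
  then obtain p q where pq: "\<forall>z. cmod z = 1 \<longrightarrow> f z = Re (poly p z)" "\<forall>z. cmod z = 1 \<longrightarrow> g z = Re (poly q z)"
    by blast
  obtain s where s: "\<forall>z. cmod z = 1 \<longrightarrow> Re (poly p z * cnj (poly q z)) = Re (poly s z)"
    using Re_poly_mult_cnj_on_circle by blast
  \<comment> \<open>Products of real parts reduce to one product of polynomials and one with a
    conjugate, which the previous lemma handles.\<close>
  have half: "Re x * Re y = Re (1 / 2 * (x * y)) + Re (x * cnj y) / 2" for x y
    by (simp add: field_simps)
  show ?case
  proof (intro exI[of _ "smult (1/2) (p * q + s)"] allI impI)
    fix z :: complex assume z: "cmod z = 1"
    have "f z * g z = Re (1 / 2 * (poly p z * poly q z)) + Re (poly s z) / 2"
      using pq s z half[of "poly p z" "poly q z"] by simp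
    then show "f z * g z = Re (poly (smult (1 / 2) (p * q + s)) z)"
      by (simp add: algebra_simps)
  qed
qed

text \<open>Approximate solution of the Dirichlet problem: boundary data are replaced by real parts
  of polynomials, whose harmonic extension is evident.\<close>

lemma continuous_approx_Re_poly_on_circle:
  fixes h :: "complex \<Rightarrow> real"
  assumes "continuous_on (sphere 0 1) h" "0 < e"
  obtains q where "\<And>z. cmod z = 1 \<Longrightarrow> \<bar>h z - Re (poly q z)\<bar> < e"
proof -
  obtain g where g: "real_polynomial_function g" "\<And>z. z \<in> sphere 0 1 \<Longrightarrow> \<bar>h z - g z\<bar> < e"
    using Stone_Weierstrass_real_polynomial_function[OF compact_sphere assms] by blast
  obtain q where "\<forall>z. cmod z = 1 \<longrightarrow> g z = Re (poly q z)"
    using real_polynomial_function_on_circle[OF g(1)] by blast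
  with g(2) show ?thesis
    by (intro that[of q]) (metis dist_0_norm mem_sphere)
qed

text \<open>If no point of \<open>K\<close> were minimal, the open sets
  \<open>{z. u w < u z}\<close> with \<open>w\<close> in \<open>K\<close> would cover
  \<open>K\<close>; in a finite subcover the index with the least value of \<open>u\<close> would
  remain uncovered.\<close>

lemma lsc_attains_inf:
  fixes u :: "'a::topological_space \<Rightarrow> 'b::linorder"
  assumes "\<And>c. open {z. c < u z}" "compact K" "K \<noteq> {}"
  shows "\<exists>z\<in>K. \<forall>w\<in>K. u z \<le> u w"
proof (rule ccontr)
  assume "\<not> ?thesis"
  then have "\<forall>z\<in>K. \<exists>w\<in>K. u w < u z"
    by (simp add: not_le)
  then have "K \<subseteq> (\<Union>w\<in>K. {z. u w < u z})"
    by blast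
  then obtain F where F: "F \<subseteq> K" "finite F" "K \<subseteq> (\<Union>w\<in>F. {z. u w < u z})"
    using compactE_image[OF assms(2), of K "\<lambda>w. {z. u w < u z}"] assms(1) by metis
  with assms(3) have "F \<noteq> {}" by blast
  then obtain m where m: "m \<in> F" "\<And>w. w \<in> F \<Longrightarrow> u m \<le> u w"
    using F(2) ex_is_arg_min_if_finite[of F u] by (auto simp: is_arg_min_linorder)
  then show False
    using F by fastforce
qed

lemma open_less_diff_continuous:
  fixes v g :: "'a::topological_space \<Rightarrow> real"
  assumes "\<And>c. open {z. c < v z}" "continuous_on UNIV g"
  shows "open {z. c < v z - g z}"
proof -
  have "{z. c < v z - g z} = (\<Union>t. {z. t < v z} \<inter> {z. c + g z < t})"
  proof (intro set_eqI iffI)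
    fix z assume "z \<in> {z. c < v z - g z}"
    then have "c + g z < v z" by simp
    then obtain t where "c + g z < t" "t < v z"
      using dense by blast
    then show "z \<in> (\<Union>t. {z. t < v z} \<inter> {z. c + g z < t})" by auto
  qed auto
  moreover have "open {z. c + g z < t}" for t
    by (intro open_Collect_less continuous_intros assms)
  ultimately show ?thesis
    using assms(1) by (simp only:) (intro open_UN ballI open_Int)
qed

lemma lsc_borel_measurable:
  fixes v :: "'a::topological_space \<Rightarrow> 'b::{second_countable_topology, linorder_topology}"
  assumes "\<And>c. open {z. c < v z}"
  shows "v \<in> borel_measurable borel"
  by (rule borel_measurableI_greater) (use assms in simp)

text \<open>The perturbation by a multiple of the squared distance to the center makes the mean value
  inequality strict, so the minimum over the disk is attained on the circle.\<close>

lemma local_mean_minimum_principle: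
  fixes v :: "complex \<Rightarrow> real"
  assumes lsc: "\<And>c. open {z. c < v z}" and bd: "\<And>z. 0 \<le> v z" "\<And>z. v z \<le> M"
    and loc: "\<And>z. z \<in> S \<Longrightarrow> \<exists>R>0. \<forall>r. 0 \<le> r \<and> r < R \<longrightarrow> (\<integral>t. v (z + of_real r * cis t) \<partial>circ) \<le> v z"
    and S: "cball a \<rho> \<subseteq> S" "0 < \<rho>"
    and Q: "Q holomorphic_on UNIV" and \<eta>: "0 < \<eta>"
    and le: "\<And>z. z \<in> sphere a \<rho> \<Longrightarrow> Re (Q z) + \<eta> \<le> v z"
  shows "Re (Q a) \<le> v a"
proof -
  \<comment> \<open>On the boundary circle the perturbation then equals the available slack
    \<eta>.\<close>
  define \<delta> where "\<delta> = \<eta> / \<rho>\<^sup>2"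
  have \<delta>: "0 < \<delta>" "\<delta> * \<rho>\<^sup>2 = \<eta>" using \<eta> S by (auto simp: \<delta>_def)
  define g where "g z = Re (Q z) + \<delta> * (cmod (z - a))\<^sup>2" for z
  have contQ: "continuous_on UNIV Q"
    using Q by (rule holomorphic_on_imp_continuous_on)
  have "\<exists>z\<in>cball a \<rho>. \<forall>w\<in>cball a \<rho>. v z - g z \<le> v w - g w"
  proof (rule lsc_attains_inf)
    show "open {z. c < v z - g z}" for c
      unfolding g_def by (intro open_less_diff_continuous lsc continuous_intros contQ)
  qed (use S in auto)
  then obtain z where z: "z \<in> cball a \<rho>" "\<And>w. w \<in> cball a \<rho> \<Longrightarrow> v z - g z \<le> v w - g w"
    by blast
  have ga: "v z - g z \<le> v a - Re (Q a)"
    using z(2)[of a] S by (simp add: g_def)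
  show ?thesis
  proof (cases "z \<in> sphere a \<rho>")
    case True
    then have "cmod (z - a) = \<rho>" by (simp add: dist_norm norm_minus_commute)
    then show ?thesis
      using le[OF True] ga \<delta> by (simp add: g_def)
  next
    case False
    with z(1) have zb: "dist a z < \<rho>" by auto
    obtain R where R: "0 < R" "\<And>r. 0 \<le> r \<Longrightarrow> r < R \<Longrightarrow> (\<integral>t. v (z + of_real r * cis t) \<partial>circ) \<le> v z"
      using loc[of z] z(1) S by blast
    define r where "r = min (R / 2) (\<rho> - dist a z)"
    have r: "0 < r" "r < R" "r \<le> \<rho> - dist a z" using R zb by (auto simp: r_def)
    have circle: "z + of_real r * cis t \<in> cball a \<rho>" for t
    proof -
      have "dist a (z + of_real r * cis t) \<le> dist a z + dist z (z + of_real r * cis t)"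
        by (rule dist_triangle)
      also have "dist z (z + of_real r * cis t) = r"
        using r by (simp add: dist_norm norm_mult)
      finally show ?thesis using r by simp
    qed
    have [measurable]: "v \<in> borel_measurable borel" "Q \<in> borel_measurable borel"
      using lsc_borel_measurable[OF lsc] borel_measurable_continuous_onI[OF contQ] by auto
    have "bounded (Q ` cball a \<rho>)"
      by (intro compact_imp_bounded compact_continuous_image continuous_on_subset[OF contQ]) auto
    then obtain B where B: "\<And>w. w \<in> cball a \<rho> \<Longrightarrow> norm (Q w) \<le> B"
      unfolding bounded_iff by blast
    have intQ: "integrable circ (\<lambda>t. Q (z + of_real r * cis t))"
      by (rule integrable_circ_bounded[where B=B]) (use B circle in auto)
    have intD: "integrable circ (\<lambda>t. (cmod (z + of_real r * cis t - a))\<^sup>2)"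
    proof (rule integrable_circ_bounded[where B="\<rho>\<^sup>2"])
      show "norm ((cmod (z + complex_of_real r * cis t - a))\<^sup>2) \<le> \<rho>\<^sup>2" for t
        using circle[of t] by (auto simp: dist_norm norm_minus_commute intro!: power_mono)
    qed measurable
    have intv: "integrable circ (\<lambda>t. v (z + of_real r * cis t))"
      by (rule integrable_circ_bounded[where B=M]) (use bd in auto)
    have "(\<integral>t. Q (z + of_real r * cis t) \<partial>circ) = Q z"
      by (rule holomorphic_circle_mean[of _ _ "r + 1"]) (use Q r in \<open>auto intro: holomorphic_on_subset\<close>)
    then have mQ: "(\<integral>t. Re (Q (z + of_real r * cis t)) \<partial>circ) = Re (Q z)"
      using integral_Re[OF intQ] by simp
    have "(cmod (z - a))\<^sup>2 + r\<^sup>2 * (cmod (deriv (\<lambda>z. z - a) z))\<^sup>2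
         \<le> (\<integral>t. (cmod (z + of_real r * cis t - a))\<^sup>2 \<partial>circ)"
      by (rule circle_mean_square_lower[of _ _ "r + 1"]) (use r in \<open>auto intro!: holomorphic_intros\<close>)
    moreover have "deriv (\<lambda>z. z - a) z = 1"
      by (intro DERIV_imp_deriv) (auto intro!: derivative_eq_intros)
    ultimately have mD: "(cmod (z - a))\<^sup>2 + r\<^sup>2 \<le> (\<integral>t. (cmod (z + of_real r * cis t - a))\<^sup>2 \<partial>circ)"
      by simp
    \<comment> \<open>Averaging \<open>v \<ge> g + (v z - g z)\<close> over a small circle about an
      interior minimum gains \<delta> times the squared radius, against the mean value inequality
      for \<open>v\<close>: this case is contradictory.\<close>
    have "v z - g z + (Re (Q z) + \<delta> * ((cmod (z - a))\<^sup>2 + r\<^sup>2))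
        \<le> (\<integral>t. (v z - g z) + (Re (Q (z + of_real r * cis t)) + \<delta> * (cmod (z + of_real r * cis t - a))\<^sup>2) \<partial>circ)"
      using intQ intD mD mQ \<delta> by simp
    also have "\<dots> \<le> (\<integral>t. v (z + of_real r * cis t) \<partial>circ)"
      using intQ intD intv z(2)[OF circle] by (intro integral_mono) (auto simp: g_def algebra_simps)
    also have "\<dots> \<le> v z"
      using R r by simp
    finally have "\<delta> * r\<^sup>2 \<le> 0"
      by (simp add: g_def algebra_simps)
    with \<delta> r show ?thesis
      by (simp add: mult_le_0_iff)
  qed
qed

text \<open>Inf-convolution with a multiple of the distance approximates a bounded lower semicontinuous
  function from below by Lipschitz functions.\<close>

lemma lsc_Lipschitz_approx:
  fixes v :: "'a::metric_space \<Rightarrow> real"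
  assumes lsc: "\<And>c. open {z. c < v z}" and bd: "\<And>z. 0 \<le> v z" "\<And>z. v z \<le> M"
  obtains h :: "nat \<Rightarrow> 'a \<Rightarrow> real" where
    "\<And>n. continuous_on UNIV (h n)" "\<And>n z. 0 \<le> h n z" "\<And>n z. h n z \<le> v z" "\<And>z. (\<lambda>n. h n z) \<longlonglongrightarrow> v z"
proof -
  define h where "h n z = (INF w. v w + real n * dist z w)" for n z
  have bdd: "bdd_below (range (\<lambda>w. v w + real n * dist z w))" for n z
    using bd by (intro bdd_belowI[of _ 0]) auto
  have nonneg: "0 \<le> h n z" for n z
    unfolding h_def using bd by (intro cINF_greatest) auto
  have le: "h n z \<le> v z" for n z
    using cINF_lower[OF bdd[of n z], of z] by (simp add: h_def)
  have lip: "h n z \<le> h n z' + real n * dist z z'" for n z z'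
  proof -
    have "h n z - real n * dist z z' \<le> h n z'"
      unfolding h_def[of n z']
    proof (rule cINF_greatest)
      fix w
      have "h n z \<le> v w + real n * dist z w"
        unfolding h_def by (rule cINF_lower[OF bdd]) simp
      also have "\<dots> \<le> v w + real n * (dist z z' + dist z' w)"
        by (intro add_left_mono mult_left_mono dist_triangle) auto
      finally show "h n z - real n * dist z z' \<le> v w + real n * dist z' w"
        by (simp add: algebra_simps)
    qed simp
    then show ?thesis by simp
  qed
  have "continuous_on UNIV (h n)" for n
  proof (rule lipschitz_on_continuous_on[OF lipschitz_onI])
    show "dist (h n z) (h n z') \<le> real n * dist z z'" for z z'
      using lip[of n z z'] lip[of n z' z] by (auto simp: dist_real_def dist_commute)
  qed simp
  moreover have "(\<lambda>n. h n z) \<longlonglongrightarrow> v z" for z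
  proof (rule LIMSEQ_I)
    fix e :: real assume e: "0 < e"
    have "\<exists>d>0. \<forall>w. dist w z < d \<longrightarrow> v z - e / 2 < v w"
      using lsc[of "v z - e / 2"] e unfolding open_dist by auto
    then obtain d where d: "0 < d" "\<And>w. dist w z < d \<Longrightarrow> v z - e / 2 < v w"
      by blast
    \<comment> \<open>With this slope the distance term alone exceeds the bound \<open>M\<close>
      outside the ball of radius \<open>d\<close>.\<close>
    obtain N :: nat where N: "M / d < real N"
      using reals_Archimedean2 by blast
    have "norm (h n z - v z) < e" if "N \<le> n" for n
    proof -
      have "v z - e / 2 \<le> h n z"
        unfolding h_def
      proof (rule cINF_greatest)
        fix w
        show "v z - e / 2 \<le> v w + real n * dist z w"
        proof (cases "dist w z < d")
          case True
          then show ?thesis using d(2)[OF True] by (simp add: add_increasing2 less_imp_le)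
        next
          case False
          have "M \<le> real N * d" using N d by (simp add: divide_less_eq less_imp_le)
          also have "\<dots> \<le> real n * dist z w"
            using False that d by (intro mult_mono) (auto simp: dist_commute)
          finally show ?thesis using bd(1)[of w] bd(2)[of z] e by linarith
        qed
      qed simp
      with le[of n z] e show ?thesis by auto
    qed
    then show "\<exists>N. \<forall>n\<ge>N. norm (h n z - v z) < e" by blast
  qed
  ultimately show ?thesis using that nonneg le by blast
qed

text \<open>A harmonic \<open>Re Q\<close> whose values on the large circle lie slightly below a
  Lipschitz minorant of \<open>v\<close> stays below \<open>v\<close> at the centre by the minimum
  principle. Its central value is its circle mean, which is within \<open>e\<close> of the mean of
  the minorant.\<close>

lemma local_mean_imp_global_mean_bounded:
  fixes v :: "complex \<Rightarrow> real" and c :: complex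
  assumes lsc: "\<And>x. open {z. x < v z}" and bd: "\<And>z. 0 \<le> v z" "\<And>z. v z \<le> M"
    and loc: "\<And>z. z \<in> S \<Longrightarrow> \<exists>R>0. \<forall>r. 0 \<le> r \<and> r < R \<longrightarrow> (\<integral>t. v (z + of_real r * cis t) \<partial>circ) \<le> v z"
    and S: "cball a (norm c) \<subseteq> S" "c \<noteq> 0"
  shows "(\<integral>t. v (a + c * cis t) \<partial>circ) \<le> v a"
proof -
  obtain h :: "nat \<Rightarrow> complex \<Rightarrow> real" where h: "\<And>n. continuous_on UNIV (h n)" "\<And>n z. 0 \<le> h n z"
    "\<And>n z. h n z \<le> v z" "\<And>z. (\<lambda>n. h n z) \<longlonglongrightarrow> v z"
    using lsc_Lipschitz_approx[OF lsc bd] by blast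
  have [measurable]: "v \<in> borel_measurable borel" "h n \<in> borel_measurable borel" for n
    using lsc_borel_measurable[OF lsc] borel_measurable_continuous_onI[OF h(1)] by auto
  have inth: "integrable circ (\<lambda>t. h n (a + c * cis t))" for n
    by (rule integrable_circ_bounded[where B=M])
       (use h(2) order_trans[OF h(3) bd(2)] in auto)
  have "(\<integral>t. h n (a + c * cis t) \<partial>circ) \<le> v a" for n
  proof (rule field_le_epsilon)
    fix e :: real assume e: "0 < e"
    have "continuous_on (sphere 0 1) (\<lambda>u. h n (a + c * u))"
      by (intro continuous_on_compose2[OF h(1)] continuous_intros) auto
    then obtain q where q: "\<And>u. cmod u = 1 \<Longrightarrow> \<bar>h n (a + c * u) - Re (poly q u)\<bar> < e / 3"
      using continuous_approx_Re_poly_on_circle[of _ "e / 3"] e by auto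
    \<comment> \<open>With approximation error below \<open>e / 3\<close>, the shift by
      \<open>2 * e / 3\<close> yields both \<open>Re Q + e / 3 \<le> h n\<close> and
      \<open>h n \<le> Re Q + e\<close> on the circle.\<close>
    define Q where "Q z = poly q ((z - a) / c) - of_real (2 * e / 3)" for z
    have Qhol: "Q holomorphic_on UNIV"
      unfolding Q_def using S by (intro holomorphic_intros) auto
    have Qcirc: "Q (a + c * u) = poly q u - of_real (2 * e / 3)" for u
      using S by (simp add: Q_def)
    have "Re (Q a) \<le> v a"
    proof (rule local_mean_minimum_principle[OF lsc bd loc S(1) _ Qhol])
      fix z assume z: "z \<in> sphere a (norm c)"
      define u where "u = (z - a) / c"
      have u: "z = a + c * u" "cmod u = 1"
        using z S by (auto simp: u_def norm_divide dist_norm norm_minus_commute)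
      show "Re (Q z) + e / 3 \<le> v z"
        using q[OF u(2)] h(3)[of n z]
        unfolding u(1) Qcirc minus_complex.simps Re_complex_of_real by linarith
    qed (use e S in auto)
    moreover have "(\<integral>t. Q (a + c * cis t) \<partial>circ) = Q a"
      by (rule holomorphic_circle_mean[of _ _ "norm c + 1"]) (use Qhol S in \<open>auto intro: holomorphic_on_subset\<close>)
    moreover have intQ: "integrable circ (\<lambda>t. Q (a + c * cis t))"
    proof -
      have "compact ((poly q) ` sphere 0 1)"
        by (intro compact_continuous_image continuous_intros) auto
      then have "bounded (poly q ` sphere 0 1)" by (rule compact_imp_bounded)
      then obtain B where "\<forall>x\<in>poly q ` sphere 0 1. norm x \<le> B"
        unfolding bounded_iff by blast
      then have B: "norm (poly q u) \<le> B" if "cmod u = 1" for u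
        using that by simp
      have [measurable]: "Q \<in> borel_measurable borel"
        by (intro borel_measurable_continuous_onI holomorphic_on_imp_continuous_on Qhol)
      show ?thesis
        unfolding Qcirc
      proof (rule integrable_circ_bounded[where B="B + 2 * e / 3"])
        show "norm (poly q (cis t) - of_real (2 * e / 3)) \<le> B + 2 * e / 3" for t
          using norm_triangle_ineq4[of "poly q (cis t)" "of_real (2 * e / 3)"] B[of "cis t"] e by simp
        show "(\<lambda>t. poly q (cis t) - of_real (2 * e / 3)) \<in> borel_measurable borel"
          unfolding Qcirc[symmetric] by measurable
      qed
    qed
    moreover have "(\<integral>t. h n (a + c * cis t) \<partial>circ)
        \<le> (\<integral>t. Re (Q (a + c * cis t)) + e \<partial>circ)"
    proof (rule integral_mono[OF inth])
      show "h n (a + c * cis t) \<le> Re (Q (a + c * cis t)) + e" for t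
        using q[of "cis t"] unfolding Qcirc minus_complex.simps Re_complex_of_real norm_cis by linarith
    qed (use intQ in auto)
    ultimately show "(\<integral>t. h n (a + c * cis t) \<partial>circ) \<le> v a + e"
      using integral_Re[OF intQ] by simp
  qed
  moreover have "(\<lambda>n. \<integral>t. h n (a + c * cis t) \<partial>circ) \<longlonglongrightarrow> (\<integral>t. v (a + c * cis t) \<partial>circ)"
    by (rule integral_dominated_convergence[where w="\<lambda>_. M"]) (use h(2,4) order_trans[OF h(3) bd(2)] in auto)
  ultimately show ?thesis
    by (intro LIMSEQ_le_const2) auto
qed

section \<open>Superharmonic functions as weights on the plane, and their means on all
  circles\<close>

definition disk_weight :: "(complex \<Rightarrow> ereal) \<Rightarrow> complex \<Rightarrow> ennreal" where
  "disk_weight \<omega> z = (if z \<in> ball 0 1 then e2ennreal (\<omega> z) else 0)"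

lemma less_e2ennreal_iff: "c < e2ennreal x \<longleftrightarrow> enn2ereal c < x"
proof (cases "0 \<le> x")
  case True
  then show ?thesis
    by (metis enn2ereal_e2ennreal less_ennreal.rep_eq)
next
  case False
  then show ?thesis
    by (metis e2ennreal_neg enn2ereal_nonneg leD le_less_trans linear not_less_zero)
qed

text \<open>Extension by 0 preserves lower semicontinuity on the whole plane because 0 is the least
  value in \<open>ennreal\<close>: a strict superlevel set never meets the complement of the open
  disk.\<close>

lemma open_disk_weight:
  assumes "lsc_on (ball 0 1) \<omega>"
  shows "open {z. c < disk_weight \<omega> z}"
proof -
  have "{z. c < disk_weight \<omega> z} = {z \<in> ball 0 1. enn2ereal c < \<omega> z}"
    by (auto simp: disk_weight_def less_e2ennreal_iff)
  then show ?thesis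
    using assms by (auto simp: lsc_on_def openin_open_eq)
qed

lemma disk_weight_local_mean:
  assumes \<omega>: "positive_superharmonic \<omega>" and z: "z \<in> ball 0 1"
  shows "\<exists>R>0. \<forall>r. 0 \<le> r \<and> r < R \<longrightarrow>
    (\<integral>\<^sup>+t. disk_weight \<omega> (z + of_real r * cis t) \<partial>circ) \<le> disk_weight \<omega> z"
proof -
  have lsc: "lsc_on (ball 0 1) \<omega>" and pos: "\<And>z. z \<in> ball 0 1 \<Longrightarrow> 0 < \<omega> z"
    using \<omega> by (auto simp: positive_superharmonic_def superharmonic_on_def)
  obtain R where R: "0 < R" "ball z R \<subseteq> ball 0 1" "\<And>r. 0 \<le> r \<Longrightarrow> r < R \<Longrightarrow> circle_mean \<omega> z r \<le> \<omega> z"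
    using \<omega> z unfolding positive_superharmonic_def superharmonic_on_def by blast
  have [measurable]: "disk_weight \<omega> \<in> borel_measurable borel"
    by (rule lsc_borel_measurable[OF open_disk_weight[OF lsc]])
  have "(\<integral>\<^sup>+t. disk_weight \<omega> (z + of_real r * cis t) \<partial>circ) \<le> disk_weight \<omega> z" if r: "0 \<le> r" "r < R" for r
  proof -
    have mem: "z + of_real r * cis t \<in> ball 0 1" for t
      by (rule subsetD[OF R(2)]) (use r in \<open>simp add: dist_norm norm_mult\<close>)
    define I where "I = (\<integral>\<^sup>+t\<in>{0..2*pi}. disk_weight \<omega> (z + of_real r * cis t) \<partial>lborel)"
    have I: "(\<integral>\<^sup>+t\<in>{0..2*pi}. e2ennreal (\<omega> (z + of_real r * cis t)) \<partial>lborel) = I"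
      unfolding I_def using mem by (simp add: disk_weight_def)
    have "e2ennreal (- \<omega> (z + of_real r * cis t)) = 0" for t
      using pos[OF mem] by (intro e2ennreal_neg) (simp add: less_imp_le)
    then have "circle_mean \<omega> z r = enn2ereal I / ereal (2 * pi)"
      unfolding circle_mean_def I by (simp add: zero_ennreal.rep_eq)
    also have "\<dots> = enn2ereal (I / ennreal (2 * pi))"
      by (simp add: divide_ennreal_def divide_ereal_def times_ennreal.rep_eq inverse_ennreal.rep_eq)
    finally have "enn2ereal (I / ennreal (2 * pi)) \<le> \<omega> z"
      using R(3)[OF r] by simp
    then have "e2ennreal (enn2ereal (I / ennreal (2 * pi))) \<le> e2ennreal (\<omega> z)"
      by (rule e2ennreal_mono)
    then show ?thesis
      using z
      by (subst nn_integral_circ) (measurable, simp add: I_def disk_weight_def)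
  qed
  with R(1) show ?thesis by blast
qed

text \<open>Truncation at height \<open>m\<close> preserves the local mean inequality, since the
  mean of a minimum is at most the minimum of the means. The bounded case applies to each truncation
  and monotone convergence removes it.\<close>

lemma disk_weight_mean:
  assumes \<omega>: "positive_superharmonic \<omega>" and S: "cball a (norm c) \<subseteq> ball 0 1"
  shows "(\<integral>\<^sup>+t. disk_weight \<omega> (a + c * cis t) \<partial>circ) \<le> disk_weight \<omega> a"
proof (cases "c = 0")
  case True
  then show ?thesis by (simp add: emeasure_circ)
next
  case False
  have lsc: "open {z. x < disk_weight \<omega> z}" for x
    using \<omega> by (auto simp: positive_superharmonic_def superharmonic_on_def intro: open_disk_weight)
  note [measurable] = lsc_borel_measurable[OF lsc]
  define v where "v m z = enn2real (min (disk_weight \<omega> z) (of_nat m))" for m z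
  have v: "ennreal (v m z) = min (disk_weight \<omega> z) (of_nat m)" for m z
    unfolding v_def by (subst ennreal_enn2real) (auto simp: min_less_iff_disj of_nat_less_top)
  have [measurable]: "v m \<in> borel_measurable borel" for m
    unfolding v_def by measurable
  have vb: "0 \<le> v m z" "v m z \<le> real m" for m z
  proof -
    show "0 \<le> v m z" by (simp add: v_def)
    have "ennreal (v m z) \<le> ennreal (real m)" by (simp add: v ennreal_of_nat_eq_real_of_nat)
    then show "v m z \<le> real m" by simp
  qed
  have vint: "(\<integral>\<^sup>+t. min (disk_weight \<omega> (z + w * cis t)) (of_nat m) \<partial>circ)
      = ennreal (\<integral>t. v m (z + w * cis t) \<partial>circ)" for m z w
    unfolding v[symmetric]
    by (rule nn_integral_eq_integral) (auto intro!: integrable_circ_bounded[where B="real m"] simp: vb)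
  have mean_le: "(\<integral>t. v m (a + c * cis t) \<partial>circ) \<le> v m a" for m
  proof (rule local_mean_imp_global_mean_bounded[OF _ vb _ S False])
    show "open {z. x < v m z}" for x
    proof (cases "0 \<le> x")
      case True
      have "x < v m z \<longleftrightarrow> ennreal x < disk_weight \<omega> z \<and> x < real m" for z
      proof -
        have "x < v m z \<longleftrightarrow> ennreal x < ennreal (v m z)"
          using True by (simp add: ennreal_less_iff)
        also have "\<dots> \<longleftrightarrow> ennreal x < disk_weight \<omega> z \<and> ennreal x < ennreal (real m)"
          by (simp add: v ennreal_of_nat_eq_real_of_nat)
        also have "ennreal x < ennreal (real m) \<longleftrightarrow> x < real m"
          using True by (simp add: ennreal_less_iff)
        finally show ?thesis .
      qed
      then show ?thesis
        using lsc[of "ennreal x"] by (cases "x < real m") auto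
    next
      case False
      then have "{z. x < v m z} = UNIV"
        using vb(1) by (auto simp: not_le intro: less_le_trans)
      then show ?thesis by simp
    qed
  next
    fix z :: complex assume "z \<in> ball 0 1"
    then obtain R where R: "0 < R" "\<And>r. 0 \<le> r \<Longrightarrow> r < R \<Longrightarrow>
       (\<integral>\<^sup>+t. disk_weight \<omega> (z + of_real r * cis t) \<partial>circ) \<le> disk_weight \<omega> z"
      using disk_weight_local_mean[OF \<omega>] by blast
    have "(\<integral>t. v m (z + of_real r * cis t) \<partial>circ) \<le> v m z" if r: "0 \<le> r" "r < R" for r
    proof -
      have "(\<integral>\<^sup>+t. min (disk_weight \<omega> (z + of_real r * cis t)) (of_nat m) \<partial>circ)
          \<le> (\<integral>\<^sup>+t. disk_weight \<omega> (z + of_real r * cis t) \<partial>circ)"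
        by (intro nn_integral_mono) simp
      moreover have "(\<integral>\<^sup>+t. min (disk_weight \<omega> (z + of_real r * cis t)) (of_nat m) \<partial>circ)
          \<le> (\<integral>\<^sup>+t. of_nat m \<partial>circ)"
        by (intro nn_integral_mono) simp
      ultimately have "ennreal (\<integral>t. v m (z + of_real r * cis t) \<partial>circ) \<le> ennreal (v m z)"
        using R(2)[OF r] unfolding v vint by (simp add: emeasure_circ)
      then show ?thesis using vb(1) by (simp add: ennreal_le_iff)
    qed
    with R(1) show "\<exists>R>0. \<forall>r. 0 \<le> r \<and> r < R \<longrightarrow> (\<integral>t. v m (z + of_real r * cis t) \<partial>circ) \<le> v m z"
      by blast
  qed
  have le: "(\<integral>\<^sup>+t. min (disk_weight \<omega> (a + c * cis t)) (of_nat m) \<partial>circ) \<le> disk_weight \<omega> a" for m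
  proof -
    have "ennreal (\<integral>t. v m (a + c * cis t) \<partial>circ) \<le> ennreal (v m a)"
      by (rule ennreal_leI) (rule mean_le)
    also have "\<dots> \<le> disk_weight \<omega> a" by (simp add: v)
    finally show ?thesis by (simp only: vint)
  qed
  have sup: "(SUP m. min x (of_nat m)) = x" for x :: ennreal
  proof (rule antisym)
    show "(SUP m. min x (of_nat m)) \<le> x" by (intro SUP_least) simp
    show "x \<le> (SUP m. min x (of_nat m))"
    proof (cases "x = top")
      case True
      then show ?thesis by (simp add: ennreal_SUP_of_nat_eq_top)
    next
      case False
      then obtain m where "x < of_nat m" using ennreal_Ex_less_of_nat[of x] by (auto simp: less_top)
      then have "x = min x (of_nat m)" by simp
      also have "\<dots> \<le> (SUP m. min x (of_nat m))" by (rule SUP_upper) simp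
      finally show ?thesis .
    qed
  qed
  have "(\<integral>\<^sup>+t. disk_weight \<omega> (a + c * cis t) \<partial>circ)
      = (\<integral>\<^sup>+t. (SUP m. min (disk_weight \<omega> (a + c * cis t)) (of_nat m)) \<partial>circ)"
    by (simp only: sup)
  also have "\<dots> = (SUP m. \<integral>\<^sup>+t. min (disk_weight \<omega> (a + c * cis t)) (of_nat m) \<partial>circ)"
    by (rule nn_integral_monotone_convergence_SUP)
       (auto simp: incseq_def le_fun_def intro: min.coboundedI2)
  also have "\<dots> \<le> disk_weight \<omega> a"
    by (intro SUP_least le)
  finally show ?thesis .
qed

section \<open>Supermean weights\<close>

lemma ball_in_borel [measurable, simp]: "ball a r \<in> sets borel"
  by (simp add: borel_open)

lemma nn_integral_lborel_translate:
  fixes f :: "'a::euclidean_space \<Rightarrow> ennreal"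
  assumes "f \<in> borel_measurable borel"
  shows "(\<integral>\<^sup>+z. f (a + z) \<partial>lborel) = (\<integral>\<^sup>+z. f z \<partial>lborel)"
proof -
  have "(\<integral>\<^sup>+z. f z \<partial>lborel) = (\<integral>\<^sup>+z. f z \<partial>distr lborel borel ((+) a))"
    by (simp add: lborel_distr_plus)
  also have "\<dots> = (\<integral>\<^sup>+z. f (a + z) \<partial>lborel)"
    using assms by (intro nn_integral_distr) auto
  finally show ?thesis by simp
qed

lemma nn_integral_lborel_reflect:
  fixes f :: "complex \<Rightarrow> ennreal"
  assumes "f \<in> borel_measurable borel"
  shows "(\<integral>\<^sup>+z. f (a - z) \<partial>lborel) = (\<integral>\<^sup>+z. f z \<partial>lborel)"
proof -
  have "lborel = distr lborel borel (\<lambda>z::complex. a - z)"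
    using lborel_affine[of "-1" a] by (simp add: density_1 flip: one_ennreal_def)
  then have "(\<integral>\<^sup>+z. f z \<partial>lborel) = (\<integral>\<^sup>+z. f z \<partial>distr lborel borel (\<lambda>z. a - z))"
    by simp
  also have "\<dots> = (\<integral>\<^sup>+z. f (a - z) \<partial>lborel)"
    using assms by (intro nn_integral_distr) auto
  finally show ?thesis by simp
qed

text \<open>Uniqueness of Haar measure: comparing with the unit ball by Tonelli's theorem shows that the
  translation invariant image measure under a rotation is Lebesgue measure itself.\<close>

lemma nn_integral_lborel_rotate:
  fixes f :: "complex \<Rightarrow> ennreal"
  assumes [measurable]: "f \<in> borel_measurable borel" and c: "cmod c = 1"
  shows "(\<integral>\<^sup>+z. f (c * z) \<partial>lborel) = (\<integral>\<^sup>+z. f z \<partial>lborel)"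
proof -
  define B :: "complex \<Rightarrow> ennreal" where "B = indicator (ball 0 1)"
  have [measurable]: "B \<in> borel_measurable borel" by (simp add: B_def)
  have c0: "c \<noteq> 0" using c by auto
  have Bc: "B (z / c) = B z" for z
    using c by (simp add: B_def indicator_def norm_divide)
  have intB: "(\<integral>\<^sup>+z. B z \<partial>lborel) = ennreal pi"
    unfolding B_def by (simp add: emeasure_ball unit_ball_vol_2)
  have "(\<integral>\<^sup>+z. f z \<partial>lborel) * ennreal pi = (\<integral>\<^sup>+x. (\<integral>\<^sup>+z. f x * B (x - c * z) \<partial>lborel) \<partial>lborel)"
  proof -
    have "(\<integral>\<^sup>+z. f x * B (x - c * z) \<partial>lborel) = f x * ennreal pi" for x
    proof -
      have "(\<integral>\<^sup>+z. f x * B (x - c * z) \<partial>lborel) = (\<integral>\<^sup>+z. f x * B (x / c - z) \<partial>lborel)"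
        using c0 by (subst Bc[symmetric]) (simp add: diff_divide_distrib)
      also have "\<dots> = f x * (\<integral>\<^sup>+z. B (x / c - z) \<partial>lborel)"
        by (rule nn_integral_cmult) measurable
      also have "(\<integral>\<^sup>+z. B (x / c - z) \<partial>lborel) = ennreal pi"
        unfolding intB[symmetric] by (rule nn_integral_lborel_reflect) measurable
      finally show ?thesis .
    qed
    then show ?thesis by (simp add: nn_integral_multc)
  qed
  also have "\<dots> = (\<integral>\<^sup>+z. (\<integral>\<^sup>+x. f x * B (x - c * z) \<partial>lborel) \<partial>lborel)"
    by (rule lborel_pair.Fubini') measurable
  also have "\<dots> = (\<integral>\<^sup>+z. (\<integral>\<^sup>+y. f (c * z + y) * B y \<partial>lborel) \<partial>lborel)"
  proof (rule nn_integral_cong)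
    fix z
    show "(\<integral>\<^sup>+x. f x * B (x - c * z) \<partial>lborel) = (\<integral>\<^sup>+y. f (c * z + y) * B y \<partial>lborel)"
      using nn_integral_lborel_translate[of "\<lambda>x. f x * B (x - c * z)" "c * z"] by simp
  qed
  also have "\<dots> = (\<integral>\<^sup>+y. (\<integral>\<^sup>+z. f (c * z + y) * B y \<partial>lborel) \<partial>lborel)"
    by (rule lborel_pair.Fubini') measurable
  also have "\<dots> = (\<integral>\<^sup>+y. (\<integral>\<^sup>+z. f (c * z) \<partial>lborel) * B y \<partial>lborel)"
  proof (rule nn_integral_cong)
    fix y
    have "(\<integral>\<^sup>+z. f (c * z + y) * B y \<partial>lborel) = (\<integral>\<^sup>+z. f (c * (y / c + z)) \<partial>lborel) * B y"
      using c0 by (subst nn_integral_multc) (measurable, simp add: algebra_simps)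
    also have "(\<integral>\<^sup>+z. f (c * (y / c + z)) \<partial>lborel) = (\<integral>\<^sup>+z. f (c * z) \<partial>lborel)"
      by (rule nn_integral_lborel_translate) measurable
    finally show "(\<integral>\<^sup>+z. f (c * z + y) * B y \<partial>lborel) = (\<integral>\<^sup>+z. f (c * z) \<partial>lborel) * B y" .
  qed
  also have "\<dots> = (\<integral>\<^sup>+z. f (c * z) \<partial>lborel) * ennreal pi"
    unfolding intB[symmetric] by (rule nn_integral_cmult) measurable
  finally have "(\<integral>\<^sup>+z. f z \<partial>lborel) * ennreal pi * ennreal (1 / pi) = (\<integral>\<^sup>+z. f (c * z) \<partial>lborel) * ennreal pi * ennreal (1 / pi)"
    by simp
  then show ?thesis
    by (simp add: mult.assoc flip: ennreal_mult')
qed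

text \<open>The radius is \<open>norm c\<close>; the argument of \<open>c\<close> only turns the
  starting point of the circle. The complex parameter allows a point \<open>z\<close> or a negative
  radius to be substituted directly.\<close>

definition supermean_weight :: "(complex \<Rightarrow> ennreal) \<Rightarrow> bool" where
  "supermean_weight u \<longleftrightarrow> u \<in> borel_measurable borel \<and>
     (\<forall>a c. cball a (norm c) \<subseteq> ball 0 1 \<longrightarrow> (\<integral>\<^sup>+t. u (a + c * cis t) \<partial>circ) \<le> u a)"

lemma supermean_weight_measurable: "supermean_weight u \<Longrightarrow> u \<in> borel_measurable borel"
  by (simp add: supermean_weight_def)

lemma supermean_weightD:
  "supermean_weight u \<Longrightarrow> cball a (norm c) \<subseteq> ball 0 1 \<Longrightarrow> (\<integral>\<^sup>+t. u (a + c * cis t) \<partial>circ) \<le> u a"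
  by (simp add: supermean_weight_def)

lemma supermean_weight_disk_weight:
  assumes "positive_superharmonic \<omega>"
  shows "supermean_weight (disk_weight \<omega>)"
  unfolding supermean_weight_def
proof (intro conjI allI impI)
  show "disk_weight \<omega> \<in> borel_measurable borel"
    using assms by (intro lsc_borel_measurable open_disk_weight)
      (auto simp: positive_superharmonic_def superharmonic_on_def)
qed (rule disk_weight_mean[OF assms])

lemma pair_sigma_finite_lborel_circ: "pair_sigma_finite (lborel :: complex measure) circ"
  by (simp add: pair_sigma_finite_def lborel.sigma_finite_measure_axioms circ.sigma_finite_measure_axioms)

text \<open>Lebesgue measure is rotation invariant, so the integral may first be averaged over
  rotations about the centre \<open>a\<close>; by Tonelli it becomes an integral of circle means,
  each at most \<open>u a\<close>.\<close>

lemma supermean_weight_integrable_ball: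
  assumes u: "supermean_weight u" and S: "ball a s \<subseteq> ball 0 1"
  shows "(\<integral>\<^sup>+z\<in>ball a s. u z \<partial>lborel) \<le> u a * emeasure lborel (ball a s)"
proof -
  have [measurable]: "u \<in> borel_measurable borel" by (rule supermean_weight_measurable[OF u])
  interpret pair_sigma_finite "lborel :: complex measure" circ
    by (rule pair_sigma_finite_lborel_circ)
  define g where "g z = u (a + z) * indicator (ball 0 s) z" for z
  have g: "g (cis t * z) = u (a + z * cis t) * indicator (ball 0 s) z" for t z
    by (simp add: g_def indicator_def norm_mult mult.commute)
  have [measurable]: "g \<in> borel_measurable borel" unfolding g_def by measurable
  have "(\<integral>\<^sup>+z\<in>ball a s. u z \<partial>lborel) = (\<integral>\<^sup>+z. u (a + z) * indicator (ball a s) (a + z) \<partial>lborel)"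
    by (rule nn_integral_lborel_translate[symmetric]) measurable
  also have "\<dots> = (\<integral>\<^sup>+z. g z \<partial>lborel)"
    by (intro nn_integral_cong) (simp add: g_def indicator_def dist_norm)
  also have "\<dots> = (\<integral>\<^sup>+t. (\<integral>\<^sup>+z. g (cis t * z) \<partial>lborel) \<partial>circ)"
    by (subst nn_integral_lborel_rotate) (auto simp: emeasure_circ)
  also have "\<dots> = (\<integral>\<^sup>+z. (\<integral>\<^sup>+t. g (cis t * z) \<partial>circ) \<partial>lborel)"
    by (rule Fubini') measurable
  also have "\<dots> \<le> (\<integral>\<^sup>+z. u a * indicator (ball 0 s) z \<partial>(lborel :: complex measure))"
  proof (rule nn_integral_mono)
    fix z :: complex
    show "(\<integral>\<^sup>+t. g (cis t * z) \<partial>circ) \<le> u a * indicator (ball 0 s) z"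
    proof (cases "z \<in> ball 0 s")
      case True
      then have "cball a (norm z) \<subseteq> ball a s" by auto
      with S have "cball a (norm z) \<subseteq> ball 0 1" by blast
      from supermean_weightD[OF u this] True show ?thesis
        by (simp add: g)
    qed (simp add: g)
  qed
  also have "\<dots> = u a * emeasure lborel (ball a s)"
  proof (cases "0 \<le> s")
    case False
    then have "s \<le> 0" by simp
    then have e: "ball 0 s = ({} :: complex set)" "ball a s = {}"
      by (simp_all only: ball_empty)
    show ?thesis unfolding e by simp
  qed (simp add: nn_integral_cmult_indicator emeasure_ball)
  finally show ?thesis .
qed

text \<open>The value at a prescribed centre may be infinite, so each point of the compact disk is
  covered by a ball whose centre is a nearby point of finiteness; finitely many such balls
  suffice.\<close>

lemma supermean_weight_locally_integrable:
  assumes u: "supermean_weight u" and \<rho>: "\<rho> < 1"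
    and dense: "\<And>z e. z \<in> ball 0 1 \<Longrightarrow> 0 < e \<Longrightarrow> \<exists>a. dist a z < e \<and> u a < \<infinity>"
  shows "(\<integral>\<^sup>+z\<in>ball 0 \<rho>. u z \<partial>lborel) < \<infinity>"
proof -
  have [measurable]: "u \<in> borel_measurable borel" by (rule supermean_weight_measurable[OF u])
  have "\<exists>a s. z \<in> ball a s \<and> ball a s \<subseteq> ball 0 1 \<and> u a < \<infinity>" if z: "z \<in> cball 0 \<rho>" for z
  proof -
    \<comment> \<open>The gap to the unit circle is shared: one half for displacing the centre, one
      half for the radius.\<close>
    define e where "e = (1 - \<rho>) / 2"
    have e: "0 < e" using \<rho> by (simp add: e_def)
    obtain a where a: "dist a z < e" "u a < \<infinity>"
      using dense[OF _ e, of z] z \<rho> by auto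
    have "ball a e \<subseteq> ball 0 1"
    proof
      fix w assume "w \<in> ball a e"
      then have "dist 0 w < \<rho> + e + e"
        using z a dist_triangle[of 0 w a] dist_triangle[of 0 a z] by (auto simp: dist_commute)
      then show "w \<in> ball 0 1" by (simp add: e_def field_simps)
    qed
    with a show ?thesis by (intro exI[of _ a] exI[of _ e]) auto
  qed
  then obtain A s where As: "\<And>z. z \<in> cball 0 \<rho> \<Longrightarrow> z \<in> ball (A z) (s z) \<and> ball (A z) (s z) \<subseteq> ball 0 1 \<and> u (A z) < \<infinity>"
    by metis
  have "cball 0 \<rho> \<subseteq> (\<Union>z\<in>cball 0 \<rho>. ball (A z) (s z))"
    using As by blast
  then obtain F where F: "F \<subseteq> cball 0 \<rho>" "finite F" "cball 0 \<rho> \<subseteq> (\<Union>z\<in>F. ball (A z) (s z))"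
    by (rule compactE_image[OF compact_cball open_ball])
  have "(\<integral>\<^sup>+z\<in>ball 0 \<rho>. u z \<partial>lborel) \<le> (\<integral>\<^sup>+z. (\<Sum>w\<in>F. u z * indicator (ball (A w) (s w)) z) \<partial>lborel)"
  proof (rule nn_integral_mono)
    fix z
    show "u z * indicator (ball 0 \<rho>) z \<le> (\<Sum>w\<in>F. u z * indicator (ball (A w) (s w)) z)"
    proof (cases "z \<in> ball 0 \<rho>")
      case True
      then obtain w where w: "w \<in> F" "z \<in> ball (A w) (s w)"
        using subsetD[OF F(3), of z] by auto
      have "u z * indicator (ball 0 \<rho>) z \<le> u z * indicator (ball (A w) (s w)) z"
        using w by (simp add: mult_left_mono indicator_def)
      also have "\<dots> \<le> (\<Sum>w\<in>F. u z * indicator (ball (A w) (s w)) z)"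
        by (rule member_le_sum[OF w(1)]) (use F in auto)
      finally show ?thesis .
    qed simp
  qed
  also have "\<dots> = (\<Sum>w\<in>F. \<integral>\<^sup>+z\<in>ball (A w) (s w). u z \<partial>lborel)"
    by (rule nn_integral_sum) measurable
  also have "\<dots> < \<infinity>"
  proof -
    have "(\<integral>\<^sup>+z\<in>ball (A w) (s w). u z \<partial>lborel) < \<infinity>" if "w \<in> F" for w
    proof -
      have "(\<integral>\<^sup>+z\<in>ball (A w) (s w). u z \<partial>lborel) \<le> u (A w) * emeasure lborel (ball (A w) (s w))"
        using As F(1) that by (intro supermean_weight_integrable_ball[OF u]) blast
      also have "\<dots> < \<infinity>"
        using As F(1) that emeasure_lborel_ball_finite[of "A w" "s w"]
        by (auto simp: ennreal_mult_less_top)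
      finally show ?thesis .
    qed
    with F(2) show ?thesis by (simp add: less_top)
  qed
  finally show ?thesis .
qed

text \<open>Since averaging is symmetric, a supermean weight decreases the integral of averaged test functions.\<close>

lemma supermean_weight_test_function:
  assumes u: "supermean_weight u" and [measurable]: "\<psi> \<in> borel_measurable borel"
    and r: "0 \<le> r" "\<And>z. \<psi> z \<noteq> 0 \<Longrightarrow> cball z r \<subseteq> ball 0 1"
  shows "(\<integral>\<^sup>+z. (\<integral>\<^sup>+t. \<psi> (z + of_real r * cis t) \<partial>circ) * u z \<partial>lborel) \<le> (\<integral>\<^sup>+z. \<psi> z * u z \<partial>lborel)"
proof -
  have [measurable]: "u \<in> borel_measurable borel" by (rule supermean_weight_measurable[OF u])
  interpret pair_sigma_finite "lborel :: complex measure" circ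
    by (rule pair_sigma_finite_lborel_circ)
  have "(\<integral>\<^sup>+z. (\<integral>\<^sup>+t. \<psi> (z + of_real r * cis t) \<partial>circ) * u z \<partial>lborel)
      = (\<integral>\<^sup>+z. (\<integral>\<^sup>+t. \<psi> (z + of_real r * cis t) * u z \<partial>circ) \<partial>lborel)"
    by (intro nn_integral_cong nn_integral_multc[symmetric]) measurable
  also have "\<dots> = (\<integral>\<^sup>+t. (\<integral>\<^sup>+z. \<psi> (z + of_real r * cis t) * u z \<partial>lborel) \<partial>circ)"
    by (rule Fubini'[symmetric]) measurable
  \<comment> \<open>Translation invariance moves the shift from \<psi> to \<open>u\<close>, with
    opposite sign.\<close>
  also have "\<dots> = (\<integral>\<^sup>+t. (\<integral>\<^sup>+z. \<psi> z * u (z + (- of_real r) * cis t) \<partial>lborel) \<partial>circ)"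
  proof (rule nn_integral_cong)
    fix t
    show "(\<integral>\<^sup>+z. \<psi> (z + of_real r * cis t) * u z \<partial>lborel) = (\<integral>\<^sup>+z. \<psi> z * u (z + (- of_real r) * cis t) \<partial>lborel)"
      using nn_integral_lborel_translate[of "\<lambda>z. \<psi> z * u (z + (- of_real r) * cis t)" "of_real r * cis t"]
      by (simp add: add.commute)
  qed
  also have "\<dots> = (\<integral>\<^sup>+z. (\<integral>\<^sup>+t. \<psi> z * u (z + (- of_real r) * cis t) \<partial>circ) \<partial>lborel)"
    by (rule Fubini') measurable
  also have "\<dots> = (\<integral>\<^sup>+z. \<psi> z * (\<integral>\<^sup>+t. u (z + (- of_real r) * cis t) \<partial>circ) \<partial>lborel)"
    by (intro nn_integral_cong nn_integral_cmult) measurable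
  also have "\<dots> \<le> (\<integral>\<^sup>+z. \<psi> z * u z \<partial>lborel)"
  proof (rule nn_integral_mono)
    fix z
    show "\<psi> z * (\<integral>\<^sup>+t. u (z + (- of_real r) * cis t) \<partial>circ) \<le> \<psi> z * u z"
    proof (cases "\<psi> z = 0")
      case False
      then show ?thesis
        using r by (intro mult_left_mono supermean_weightD[OF u]) auto
    qed simp
  qed
  finally show ?thesis .
qed

text \<open>The difference \<open>W = Re H - (C \<bar>f\<bar>\<^sup>2 - \<bar>g\<bar>\<^sup>2)\<close> has Laplacian
  \<open>4 (\<bar>g'\<bar>\<^sup>2 - C \<bar>f'\<bar>\<^sup>2)\<close>, is positive in the disk and vanishes on its boundary. Testing the weight with
  the truncation \<open>max (W - \<epsilon>) 0\<close>, whose averages are controlled by convexity, avoids all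
  smoothness and boundary issues.\<close>

lemma weighted_energy_compare:
  fixes f g H :: "complex \<Rightarrow> complex"
  assumes u: "supermean_weight u" and \<rho>: "0 < \<rho>" "\<rho> \<le> 1"
    and fin: "(\<integral>\<^sup>+z\<in>ball 0 \<rho>. u z \<partial>lborel) < \<infinity>"
    and hol: "f holomorphic_on UNIV" "g holomorphic_on UNIV" "H holomorphic_on UNIV" and C: "0 \<le> C"
    and pos: "\<And>z. z \<in> ball 0 \<rho> \<Longrightarrow> C * (cmod (f z))\<^sup>2 - (cmod (g z))\<^sup>2 < Re (H z)"
    and bdy: "\<And>z. z \<in> sphere 0 \<rho> \<Longrightarrow> Re (H z) \<le> C * (cmod (f z))\<^sup>2 - (cmod (g z))\<^sup>2"
  shows "(\<integral>\<^sup>+z\<in>ball 0 \<rho>. ennreal ((cmod (deriv g z))\<^sup>2) * u z \<partial>lborel)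
    \<le> ennreal C * (\<integral>\<^sup>+z\<in>ball 0 \<rho>. ennreal ((cmod (deriv f z))\<^sup>2) * u z \<partial>lborel)"
proof -
  have [measurable]: "u \<in> borel_measurable borel" by (rule supermean_weight_measurable[OF u])
  define \<nu> where "\<nu> = density lborel (\<lambda>z. u z * indicator (ball 0 \<rho>) z)"
  have sets_\<nu> [measurable_cong, simp]: "sets \<nu> = sets borel" and space_\<nu> [simp]: "space \<nu> = UNIV"
    by (simp_all add: \<nu>_def)
  have \<nu>: "(\<integral>\<^sup>+z. h z \<partial>\<nu>) = (\<integral>\<^sup>+z\<in>ball 0 \<rho>. h z * u z \<partial>lborel)" if [measurable]: "h \<in> borel_measurable borel" for h
    unfolding \<nu>_def by (subst nn_integral_density) (auto intro!: nn_integral_cong simp: mult_ac)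
  interpret \<nu>: finite_measure \<nu>
  proof (rule finite_measureI)
    show "emeasure \<nu> (space \<nu>) \<noteq> \<infinity>"
      using fin \<nu>[of "\<lambda>_. 1"] by simp
  qed
  have cont: "continuous_on UNIV f" "continuous_on UNIV g" "continuous_on UNIV H"
    using hol by (auto intro: holomorphic_on_imp_continuous_on)
  have contd: "continuous_on UNIV (deriv f)" "continuous_on UNIV (deriv g)"
    using hol by (auto intro!: holomorphic_on_imp_continuous_on holomorphic_deriv)
  define W where "W z = Re (H z) - (C * (cmod (f z))\<^sup>2 - (cmod (g z))\<^sup>2)" for z
  have contW: "continuous_on UNIV W"
    unfolding W_def by (intro continuous_intros cont)
  have [measurable]: "W \<in> borel_measurable borel" "deriv f \<in> borel_measurable borel" "deriv g \<in> borel_measurable borel"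
    by (auto intro!: borel_measurable_continuous_onI contW contd)
  have bound: "\<exists>B. \<forall>z\<in>cball 0 R. norm (h z) \<le> B" if "continuous_on UNIV h" for R and h :: "complex \<Rightarrow> 'b::real_normed_vector"
    using compact_imp_bounded[OF compact_continuous_image[OF continuous_on_subset[OF that] compact_cball[of 0 R]]]
    by (auto simp: bounded_iff)
  obtain BW where BW: "\<And>z. z \<in> cball 0 1 \<Longrightarrow> \<bar>W z\<bar> \<le> BW" using bound[OF contW] by fastforce
  obtain Bf where Bf: "\<And>z. z \<in> cball 0 1 \<Longrightarrow> cmod (deriv f z) \<le> Bf" using bound[OF contd(1)] by fastforce
  obtain Bg where Bg: "\<And>z. z \<in> cball 0 1 \<Longrightarrow> cmod (deriv g z) \<le> Bg" using bound[OF contd(2)] by fastforce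
  obtain B2 where B2: "\<And>z. z \<in> cball 0 2 \<Longrightarrow> cmod (f z) \<le> B2" using bound[OF cont(1)] by fastforce
  have ball1: "z \<in> cball 0 1" if "z \<in> ball 0 \<rho>" for z :: complex using that \<rho> by auto
  have mean1: "(\<integral>t. (cmod (f (z + cis t)))\<^sup>2 \<partial>circ) \<le> B2\<^sup>2" if z: "z \<in> ball 0 \<rho>" for z
  proof -
    have "cmod (z + cis t) \<le> 2" for t
      using norm_triangle_ineq[of z "cis t"] z \<rho> by simp
    then have "(cmod (f (z + cis t)))\<^sup>2 \<le> B2\<^sup>2" for t
      by (intro power_mono B2) auto
    moreover have [measurable]: "f \<in> borel_measurable borel"
      by (intro borel_measurable_continuous_onI cont)
    ultimately have "(\<integral>t. (cmod (f (z + cis t)))\<^sup>2 \<partial>circ) \<le> (\<integral>t. B2\<^sup>2 \<partial>circ)"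
      by (intro integral_mono integrable_circ_bounded[where B="B2\<^sup>2"]) auto
    then show ?thesis by simp
  qed
  have circ_int: "integrable circ (\<lambda>t. h (z + of_real r * cis t))" if h: "continuous_on UNIV h" for h :: "complex \<Rightarrow> 'b::{banach, second_countable_topology}" and z r
  proof -
    have [measurable]: "h \<in> borel_measurable borel" by (rule borel_measurable_continuous_onI[OF h])
    obtain b where "\<forall>w\<in>cball 0 (norm z + \<bar>r\<bar>). norm (h w) \<le> b" using bound[OF h] by blast
    moreover have "z + of_real r * cis t \<in> cball 0 (norm z + \<bar>r\<bar>)" for t
      using norm_triangle_ineq[of z "of_real r * cis t"] by (simp add: norm_mult)
    ultimately show ?thesis
      by (intro integrable_circ_bounded[where B=b]) auto
  qed
  \<comment> \<open>A lower bound for the mean difference of \<open>W\<close> in place of its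
    Laplacian: \<open>Re H\<close> contributes nothing, \<open>g\<close> is estimated from below and
    \<open>f\<close> from above, with an error of order \<open>r ^ 4\<close> uniform on the
    disk.\<close>
  have meanW: "W z + r\<^sup>2 * ((cmod (deriv g z))\<^sup>2 - C * (cmod (deriv f z))\<^sup>2 - C * B2\<^sup>2 * r\<^sup>2)
      \<le> (\<integral>t. W (z + of_real r * cis t) \<partial>circ)"
    if z: "z \<in> ball 0 \<rho>" and r: "0 \<le> r" "r \<le> 1" for z r
  proof -
    have "H holomorphic_on ball z 2" using hol by (auto intro: holomorphic_on_subset)
    then have "(\<integral>t. H (z + of_real r * cis t) \<partial>circ) = H z"
      by (rule holomorphic_circle_mean) (use r in auto)
    moreover have "integrable circ (\<lambda>t. H (z + of_real r * cis t))"
      by (rule circ_int[OF cont(3)])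
    ultimately have 1: "(\<integral>t. Re (H (z + of_real r * cis t)) \<partial>circ) = Re (H z)"
      using integral_Re by metis
    have 2: "(cmod (g z))\<^sup>2 + r\<^sup>2 * (cmod (deriv g z))\<^sup>2 \<le> (\<integral>t. (cmod (g (z + of_real r * cis t)))\<^sup>2 \<partial>circ)"
      by (rule circle_mean_square_lower[of _ _ 2]) (use hol r in \<open>auto intro: holomorphic_on_subset\<close>)
    have "(\<integral>t. (cmod (f (z + of_real r * cis t)))\<^sup>2 \<partial>circ)
       \<le> (cmod (f z))\<^sup>2 + r\<^sup>2 * (cmod (deriv f z))\<^sup>2 + r ^ 4 * (\<integral>t. (cmod (f (z + cis t)))\<^sup>2 \<partial>circ)"
      by (rule circle_mean_square_upper[of _ _ 2]) (use hol r in \<open>auto intro: holomorphic_on_subset\<close>)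
    also have "\<dots> \<le> (cmod (f z))\<^sup>2 + r\<^sup>2 * (cmod (deriv f z))\<^sup>2 + r ^ 4 * B2\<^sup>2"
      using mean1[OF z] by (intro add_left_mono mult_left_mono) auto
    finally have 3: "C * (\<integral>t. (cmod (f (z + of_real r * cis t)))\<^sup>2 \<partial>circ)
       \<le> C * ((cmod (f z))\<^sup>2 + r\<^sup>2 * (cmod (deriv f z))\<^sup>2 + r ^ 4 * B2\<^sup>2)"
      using C by (rule mult_left_mono)
    have "(\<integral>t. W (z + of_real r * cis t) \<partial>circ) = (\<integral>t. Re (H (z + of_real r * cis t)) \<partial>circ)
        - (C * (\<integral>t. (cmod (f (z + of_real r * cis t)))\<^sup>2 \<partial>circ) - (\<integral>t. (cmod (g (z + of_real r * cis t)))\<^sup>2 \<partial>circ))"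
      unfolding W_def
      using circ_int[of "\<lambda>w. Re (H w)" z r] circ_int[of "\<lambda>w. (cmod (f w))\<^sup>2" z r] circ_int[of "\<lambda>w. (cmod (g w))\<^sup>2" z r] cont
      by (simp add: continuous_intros)
    moreover have "r ^ 4 = r\<^sup>2 * r\<^sup>2" by (simp flip: power_add)
    ultimately show ?thesis
      using 1 2 3 by (simp add: W_def algebra_simps)
  qed
  define E where "E \<epsilon> = {z \<in> ball 0 \<rho>. \<epsilon> < W z}" for \<epsilon>
  have [measurable]: "E \<epsilon> \<in> sets borel" for \<epsilon> unfolding E_def by measurable
  have intE: "integrable \<nu> (\<lambda>z. indicator (E \<epsilon>) z * (cmod (deriv h z))\<^sup>2)"
    if "\<And>z. z \<in> cball 0 1 \<Longrightarrow> cmod (deriv h z) \<le> Bh" "deriv h \<in> borel_measurable borel" for h Bh \<epsilon>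
  proof (rule \<nu>.integrable_const_bound[where B="Bh\<^sup>2"])
    show "AE z in \<nu>. norm (indicator (E \<epsilon>) z * (cmod (deriv h z))\<^sup>2) \<le> Bh\<^sup>2"
      using that(1) ball1 by (intro AE_I2) (auto simp: E_def indicator_def intro!: power_mono)
  qed (use that(2) in measurable)
  have real_ineq: "(\<integral>z. indicator (E \<epsilon>) z * (cmod (deriv g z))\<^sup>2 \<partial>\<nu>)
      \<le> C * (\<integral>z. indicator (E \<epsilon>) z * (cmod (deriv f z))\<^sup>2 \<partial>\<nu>)" if \<epsilon>: "0 < \<epsilon>" for \<epsilon>
  proof -
    \<comment> \<open>Since \<open>W \<le> 0 < \<epsilon>\<close> on the bounding circle,
      \<open>K\<close> is a compact subset of the open disk. Its distance to the circle leaves room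
      for averaging at every radius up to \<open>d\<close>.\<close>
    define K where "K = {z \<in> cball 0 \<rho>. \<epsilon> \<le> W z}"
    have "compact K"
    proof -
      have "K = cball 0 \<rho> \<inter> {z. \<epsilon> \<le> W z}" by (auto simp: K_def)
      moreover have "closed {z. \<epsilon> \<le> W z}" by (intro closed_Collect_le continuous_intros contW)
      ultimately show ?thesis by (auto intro: compact_Int_closed)
    qed
    moreover have "K \<subseteq> ball 0 \<rho>"
    proof
      fix z assume z: "z \<in> K"
      then have "z \<notin> sphere 0 \<rho>" using bdy[of z] \<epsilon> by (auto simp: K_def W_def)
      with z show "z \<in> ball 0 \<rho>" by (auto simp: K_def)
    qed
    ultimately obtain d where d: "0 < d" "(\<Union>z\<in>K. cball z d) \<subseteq> ball 0 \<rho>"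
      using compact_subset_open_imp_cball_epsilon_subset[of K "ball 0 \<rho>"] by auto
    define \<psi> where "\<psi> z = (if z \<in> ball 0 \<rho> then max (W z - \<epsilon>) 0 else 0)" for z
    have [measurable]: "\<psi> \<in> borel_measurable borel" unfolding \<psi>_def by measurable
    have \<psi>0: "0 \<le> \<psi> z" and \<psi>B: "\<bar>\<psi> z\<bar> \<le> \<bar>BW\<bar>" for z
      using BW[OF ball1[of z]] \<epsilon> by (auto simp: \<psi>_def)
    have \<psi>K: "z \<in> K" if "\<psi> z \<noteq> 0" for z
      using that by (auto simp: \<psi>_def K_def max_def split: if_splits)
    have step: "(\<integral>z. indicator (E \<epsilon>) z * (cmod (deriv g z))\<^sup>2 \<partial>\<nu>)
        - C * (\<integral>z. indicator (E \<epsilon>) z * (cmod (deriv f z))\<^sup>2 \<partial>\<nu>) - C * B2\<^sup>2 * r\<^sup>2 * measure \<nu> (E \<epsilon>) \<le> 0"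
      if r: "0 < r" "r \<le> min d 1" for r
    proof -
      define A where "A z = (\<integral>t. \<psi> (z + of_real r * cis t) \<partial>circ)" for z
      have [measurable]: "A \<in> borel_measurable borel" unfolding A_def by measurable
      have int\<psi>: "integrable circ (\<lambda>t. \<psi> (z + of_real r * cis t))" for z
        by (rule integrable_circ_bounded[where B="\<bar>BW\<bar>"]) (use \<psi>B in auto)
      have A0: "0 \<le> A z" for z unfolding A_def by (intro integral_nonneg_AE AE_I2 \<psi>0)
      have AB: "\<bar>A z\<bar> \<le> \<bar>BW\<bar>" for z
      proof -
        have "A z \<le> (\<integral>t. \<bar>BW\<bar> \<partial>circ)"
          unfolding A_def by (intro integral_mono int\<psi>) (auto intro: order_trans[OF abs_ge_self \<psi>B])
        with A0[of z] show ?thesis by simp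
      qed
      have Aint: "integrable \<nu> A" and \<psi>int: "integrable \<nu> \<psi>"
        using AB \<psi>B by (auto intro!: \<nu>.integrable_const_bound[where B="\<bar>BW\<bar>"])
      have "ennreal (\<integral>z. A z \<partial>\<nu>) = (\<integral>\<^sup>+z. ennreal (A z) \<partial>\<nu>)"
        using Aint A0 by (intro nn_integral_eq_integral[symmetric]) auto
      also have "\<dots> = (\<integral>\<^sup>+z\<in>ball 0 \<rho>. ennreal (A z) * u z \<partial>lborel)"
        by (rule \<nu>) measurable
      also have "\<dots> \<le> (\<integral>\<^sup>+z. ennreal (A z) * u z \<partial>lborel)"
        by (intro nn_integral_mono) (auto simp: indicator_def)
      also have "\<dots> = (\<integral>\<^sup>+z. (\<integral>\<^sup>+t. ennreal (\<psi> (z + of_real r * cis t)) \<partial>circ) * u z \<partial>lborel)"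
        unfolding A_def using int\<psi> \<psi>0 by (subst nn_integral_eq_integral) auto
      also have "\<dots> \<le> (\<integral>\<^sup>+z. ennreal (\<psi> z) * u z \<partial>lborel)"
      proof (rule supermean_weight_test_function[OF u])
        fix z assume "ennreal (\<psi> z) \<noteq> 0"
        then have "z \<in> K" using \<psi>K by force
        then have "cball z d \<subseteq> ball 0 \<rho>" using d by blast
        moreover have "cball z r \<subseteq> cball z d" "ball (0::complex) \<rho> \<subseteq> ball 0 1"
          using r \<rho> by (auto intro!: subset_cball subset_ball)
        ultimately show "cball z r \<subseteq> ball 0 1" by blast
      qed (use r in auto)
      also have "\<dots> = (\<integral>\<^sup>+z\<in>ball 0 \<rho>. ennreal (\<psi> z) * u z \<partial>lborel)"
        by (intro nn_integral_cong) (auto simp: \<psi>_def indicator_def)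
      also have "\<dots> = (\<integral>\<^sup>+z. ennreal (\<psi> z) \<partial>\<nu>)"
        by (rule \<nu>[symmetric]) measurable
      also have "\<dots> = ennreal (\<integral>z. \<psi> z \<partial>\<nu>)"
        using \<psi>int \<psi>0 by (intro nn_integral_eq_integral) auto
      finally have mean_le: "(\<integral>z. A z \<partial>\<nu>) \<le> (\<integral>z. \<psi> z \<partial>\<nu>)"
        using \<psi>0 by (subst (asm) ennreal_le_iff) (auto intro!: integral_nonneg_AE)
      \<comment> \<open>\<open>G\<close> minorizes \<open>A - \<psi>\<close>: on
        \<open>E \<epsilon>\<close> by the mean estimate for \<open>W\<close>, because \<psi>
        dominates \<open>W - \<epsilon>\<close> on the disk; elsewhere because \<psi> vanishes at
        \<open>z\<close> while its average is non-negative.\<close>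
      define G where "G z = r\<^sup>2 * (indicator (E \<epsilon>) z * (cmod (deriv g z))\<^sup>2
        - C * (indicator (E \<epsilon>) z * (cmod (deriv f z))\<^sup>2) - C * B2\<^sup>2 * r\<^sup>2 * indicator (E \<epsilon>) z)" for z
      have iE: "integrable \<nu> (indicator (E \<epsilon>) :: _ \<Rightarrow> real)"
        by (rule \<nu>.integrable_const_bound[where B=1]) (auto simp: indicator_def)
      note ints = intE[OF Bf, of \<epsilon>] intE[OF Bg, of \<epsilon>] iE
      have Gint: "integrable \<nu> G" unfolding G_def using ints by auto
      have "G z \<le> A z - \<psi> z" for z
      proof (cases "z \<in> E \<epsilon>")
        case True
        then have zb: "z \<in> ball 0 \<rho>" and zW: "\<epsilon> < W z" by (auto simp: E_def)
        have "z \<in> K" using True by (auto simp: E_def K_def)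
        then have "cball z d \<subseteq> ball 0 \<rho>" using d by blast
        moreover have "z + of_real r * cis t \<in> cball z d" for t
          using r by (simp add: dist_norm norm_mult)
        ultimately have zt: "z + of_real r * cis t \<in> ball 0 \<rho>" for t by blast
        have "W z + G z - \<epsilon> \<le> (\<integral>t. W (z + of_real r * cis t) \<partial>circ) - \<epsilon>"
          using meanW[OF zb, of r] r True by (simp add: G_def)
        also have "\<dots> = (\<integral>t. W (z + of_real r * cis t) - \<epsilon> \<partial>circ)"
          using circ_int[OF contW] by simp
        also have "\<dots> \<le> A z"
          unfolding A_def using circ_int[OF contW] int\<psi> zt by (intro integral_mono) (auto simp: \<psi>_def)
        finally show ?thesis using zb zW by (simp add: \<psi>_def)
      next
        case False
        then have "\<psi> z = 0" by (auto simp: E_def \<psi>_def)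
        with A0[of z] False show ?thesis by (simp add: G_def)
      qed
      then have "(\<integral>z. G z \<partial>\<nu>) \<le> (\<integral>z. A z - \<psi> z \<partial>\<nu>)"
        using Gint Aint \<psi>int by (intro integral_mono) auto
      also have "\<dots> \<le> 0" using mean_le Aint \<psi>int by simp
      finally have "(\<integral>z. G z \<partial>\<nu>) \<le> 0" .
      moreover have "(\<integral>z. G z \<partial>\<nu>) = r\<^sup>2 * ((\<integral>z. indicator (E \<epsilon>) z * (cmod (deriv g z))\<^sup>2 \<partial>\<nu>)
        - C * (\<integral>z. indicator (E \<epsilon>) z * (cmod (deriv f z))\<^sup>2 \<partial>\<nu>) - C * B2\<^sup>2 * r\<^sup>2 * measure \<nu> (E \<epsilon>))"
        unfolding G_def using ints by simp
      ultimately show ?thesis using r by (simp add: mult_le_0_iff)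
    qed
    \<comment> \<open>The factor \<open>r\<^sup>2\<close> has been divided out; letting
      \<open>r\<close> tend to 0 removes the remaining error.\<close>
    have "((\<lambda>r. (\<integral>z. indicator (E \<epsilon>) z * (cmod (deriv g z))\<^sup>2 \<partial>\<nu>)
        - C * (\<integral>z. indicator (E \<epsilon>) z * (cmod (deriv f z))\<^sup>2 \<partial>\<nu>) - C * B2\<^sup>2 * r\<^sup>2 * measure \<nu> (E \<epsilon>)) \<longlongrightarrow>
        (\<integral>z. indicator (E \<epsilon>) z * (cmod (deriv g z))\<^sup>2 \<partial>\<nu>)
        - C * (\<integral>z. indicator (E \<epsilon>) z * (cmod (deriv f z))\<^sup>2 \<partial>\<nu>) - C * B2\<^sup>2 * 0\<^sup>2 * measure \<nu> (E \<epsilon>)) (at_right 0)"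
      by (intro tendsto_intros)
    moreover have "\<forall>\<^sub>F r in at_right 0. (\<integral>z. indicator (E \<epsilon>) z * (cmod (deriv g z))\<^sup>2 \<partial>\<nu>)
        - C * (\<integral>z. indicator (E \<epsilon>) z * (cmod (deriv f z))\<^sup>2 \<partial>\<nu>) - C * B2\<^sup>2 * r\<^sup>2 * measure \<nu> (E \<epsilon>) \<le> 0"
      using step d by (intro eventually_at_rightI[of 0 "min d 1"]) auto
    ultimately have "(\<integral>z. indicator (E \<epsilon>) z * (cmod (deriv g z))\<^sup>2 \<partial>\<nu>)
        - C * (\<integral>z. indicator (E \<epsilon>) z * (cmod (deriv f z))\<^sup>2 \<partial>\<nu>) - C * B2\<^sup>2 * 0\<^sup>2 * measure \<nu> (E \<epsilon>) \<le> 0"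
      by (rule tendsto_upperbound) simp
    then show ?thesis by simp
  qed
  have nn_ineq: "(\<integral>\<^sup>+z. indicator (E \<epsilon>) z * ennreal ((cmod (deriv g z))\<^sup>2) \<partial>\<nu>)
      \<le> ennreal C * (\<integral>\<^sup>+z. ennreal ((cmod (deriv f z))\<^sup>2) \<partial>\<nu>)" if \<epsilon>: "0 < \<epsilon>" for \<epsilon>
  proof -
    have conv: "(\<integral>\<^sup>+z. indicator (E \<epsilon>) z * ennreal ((cmod (deriv h z))\<^sup>2) \<partial>\<nu>)
        = ennreal (\<integral>z. indicator (E \<epsilon>) z * (cmod (deriv h z))\<^sup>2 \<partial>\<nu>)"
      if "integrable \<nu> (\<lambda>z. indicator (E \<epsilon>) z * (cmod (deriv h z))\<^sup>2)" for h
      using nn_integral_eq_integral[OF that] by (simp add: ennreal_mult' flip: ennreal_indicator)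
    have "(\<integral>\<^sup>+z. indicator (E \<epsilon>) z * ennreal ((cmod (deriv g z))\<^sup>2) \<partial>\<nu>)
       \<le> ennreal (C * (\<integral>z. indicator (E \<epsilon>) z * (cmod (deriv f z))\<^sup>2 \<partial>\<nu>))"
      using real_ineq[OF \<epsilon>] intE[OF Bg, of \<epsilon>] by (subst conv) (auto intro: ennreal_leI)
    also have "\<dots> = ennreal C * (\<integral>\<^sup>+z. indicator (E \<epsilon>) z * ennreal ((cmod (deriv f z))\<^sup>2) \<partial>\<nu>)"
      using intE[OF Bf, of \<epsilon>] C by (subst conv) (auto simp: ennreal_mult')
    also have "\<dots> \<le> ennreal C * (\<integral>\<^sup>+z. ennreal ((cmod (deriv f z))\<^sup>2) \<partial>\<nu>)"
      by (intro mult_left_mono nn_integral_mono) (auto simp: indicator_def)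
    finally show ?thesis .
  qed
  \<comment> \<open>\<open>W\<close> is positive throughout the open disk, so the sets
    \<open>E (1 / real (Suc n))\<close> exhaust it.\<close>
  have "(\<integral>\<^sup>+z. ennreal ((cmod (deriv g z))\<^sup>2) \<partial>\<nu>)
      = (\<integral>\<^sup>+z. (SUP n. indicator (E (1 / real (Suc n))) z * ennreal ((cmod (deriv g z))\<^sup>2)) \<partial>\<nu>)"
  proof (rule nn_integral_cong_AE)
    have "AE z in \<nu>. z \<in> ball 0 \<rho>"
      unfolding \<nu>_def by (subst AE_density) (auto simp: indicator_def)
    then show "AE z in \<nu>. ennreal ((cmod (deriv g z))\<^sup>2)
       = (SUP n. indicator (E (1 / real (Suc n))) z * ennreal ((cmod (deriv g z))\<^sup>2))"
    proof eventually_elim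
      case (elim z)
      have "0 < W z" using pos[OF elim] by (simp add: W_def)
      then obtain n where "1 / real (Suc n) < W z"
        using nat_approx_posE by blast
      then have n: "indicator (E (1 / real (Suc n))) z = (1::ennreal)" using elim by (simp add: E_def)
      show ?case
      proof (rule antisym)
        show "ennreal ((cmod (deriv g z))\<^sup>2) \<le> (SUP n. indicator (E (1 / real (Suc n))) z * ennreal ((cmod (deriv g z))\<^sup>2))"
          by (rule SUP_upper2[of n]) (simp_all only: n mult_1_left UNIV_I order_refl)
        show "(SUP n. indicator (E (1 / real (Suc n))) z * ennreal ((cmod (deriv g z))\<^sup>2)) \<le> ennreal ((cmod (deriv g z))\<^sup>2)"
          by (intro SUP_least) (auto simp: indicator_def)
      qed
    qed
  qed
  also have "\<dots> = (SUP n. \<integral>\<^sup>+z. indicator (E (1 / real (Suc n))) z * ennreal ((cmod (deriv g z))\<^sup>2) \<partial>\<nu>)"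
  proof (rule nn_integral_monotone_convergence_SUP)
    have "E (1 / real (Suc m)) \<subseteq> E (1 / real (Suc n))" if "m \<le> n" for m n
    proof -
      have "1 / real (Suc n) \<le> 1 / real (Suc m)" using that by (intro divide_left_mono) auto
      then show ?thesis by (auto simp: E_def)
    qed
    then show "incseq (\<lambda>n z. indicator (E (1 / real (Suc n))) z * ennreal ((cmod (deriv g z))\<^sup>2))"
      by (auto simp: incseq_def le_fun_def indicator_def)
  qed measurable
  also have "\<dots> \<le> ennreal C * (\<integral>\<^sup>+z. ennreal ((cmod (deriv f z))\<^sup>2) \<partial>\<nu>)"
    by (intro SUP_least nn_ineq) simp
  finally show ?thesis
    by (simp add: \<nu>)
qed

section \<open>Coefficient multipliers\<close>

definition tail :: "(nat \<Rightarrow> complex) \<Rightarrow> nat \<Rightarrow> complex \<Rightarrow> nat \<Rightarrow> complex" where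
  "tail a N \<eta> k = (\<Sum>j\<in>{k<..N}. a j * \<eta> ^ (j - Suc k))"

lemma tail_eq_0 [simp]: "N \<le> k \<Longrightarrow> tail a N \<eta> k = 0"
  by (simp add: tail_def)

lemma tail_Suc:
  assumes "k < N"
  shows "tail a N \<eta> k = a (Suc k) + \<eta> * tail a N \<eta> (Suc k)"
proof -
  have "{k<..N} = insert (Suc k) {Suc k<..N}" using assms by auto
  then have "tail a N \<eta> k = a (Suc k) + (\<Sum>j\<in>{Suc k<..N}. a j * \<eta> ^ (j - Suc k))"
    by (simp add: tail_def)
  also have "(\<Sum>j\<in>{Suc k<..N}. a j * \<eta> ^ (j - Suc k)) = \<eta> * tail a N \<eta> (Suc k)"
    unfolding tail_def sum_distrib_left
  proof (rule sum.cong)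
    fix j assume "j \<in> {Suc k<..N}"
    then have "j - Suc k = Suc (j - Suc (Suc k))" by auto
    then show "a j * \<eta> ^ (j - Suc k) = \<eta> * (a j * \<eta> ^ (j - Suc (Suc k)))" by simp
  qed simp
  finally show ?thesis .
qed

lemma sum_powers_eq_tail: "(\<Sum>k\<le>N. a k * \<eta> ^ k) = a 0 + \<eta> * tail a N \<eta> 0"
proof -
  have "(\<Sum>k\<le>N. a k * \<eta> ^ k) = a 0 + (\<Sum>k\<in>{0<..N}. a k * \<eta> ^ k)"
    by (simp add: sum.atMost_shift sum.lessThan_Suc_shift atLeast0AtMost[symmetric] sum.head)
  also have "(\<Sum>k\<in>{0<..N}. a k * \<eta> ^ k) = \<eta> * tail a N \<eta> 0"
    unfolding tail_def sum_distrib_left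
    by (rule sum.cong) (auto simp: power_eq_if)
  finally show ?thesis .
qed

lemma cmod_add_square: "(cmod (x + y))\<^sup>2 = (cmod x)\<^sup>2 + (cmod y)\<^sup>2 + 2 * Re (cnj x * y)"
  unfolding cmod_power2 by (simp add: power2_eq_square algebra_simps)

text \<open>The right-hand side is harmonic in \<open>\<eta>\<close>: this exhibits \<open>(1 - \<bar>\<eta>\<bar>\<^sup>2) \<Sum> \<bar>tail\<bar>\<^sup>2\<close> as the
  Green potential of \<open>4 \<bar>f'\<bar>\<^sup>2\<close> for the polynomial \<open>f\<close> with coefficients \<open>a\<close>.\<close>

lemma tail_square_identity:
  "(cmod (\<Sum>k\<le>N. a k * \<eta> ^ k))\<^sup>2 + (1 - (cmod \<eta>)\<^sup>2) * (\<Sum>k<N. (cmod (tail a N \<eta> k))\<^sup>2)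
   = (\<Sum>k\<le>N. (cmod (a k))\<^sup>2) + 2 * Re (\<Sum>k\<le>N. cnj (a k) * (\<eta> * tail a N \<eta> k))"
proof -
  let ?t = "tail a N \<eta>"
  define h where "h k = (cmod (a k))\<^sup>2 + (cmod \<eta>)\<^sup>2 * (cmod (?t k))\<^sup>2 + 2 * Re (cnj (a k) * (\<eta> * ?t k))" for k
  have h: "(cmod (a k + \<eta> * ?t k))\<^sup>2 = h k" for k
    unfolding cmod_add_square h_def by (simp add: norm_mult power_mult_distrib)
  \<comment> \<open>The recursion \<open>tail_Suc\<close> makes the square at \<open>k\<close> equal
    to \<open>h (Suc k)\<close>. The polynomial itself plays the role of the entry of index -1 and
    supplies \<open>h 0\<close>, so together they run through all \<open>h k\<close>.\<close>
  have "(\<Sum>k<N. (cmod (?t k))\<^sup>2) = (\<Sum>k<N. h (Suc k))"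
    by (intro sum.cong refl) (simp add: tail_Suc flip: h)
  then have "(cmod (\<Sum>k\<le>N. a k * \<eta> ^ k))\<^sup>2 + (\<Sum>k<N. (cmod (?t k))\<^sup>2) = h 0 + (\<Sum>k<N. h (Suc k))"
    unfolding sum_powers_eq_tail h by simp
  also have "\<dots> = (\<Sum>k\<le>N. h k)"
    by (simp add: sum.atMost_shift)
  also have "\<dots> = (\<Sum>k\<le>N. (cmod (a k))\<^sup>2) + (cmod \<eta>)\<^sup>2 * (\<Sum>k\<le>N. (cmod (?t k))\<^sup>2)
      + 2 * Re (\<Sum>k\<le>N. cnj (a k) * (\<eta> * ?t k))"
    by (simp only: h_def sum.distrib sum_distrib_left Re_sum)
  also have "(\<Sum>k\<le>N. (cmod (?t k))\<^sup>2) = (\<Sum>k<N. (cmod (?t k))\<^sup>2)"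
    by (simp add: lessThan_Suc_atMost[symmetric])
  finally show ?thesis by (simp add: algebra_simps)
qed

text \<open>Abel summation: the recursion expresses each coefficient by two neighbouring tails, so
  the multiplier acts on the tails with diagonal entries \<open>c (Suc k)\<close> and increments of
  \<open>c\<close> above the diagonal. The recursion fits a descending induction on
  \<open>k\<close>.\<close>

lemma tail_multiplier:
  "tail (\<lambda>j. of_real (c j) * a j) N \<eta> k
   = of_real (c (Suc k)) * tail a N \<eta> k
     + (\<Sum>j\<in>{k<..<N}. \<eta> ^ (j - k) * of_real (c (Suc j) - c j) * tail a N \<eta> j)"
proof (cases "k \<le> N")
  case True
  then show ?thesis
  proof (induction rule: inc_induct)
    case (step k)
    let ?t = "tail a N \<eta>"
    have eq: "(\<Sum>j\<in>{k<..<N}. \<eta> ^ (j - k) * of_real (c (Suc j) - c j) * ?t j)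
        = \<eta> * (of_real (c (Suc (Suc k)) - c (Suc k)) * ?t (Suc k)
            + (\<Sum>j\<in>{Suc k<..<N}. \<eta> ^ (j - Suc k) * of_real (c (Suc j) - c j) * ?t j))"
    proof (cases "Suc k < N")
      case True
      then have "{k<..<N} = insert (Suc k) {Suc k<..<N}" by auto
      then have "(\<Sum>j\<in>{k<..<N}. \<eta> ^ (j - k) * of_real (c (Suc j) - c j) * ?t j)
        = \<eta> * of_real (c (Suc (Suc k)) - c (Suc k)) * ?t (Suc k)
         + (\<Sum>j\<in>{Suc k<..<N}. \<eta> ^ (j - k) * of_real (c (Suc j) - c j) * ?t j)" by simp
      also have "(\<Sum>j\<in>{Suc k<..<N}. \<eta> ^ (j - k) * of_real (c (Suc j) - c j) * ?t j)
         = \<eta> * (\<Sum>j\<in>{Suc k<..<N}. \<eta> ^ (j - Suc k) * of_real (c (Suc j) - c j) * ?t j)"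
        unfolding sum_distrib_left
      proof (rule sum.cong)
        fix j assume "j \<in> {Suc k<..<N}"
        then have "j - k = Suc (j - Suc k)" by auto
        then show "\<eta> ^ (j - k) * of_real (c (Suc j) - c j) * ?t j
          = \<eta> * (\<eta> ^ (j - Suc k) * of_real (c (Suc j) - c j) * ?t j)" by simp
      qed simp
      finally show ?thesis by (simp add: algebra_simps)
    next
      case False
      with step.hyps have "N = Suc k" by simp
      then show ?thesis by simp
    qed
    show ?case
      unfolding eq
      using step.IH step.hyps by (simp add: tail_Suc[of k] algebra_simps)
  qed simp
qed simp

text \<open>The diagonal part is bounded by \<open>M\<close>, the rest by its Hilbert-Schmidt norm:
  Cauchy-Schwarz in each row, powers of \<eta> discarded, then the triangle inequality for the two
  parts.\<close>

lemma tail_multiplier_bound: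
  assumes \<eta>: "cmod \<eta> \<le> 1" and M: "\<And>k. \<bar>c k\<bar> \<le> M"
    and D: "(\<Sum>j<N. real j * (c (Suc j) - c j)\<^sup>2) \<le> D"
  shows "(\<Sum>k<N. (cmod (tail (\<lambda>j. of_real (c j) * a j) N \<eta> k))\<^sup>2)
    \<le> (M + sqrt D)\<^sup>2 * (\<Sum>k<N. (cmod (tail a N \<eta> k))\<^sup>2)"
proof -
  let ?t = "tail a N \<eta>"
  define L where "L = L2_set (\<lambda>k. cmod (?t k)) {..<N}"
  define d where "d j = c (Suc j) - c j" for j
  define S where "S k = (\<Sum>j\<in>{k<..<N}. \<bar>d j\<bar> * cmod (?t j))" for k
  have L0: "0 \<le> L" by (simp add: L_def L2_set_nonneg)
  have M0: "0 \<le> M" using M[of 0] by linarith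
  have S2: "(S k)\<^sup>2 \<le> (\<Sum>j\<in>{k<..<N}. (d j)\<^sup>2) * L\<^sup>2" for k
  proof -
    have "S k \<le> L2_set d {k<..<N} * L2_set (\<lambda>k. cmod (?t k)) {k<..<N}"
      unfolding S_def using L2_set_mult_ineq[of d "\<lambda>k. cmod (?t k)" "{k<..<N}"] by simp
    also have "\<dots> \<le> L2_set d {k<..<N} * L"
      unfolding L_def L2_set_def by (intro mult_left_mono real_sqrt_le_mono sum_mono2) (auto intro: sum_nonneg)
    finally have "(S k)\<^sup>2 \<le> (L2_set d {k<..<N} * L)\<^sup>2"
      by (intro power_mono) (auto simp: S_def intro: sum_nonneg)
    then show ?thesis
      by (simp add: power_mult_distrib L2_set_def sum_nonneg)
  qed
  \<comment> \<open>Column \<open>j\<close> has its increment in the \<open>j\<close> rows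
    \<open>k < j\<close>; this produces the weight \<open>real j\<close>.\<close>
  have "(\<Sum>k<N. \<Sum>j\<in>{k<..<N}. (d j)\<^sup>2) = (\<Sum>j<N. real j * (d j)\<^sup>2)"
  proof -
    have "(\<Sum>k<N. \<Sum>j\<in>{k<..<N}. (d j)\<^sup>2) = (\<Sum>k<N. \<Sum>j<N. if k < j then (d j)\<^sup>2 else 0)"
    proof (rule sum.cong)
      fix k
      have "{..<N} \<inter> {j. k < j} = {k<..<N}" by auto
      then show "(\<Sum>j\<in>{k<..<N}. (d j)\<^sup>2) = (\<Sum>j<N. if k < j then (d j)\<^sup>2 else 0)"
        by (simp add: sum.If_cases)
    qed simp
    also have "\<dots> = (\<Sum>j<N. \<Sum>k<N. if k < j then (d j)\<^sup>2 else 0)"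
      by (rule sum.swap)
    also have "\<dots> = (\<Sum>j<N. real j * (d j)\<^sup>2)"
    proof (rule sum.cong)
      fix j assume "j \<in> {..<N}"
      then have "{..<N} \<inter> {k. k < j} = {..<j}" by auto
      then show "(\<Sum>k<N. if k < j then (d j)\<^sup>2 else 0) = real j * (d j)\<^sup>2"
        by (simp add: sum.If_cases)
    qed simp
    finally show ?thesis .
  qed
  then have "(\<Sum>k<N. \<Sum>j\<in>{k<..<N}. (d j)\<^sup>2) \<le> D"
    using D by (simp add: d_def)
  then have "(\<Sum>k<N. \<Sum>j\<in>{k<..<N}. (d j)\<^sup>2) * L\<^sup>2 \<le> D * L\<^sup>2"
    by (rule mult_right_mono) simp
  moreover have "(\<Sum>k<N. (S k)\<^sup>2) \<le> (\<Sum>k<N. \<Sum>j\<in>{k<..<N}. (d j)\<^sup>2) * L\<^sup>2"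
    unfolding sum_distrib_right[of _ "{..<N}"] by (intro sum_mono S2)
  ultimately have "(\<Sum>k<N. (S k)\<^sup>2) \<le> D * L\<^sup>2"
    by simp
  then have "L2_set S {..<N} \<le> sqrt (D * L\<^sup>2)"
    unfolding L2_set_def by (rule real_sqrt_le_mono)
  then have LS: "L2_set S {..<N} \<le> sqrt D * L"
    using L0 by (simp add: real_sqrt_mult)
  have "cmod (tail (\<lambda>j. of_real (c j) * a j) N \<eta> k) \<le> M * cmod (?t k) + S k" for k
  proof -
    have "cmod (\<Sum>j\<in>{k<..<N}. \<eta> ^ (j - k) * of_real (c (Suc j) - c j) * ?t j) \<le> S k"
      unfolding S_def
    proof (rule order_trans[OF norm_sum], rule sum_mono)
      fix j
      have "cmod \<eta> ^ (j - k) \<le> 1" using \<eta> by (intro power_le_one) auto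
      then have "cmod \<eta> ^ (j - k) * (\<bar>d j\<bar> * cmod (?t j)) \<le> 1 * (\<bar>d j\<bar> * cmod (?t j))"
        by (intro mult_right_mono) auto
      then show "cmod (\<eta> ^ (j - k) * of_real (c (Suc j) - c j) * ?t j) \<le> \<bar>d j\<bar> * cmod (?t j)"
        by (simp add: norm_mult norm_power d_def mult.assoc del: of_real_diff)
    qed
    moreover have "cmod (of_real (c (Suc k)) * ?t k) \<le> M * cmod (?t k)"
      using M by (simp add: norm_mult mult_right_mono)
    ultimately show ?thesis
      unfolding tail_multiplier by (intro order_trans[OF norm_triangle_ineq] add_mono)
  qed
  then have "L2_set (\<lambda>k. cmod (tail (\<lambda>j. of_real (c j) * a j) N \<eta> k)) {..<N}
      \<le> L2_set (\<lambda>k. M * cmod (?t k) + S k) {..<N}"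
    by (intro L2_set_mono) auto
  also have "\<dots> \<le> L2_set (\<lambda>k. M * cmod (?t k)) {..<N} + L2_set S {..<N}"
    by (rule L2_set_triangle_ineq)
  also have "L2_set (\<lambda>k. M * cmod (?t k)) {..<N} = M * L"
    using M0 by (simp add: L_def L2_set_right_distrib)
  also have "M * L + L2_set S {..<N} \<le> (M + sqrt D) * L"
    using LS by (simp add: algebra_simps)
  finally have "(L2_set (\<lambda>k. cmod (tail (\<lambda>j. of_real (c j) * a j) N \<eta> k)) {..<N})\<^sup>2 \<le> ((M + sqrt D) * L)\<^sup>2"
    by (intro power_mono) (auto simp: L2_set_nonneg)
  then show ?thesis
    by (simp add: L_def L2_set_def power_mult_distrib sum_nonneg)
qed

section \<open>Energy bounds for coefficient multipliers, on smaller disks and then on the unit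
  disk\<close>

definition energy :: "(complex \<Rightarrow> ennreal) \<Rightarrow> complex set \<Rightarrow> (complex \<Rightarrow> complex) \<Rightarrow> ennreal" where
  "energy u S f = (\<integral>\<^sup>+z\<in>S. ennreal ((cmod (deriv f z))\<^sup>2) * u z \<partial>lborel)"

text \<open>The function \<open>W\<close> of the energy comparison is
  \<open>1 - \<bar>\<eta>\<bar>\<^sup>2\<close> times \<open>K\<close> times the tail sum of
  \<open>f\<close> minus that of \<open>g\<close>. It vanishes on the boundary, and the strict
  inequality for \<open>K\<close> makes it positive inside. For a constant polynomial all tails
  vanish, but then both energies are 0.\<close>

lemma energy_polynomial_multiplier:
  fixes a :: "nat \<Rightarrow> complex" and c :: "nat \<Rightarrow> real"
  assumes u: "supermean_weight u" and \<rho>: "0 < \<rho>" "\<rho> \<le> 1"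
    and fin: "(\<integral>\<^sup>+z\<in>ball 0 \<rho>. u z \<partial>lborel) < \<infinity>"
    and M: "\<And>k. \<bar>c k\<bar> \<le> M" and D: "(\<Sum>j<N. real j * (c (Suc j) - c j)\<^sup>2) \<le> D"
    and K: "(M + sqrt D)\<^sup>2 < K"
  shows "energy u (ball 0 \<rho>) (\<lambda>z. \<Sum>k\<le>N. of_real (c k) * a k * z ^ k)
    \<le> ennreal K * energy u (ball 0 \<rho>) (\<lambda>z. \<Sum>k\<le>N. a k * z ^ k)"
proof (cases "\<exists>k\<in>{0<..N}. a k \<noteq> 0")
  case False
  have "(\<Sum>k\<le>N. of_real (c k) * a k * z ^ k) = of_real (c 0) * a 0" for z
    using False unfolding sum.atMost_shift by (simp add: sum.neutral)
  then show ?thesis by (simp add: energy_def)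
next
  case True
  \<comment> \<open>Rescaling to \<open>\<eta> = z / of_real \<rho>\<close> moves the disk of radius
    \<rho> to the unit disk, where the tail identity is harmonic.\<close>
  define A where "A k = a k * of_real \<rho> ^ k" for k
  define A' where "A' k = of_real (c k) * A k" for k
  define f where "f z = (\<Sum>k\<le>N. a k * z ^ k)" for z
  define g where "g z = (\<Sum>k\<le>N. of_real (c k) * a k * z ^ k)" for z
  define h where "h B \<eta> = of_real (\<Sum>k\<le>N. (cmod (B k))\<^sup>2) + 2 * (\<Sum>k\<le>N. cnj (B k) * (\<eta> * tail B N \<eta> k))"
    for B and \<eta> :: complex
  define H where "H z = of_real K * h A (z / of_real \<rho>) - h A' (z / of_real \<rho>)" for z
  have fA: "f z = (\<Sum>k\<le>N. A k * (z / of_real \<rho>) ^ k)" for z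
    using \<rho> by (simp add: f_def A_def power_divide)
  have gA: "g z = (\<Sum>k\<le>N. A' k * (z / of_real \<rho>) ^ k)" for z
    using \<rho> by (simp add: g_def A'_def A_def power_divide mult.assoc)
  have hid: "Re (h B \<eta>) = (cmod (\<Sum>k\<le>N. B k * \<eta> ^ k))\<^sup>2 + (1 - (cmod \<eta>)\<^sup>2) * (\<Sum>k<N. (cmod (tail B N \<eta> k))\<^sup>2)" for B \<eta>
    unfolding tail_square_identity h_def by simp
  have K0: "0 \<le> K" using K by (meson less_imp_le order_trans zero_le_power2)
  have Re_of_real_mult: "Re (of_real x * w) = x * Re w" for x w
    by simp
  have ReH: "Re (H z) = K * (cmod (f z))\<^sup>2 - (cmod (g z))\<^sup>2 + (1 - (cmod (z / of_real \<rho>))\<^sup>2) *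
      (K * (\<Sum>k<N. (cmod (tail A N (z / of_real \<rho>) k))\<^sup>2) - (\<Sum>k<N. (cmod (tail A' N (z / of_real \<rho>) k))\<^sup>2))" for z
    unfolding H_def minus_complex.simps Re_complex_of_real Re_of_real_mult hid fA gA
    by (simp add: hid algebra_simps)
  have "energy u (ball 0 \<rho>) g \<le> ennreal K * energy u (ball 0 \<rho>) f"
    unfolding energy_def
  proof (rule weighted_energy_compare[OF u \<rho> fin])
    show "f holomorphic_on UNIV" "g holomorphic_on UNIV"
      unfolding f_def g_def by (intro holomorphic_intros)+
    show "H holomorphic_on UNIV"
      unfolding H_def h_def tail_def using \<rho> by (intro holomorphic_intros) auto
    show "0 \<le> K" by (rule K0)
  next
    fix z :: complex assume z: "z \<in> ball 0 \<rho>"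
    define \<eta> where "\<eta> = z / of_real \<rho>"
    have \<eta>: "cmod \<eta> < 1" using z \<rho> by (simp add: \<eta>_def norm_divide)
    \<comment> \<open>The last non-zero coefficient is alone in the tail just before it, so the tail
      sum is positive at every point.\<close>
    have "finite {k\<in>{0<..N}. a k \<noteq> 0}" "{k\<in>{0<..N}. a k \<noteq> 0} \<noteq> {}" using True by auto
    then have n: "Max {k\<in>{0<..N}. a k \<noteq> 0} \<in> {k\<in>{0<..N}. a k \<noteq> 0}" by (rule Max_in)
    define n where "n = Max {k\<in>{0<..N}. a k \<noteq> 0}"
    have n1: "0 < n" "n \<le> N" "a n \<noteq> 0" using n by (auto simp: n_def)
    have n2: "a k = 0" if "n < k" "k \<le> N" for k
    proof (rule ccontr)
      assume "a k \<noteq> 0"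
      then have "k \<le> n" unfolding n_def using that by (intro Max_ge) auto
      with that show False by simp
    qed
    have "tail A N \<eta> (n - 1) = (\<Sum>j\<in>{n}. A j * \<eta> ^ (j - Suc (n - 1)))"
      unfolding tail_def using n1 n2 by (intro sum.mono_neutral_right) (auto simp: A_def)
    also have "\<dots> = A n" using n1 by simp
    finally have "0 < (cmod (tail A N \<eta> (n - 1)))\<^sup>2" using n1 \<rho> by (simp add: A_def)
    also have "\<dots> \<le> (\<Sum>k<N. (cmod (tail A N \<eta> k))\<^sup>2)"
      using n1 by (intro member_le_sum) auto
    finally have pos: "0 < (\<Sum>k<N. (cmod (tail A N \<eta> k))\<^sup>2)" .
    have "(\<Sum>k<N. (cmod (tail A' N \<eta> k))\<^sup>2) \<le> (M + sqrt D)\<^sup>2 * (\<Sum>k<N. (cmod (tail A N \<eta> k))\<^sup>2)"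
      unfolding A'_def using \<eta> M D by (intro tail_multiplier_bound) auto
    also have "\<dots> < K * (\<Sum>k<N. (cmod (tail A N \<eta> k))\<^sup>2)"
      using K pos by (rule mult_strict_right_mono)
    finally have "0 < (1 - (cmod \<eta>)\<^sup>2) * (K * (\<Sum>k<N. (cmod (tail A N \<eta> k))\<^sup>2) - (\<Sum>k<N. (cmod (tail A' N \<eta> k))\<^sup>2))"
      using \<eta> by (intro mult_pos_pos) (auto simp: power_less_one_iff abs_square_less_1)
    then show "K * (cmod (f z))\<^sup>2 - (cmod (g z))\<^sup>2 < Re (H z)"
      unfolding ReH \<eta>_def by simp
  next
    fix z :: complex assume "z \<in> sphere 0 \<rho>"
    then show "Re (H z) \<le> K * (cmod (f z))\<^sup>2 - (cmod (g z))\<^sup>2"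
      unfolding ReH using \<rho> by (simp add: norm_divide)
  qed
  then show ?thesis unfolding f_def g_def .
qed

lemma power_series_deriv:
  fixes a :: "nat \<Rightarrow> complex"
  assumes F: "\<And>z. z \<in> ball 0 1 \<Longrightarrow> (\<lambda>k. a k * z ^ k) sums F z" and z: "z \<in> ball 0 1"
  shows "(\<lambda>k. of_nat (Suc k) * a (Suc k) * z ^ k) sums deriv F z"
    and "summable (\<lambda>k. norm (of_nat (Suc k) * a (Suc k) * z ^ k))"
proof -
  have sm: "summable (\<lambda>k. a k * w ^ k)" if "norm w < 1" for w
    using F[of w] that by (auto simp: sums_iff)
  have "((\<lambda>w. \<Sum>k. a k * w ^ k) has_field_derivative (\<Sum>k. diffs a k * z ^ k)) (at z)"
    by (rule termdiffs_strong'[OF sm]) (use z in auto)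
  then have "(F has_field_derivative (\<Sum>k. diffs a k * z ^ k)) (at z)"
    by (rule has_field_derivative_transform_within_open[where S="ball 0 1"])
       (use z F in \<open>auto simp: sums_iff\<close>)
  then have "deriv F z = (\<Sum>k. diffs a k * z ^ k)" by (rule DERIV_imp_deriv)
  moreover have sd: "summable (\<lambda>k. diffs a k * w ^ k)" if "norm w < 1" for w
    by (rule termdiff_converges[of _ 1]) (use that sm in auto)
  ultimately show "(\<lambda>k. of_nat (Suc k) * a (Suc k) * z ^ k) sums deriv F z"
    using z summable_sums[OF sd[of z]] by (simp add: diffs_def)
  define s where "s = (1 + norm z) / 2"
  have s: "norm z < s" "s < 1" using z by (auto simp: s_def)
  have "0 \<le> s" unfolding s_def by simp
  have "summable (\<lambda>k. norm (diffs a k * z ^ k))"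
    by (rule powser_insidea[OF sd[of "of_real s"]]) (use s \<open>0 \<le> s\<close> in auto)
  then show "summable (\<lambda>k. norm (of_nat (Suc k) * a (Suc k) * z ^ k))"
    by (simp add: diffs_def)
qed

lemma deriv_polynomial:
  "deriv (\<lambda>z::complex. \<Sum>k\<le>N. a k * z ^ k) z = (\<Sum>k<N. of_nat (Suc k) * a (Suc k) * z ^ k)"
proof -
  have "((\<lambda>z. \<Sum>k\<le>N. a k * z ^ k) has_field_derivative (\<Sum>k\<le>N. a k * (of_nat k * z ^ (k - 1)))) (at z)"
    by (intro DERIV_sum) (auto intro!: derivative_eq_intros)
  then have "deriv (\<lambda>z. \<Sum>k\<le>N. a k * z ^ k) z = (\<Sum>k\<le>N. a k * (of_nat k * z ^ (k - 1)))"
    by (rule DERIV_imp_deriv)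
  then show ?thesis by (simp add: sum.atMost_shift mult_ac)
qed

text \<open>The weight is known to be integrable only on strictly smaller disks; bounds proved there
  with a common constant pass to the unit disk by monotone convergence.\<close>

lemma energy_exhaust:
  assumes [measurable]: "u \<in> borel_measurable borel"
    and le: "\<And>\<rho>. 0 < \<rho> \<Longrightarrow> \<rho> < 1 \<Longrightarrow> energy u (ball 0 \<rho>) f \<le> B"
    and f: "f holomorphic_on ball 0 1"
  shows "energy u (ball 0 1) f \<le> B"
proof -
  define \<rho> where "\<rho> n = 1 - 1 / real (n + 2)" for n
  have \<rho>: "0 < \<rho> n" "\<rho> n < 1" "\<rho> n \<le> \<rho> (n + m)" for n m
    by (auto simp: \<rho>_def field_simps)
  define v where "v z = (if z \<in> ball 0 1 then ennreal ((cmod (deriv f z))\<^sup>2) * u z else 0)" for z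
  have "continuous_on (ball 0 1) (deriv f)"
    by (intro holomorphic_on_imp_continuous_on holomorphic_deriv f) auto
  then have dm: "(\<lambda>z. if z \<in> ball 0 1 then deriv f z else 0) \<in> borel_measurable borel"
    by (intro borel_measurable_continuous_on_if) auto
  have "v = (\<lambda>z. ennreal ((cmod (if z \<in> ball 0 1 then deriv f z else 0))\<^sup>2) * u z)"
    by (auto simp: v_def)
  with dm have [measurable]: "v \<in> borel_measurable borel" by simp
  have v: "energy u (ball 0 r) f = (\<integral>\<^sup>+z. v z * indicator (ball 0 r) z \<partial>lborel)" if "r \<le> 1" for r
    unfolding energy_def using that by (intro nn_integral_cong) (auto simp: v_def indicator_def)
  have "(SUP n. v z * indicator (ball 0 (\<rho> n)) z) = v z * indicator (ball 0 1) z" for z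
  proof (rule antisym)
    show "(SUP n. v z * indicator (ball 0 (\<rho> n)) z) \<le> v z * indicator (ball 0 1) z"
      using \<rho>(2) by (intro SUP_least) (auto simp: indicator_def intro: less_trans)
    show "v z * indicator (ball 0 1) z \<le> (SUP n. v z * indicator (ball 0 (\<rho> n)) z)"
    proof (cases "z \<in> ball 0 1")
      case True
      then obtain n where "1 / real (Suc n) < 1 - cmod z"
        using nat_approx_posE[of "1 - cmod z"] by auto
      moreover have "1 / real (n + 2) \<le> 1 / real (Suc n)" by (simp add: field_simps)
      ultimately have "z \<in> ball 0 (\<rho> n)" by (simp add: \<rho>_def)
      with True show ?thesis
        by (intro SUP_upper2[of n]) (auto simp: indicator_def)
    qed simp
  qed
  then have "energy u (ball 0 1) f = (\<integral>\<^sup>+z. (SUP n. v z * indicator (ball 0 (\<rho> n)) z) \<partial>lborel)"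
    by (simp add: v)
  also have "\<dots> = (SUP n. \<integral>\<^sup>+z. v z * indicator (ball 0 (\<rho> n)) z \<partial>lborel)"
  proof (rule nn_integral_monotone_convergence_SUP)
    have "\<rho> m \<le> \<rho> n" if "m \<le> n" for m n using \<rho>(3)[of m "n - m"] that by simp
    then show "incseq (\<lambda>n z. v z * indicator (ball 0 (\<rho> n)) z)"
      by (auto simp: incseq_def le_fun_def indicator_def intro: less_le_trans)
  qed measurable
  also have "\<dots> \<le> B"
    using le[OF \<rho>(1,2)] \<rho>(2) by (intro SUP_least) (simp add: v less_imp_le)
  finally show ?thesis .
qed

text \<open>The polynomial bound is applied to the partial sums of degree \<open>N \<ge> n\<close>.
  The multiplier kills everything beyond \<open>n\<close>, so the left-hand side does not change
  with \<open>N\<close>, while on a smaller disk the energies on the right converge.\<close>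

lemma energy_multiplier:
  fixes a :: "nat \<Rightarrow> complex" and c :: "nat \<Rightarrow> real"
  assumes u: "supermean_weight u"
    and fin: "\<And>\<rho>. \<rho> < 1 \<Longrightarrow> (\<integral>\<^sup>+z\<in>ball 0 \<rho>. u z \<partial>lborel) < \<infinity>"
    and F: "\<And>z. z \<in> ball 0 1 \<Longrightarrow> (\<lambda>k. a k * z ^ k) sums F z"
    and M: "\<And>k. \<bar>c k\<bar> \<le> M" and supp: "\<And>k. n < k \<Longrightarrow> c k = 0"
    and D: "(\<Sum>j\<le>n. real j * (c (Suc j) - c j)\<^sup>2) \<le> D"
    and K: "(M + sqrt D)\<^sup>2 < K"
  shows "energy u (ball 0 1) (\<lambda>z. \<Sum>k\<le>n. of_real (c k) * a k * z ^ k) \<le> ennreal K * energy u (ball 0 1) F"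
proof (rule energy_exhaust)
  show um [measurable]: "u \<in> borel_measurable borel" by (rule supermean_weight_measurable[OF u])
  show "(\<lambda>z. \<Sum>k\<le>n. of_real (c k) * a k * z ^ k) holomorphic_on ball 0 1"
    by (intro holomorphic_intros)
  fix \<rho> :: real assume \<rho>: "0 < \<rho>" "\<rho> < 1"
  define p where "p N z = (\<Sum>k\<le>N. a k * z ^ k)" for N and z :: complex
  \<comment> \<open>Increments vanish beyond \<open>n\<close>; the one at \<open>j = n\<close> is
    the jump from \<open>c n\<close> to 0 and has to be counted.\<close>
  have D': "(\<Sum>j<N. real j * (c (Suc j) - c j)\<^sup>2) \<le> D" for N
  proof -
    have "(\<Sum>j<N. real j * (c (Suc j) - c j)\<^sup>2) = (\<Sum>j\<in>{..<N} \<inter> {..n}. real j * (c (Suc j) - c j)\<^sup>2)"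
    proof (rule sum.mono_neutral_right)
      show "\<forall>j\<in>{..<N} - {..<N} \<inter> {..n}. real j * (c (Suc j) - c j)\<^sup>2 = 0"
      proof
        fix j assume "j \<in> {..<N} - {..<N} \<inter> {..n}"
        then have "n < j" by auto
        then show "real j * (c (Suc j) - c j)\<^sup>2 = 0"
          using supp[of j] supp[of "Suc j"] by simp
      qed
    qed auto
    also have "\<dots> \<le> (\<Sum>j\<le>n. real j * (c (Suc j) - c j)\<^sup>2)"
      by (rule sum_mono2) auto
    finally show ?thesis using D by simp
  qed
  have le: "energy u (ball 0 \<rho>) (\<lambda>z. \<Sum>k\<le>n. of_real (c k) * a k * z ^ k) \<le> ennreal K * energy u (ball 0 \<rho>) (p N)"
    if N: "n \<le> N" for N
  proof -
    have "(\<Sum>k\<le>n. of_real (c k) * a k * z ^ k) = (\<Sum>k\<le>N. of_real (c k) * a k * z ^ k)" for z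
      using N by (intro sum.mono_neutral_left) (auto simp: supp not_le)
    then show ?thesis
      unfolding p_def using energy_polynomial_multiplier[OF u \<rho>(1) _ fin[OF \<rho>(2)] M D' K] \<rho> by simp
  qed
  have rho_mem: "of_real \<rho> \<in> ball (0::complex) 1" using \<rho> by simp
  define B where "B = (\<Sum>k. norm (of_nat (Suc k) * a (Suc k) * of_real \<rho> ^ k))"
  have dp: "(\<lambda>N. deriv (p N) z) \<longlonglongrightarrow> deriv F z" if "z \<in> ball 0 1" for z
    using power_series_deriv(1)[OF F that] unfolding p_def deriv_polynomial sums_def .
  have bound: "cmod (deriv (p N) z) \<le> B" if z: "z \<in> ball 0 \<rho>" for N z
  proof -
    have "cmod (deriv (p N) z) \<le> (\<Sum>k<N. norm (of_nat (Suc k) * a (Suc k) * of_real \<rho> ^ k))"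
      unfolding p_def deriv_polynomial
      using z \<rho> by (intro order_trans[OF norm_sum] sum_mono) (auto simp: norm_mult norm_power intro!: mult_left_mono power_mono)
    also have "\<dots> \<le> B"
      unfolding B_def using power_series_deriv(2)[OF F rho_mem] by (intro sum_le_suminf) auto
    finally show ?thesis .
  qed
  have "continuous_on UNIV (deriv (p N))" for N
    unfolding p_def deriv_polynomial by (intro continuous_intros)
  then have [measurable]: "deriv (p N) \<in> borel_measurable borel" for N
    by (rule borel_measurable_continuous_onI)
  have "(\<lambda>N. energy u (ball 0 \<rho>) (p N)) \<longlonglongrightarrow> energy u (ball 0 \<rho>) F"
    unfolding energy_def
  proof (rule nn_integral_dominated_convergence[where w="\<lambda>z. ennreal (B\<^sup>2) * (u z * indicator (ball 0 \<rho>) z)"])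
    show "(\<integral>\<^sup>+z. ennreal (B\<^sup>2) * (u z * indicator (ball 0 \<rho>) z) \<partial>lborel) < \<infinity>"
      using fin[OF \<rho>(2)] by (subst nn_integral_cmult) (auto simp: ennreal_mult_less_top)
    show "AE z in lborel. ennreal ((cmod (deriv (p N) z))\<^sup>2) * u z * indicator (ball 0 \<rho>) z
        \<le> ennreal (B\<^sup>2) * (u z * indicator (ball 0 \<rho>) z)" for N
      by (intro AE_I2) (auto simp: indicator_def intro!: mult_right_mono ennreal_leI power_mono bound)
    \<comment> \<open>Multiplication in \<open>ennreal\<close> is discontinuous at 0 times infinity,
      so the points where the weight is infinite are excluded as a null set.\<close>
    have "AE z in lborel. u z * indicator (ball 0 \<rho>) z < \<infinity>"
      using nn_integral_PInf_AE[of "\<lambda>z. u z * indicator (ball 0 \<rho>) z" lborel] fin[OF \<rho>(2)]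
      by (auto simp: less_top)
    then have "AE z in lborel. (\<lambda>N. ennreal ((cmod (deriv (p N) z))\<^sup>2) * u z * indicator (ball 0 \<rho>) z)
        \<longlonglongrightarrow> ennreal ((cmod (deriv F z))\<^sup>2) * u z * indicator (ball 0 \<rho>) z"
    proof eventually_elim
      case (elim z)
      show ?case
      proof (cases "z \<in> ball 0 \<rho>")
        case True
        then have "(\<lambda>N. ennreal ((cmod (deriv (p N) z))\<^sup>2) * u z) \<longlonglongrightarrow> ennreal ((cmod (deriv F z))\<^sup>2) * u z"
          using \<rho> elim dp[of z]
          by (intro tendsto_mult_ennreal tendsto_ennrealI tendsto_power tendsto_norm tendsto_const)
             (auto simp: less_top)
        with True show ?thesis by simp
      qed simp
    qed
    then show "AE z in lborel. (\<lambda>N. ennreal ((cmod (deriv (p N) z))\<^sup>2) * u z * indicator (ball 0 \<rho>) z)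
        \<longlonglongrightarrow> ennreal ((cmod (deriv F z))\<^sup>2) * u z * indicator (ball 0 \<rho>) z" .
    have "F holomorphic_on ball 0 1"
      by (rule power_series_holomorphic) (use F in auto)
    then have "continuous_on (ball 0 1) (deriv F)"
      by (intro holomorphic_on_imp_continuous_on holomorphic_deriv) auto
    then have dm: "(\<lambda>z. if z \<in> ball 0 1 then deriv F z else 0) \<in> borel_measurable borel"
      by (intro borel_measurable_continuous_on_if) auto
    have "(\<lambda>z. ennreal ((cmod (deriv F z))\<^sup>2) * u z * indicator (ball 0 \<rho>) z)
       = (\<lambda>z. ennreal ((cmod (if z \<in> ball 0 1 then deriv F z else 0))\<^sup>2) * u z * indicator (ball 0 \<rho>) z)"
      using \<rho> by (auto simp: indicator_def)
    with dm show "(\<lambda>z. ennreal ((cmod (deriv F z))\<^sup>2) * u z * indicator (ball 0 \<rho>) z) \<in> borel_measurable lborel"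
      by simp
  qed measurable
  then have "(\<lambda>N. ennreal K * energy u (ball 0 \<rho>) (p N)) \<longlonglongrightarrow> ennreal K * energy u (ball 0 \<rho>) F"
    by (intro ennreal_tendsto_cmult) auto
  then have "energy u (ball 0 \<rho>) (\<lambda>z. \<Sum>k\<le>n. of_real (c k) * a k * z ^ k) \<le> ennreal K * energy u (ball 0 \<rho>) F"
    by (rule LIMSEQ_le_const) (use le in blast)
  also have "\<dots> \<le> ennreal K * energy u (ball 0 1) F"
    unfolding energy_def using \<rho> by (intro mult_left_mono nn_integral_mono) (auto simp: indicator_def)
  finally show "energy u (ball 0 \<rho>) (\<lambda>z. \<Sum>k\<le>n. of_real (c k) * a k * z ^ k) \<le> ennreal K * energy u (ball 0 1) F" .
qed

section \<open>Approximation by polynomials\<close>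

lemma power_series_holomorphic_ball:
  assumes "\<And>z. z \<in> ball 0 1 \<Longrightarrow> (\<lambda>k. a k * z ^ k) sums F z"
  shows "F holomorphic_on ball (0::complex) 1"
  by (rule power_series_holomorphic) (use assms in auto)

lemma measurable_deriv_on_ball:
  assumes "f holomorphic_on ball 0 1"
  shows "(\<lambda>z. if z \<in> ball 0 1 then deriv f z else 0) \<in> borel_measurable borel"
proof -
  have "continuous_on (ball 0 1) (deriv f)"
    by (intro holomorphic_on_imp_continuous_on holomorphic_deriv assms) auto
  then show ?thesis by (intro borel_measurable_continuous_on_if) auto
qed

definition disk_measure :: "(complex \<Rightarrow> ennreal) \<Rightarrow> complex measure" where
  "disk_measure u = density lborel (\<lambda>z. u z * indicator (ball 0 1) z)"

lemma sets_disk_measure [measurable_cong, simp]: "sets (disk_measure u) = sets borel"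
  and space_disk_measure [simp]: "space (disk_measure u) = UNIV"
  by (simp_all add: disk_measure_def)

text \<open>\<open>deriv f\<close> is uncontrolled outside the disk. A measurable \<open>g\<close>
  agreeing with it inside replaces it, as \<open>disk_measure\<close> carries no mass
  outside.\<close>

lemma energy_eq_disk_measure:
  assumes [measurable]: "u \<in> borel_measurable borel" "g \<in> borel_measurable borel"
    and g: "\<And>z. z \<in> ball 0 1 \<Longrightarrow> g z = deriv f z"
  shows "energy u (ball 0 1) f = (\<integral>\<^sup>+z. ennreal ((cmod (g z))\<^sup>2) \<partial>disk_measure u)"
  unfolding energy_def disk_measure_def
  by (subst nn_integral_density) (auto intro!: nn_integral_cong simp: g mult_ac indicator_def)

lemma energy_add3:
  assumes [measurable]: "u \<in> borel_measurable borel"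
    and hol: "f holomorphic_on ball 0 1" "g holomorphic_on ball 0 1" "h holomorphic_on ball 0 1"
    and F: "\<And>z. z \<in> ball 0 1 \<Longrightarrow> F z = f z + g z + h z"
  shows "energy u (ball 0 1) F \<le> 3 * (energy u (ball 0 1) f + energy u (ball 0 1) g + energy u (ball 0 1) h)"
proof -
  define f' where "f' z = (if z \<in> ball 0 1 then deriv f z else 0)" for z
  define g' where "g' z = (if z \<in> ball 0 1 then deriv g z else 0)" for z
  define h' where "h' z = (if z \<in> ball 0 1 then deriv h z else 0)" for z
  have m [measurable]: "f' \<in> borel_measurable borel" "g' \<in> borel_measurable borel" "h' \<in> borel_measurable borel"
    unfolding f'_def g'_def h'_def by (intro measurable_deriv_on_ball hol)+
  have "deriv F z = f' z + g' z + h' z" if z: "z \<in> ball 0 1" for z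
  proof -
    have "(f has_field_derivative deriv f z) (at z)" "(g has_field_derivative deriv g z) (at z)"
      "(h has_field_derivative deriv h z) (at z)"
      using hol z by (auto intro: holomorphic_derivI)
    then have "((\<lambda>z. f z + g z + h z) has_field_derivative deriv f z + deriv g z + deriv h z) (at z)"
      by (intro DERIV_add)
    then have "(F has_field_derivative deriv f z + deriv g z + deriv h z) (at z)"
      by (rule has_field_derivative_transform_within_open[where S="ball 0 1"]) (use z F in auto)
    then show ?thesis using z by (simp add: DERIV_imp_deriv f'_def g'_def h'_def)
  qed
  then have "energy u (ball 0 1) F = (\<integral>\<^sup>+z. ennreal ((cmod (f' z + g' z + h' z))\<^sup>2) \<partial>disk_measure u)"
    by (intro energy_eq_disk_measure) auto
  also have "\<dots> \<le> (\<integral>\<^sup>+z. 3 * (ennreal ((cmod (f' z))\<^sup>2) + ennreal ((cmod (g' z))\<^sup>2) + ennreal ((cmod (h' z))\<^sup>2)) \<partial>disk_measure u)"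
  proof (rule nn_integral_mono)
    fix z
    have sq: "(x + y + w)\<^sup>2 \<le> 3 * (x\<^sup>2 + y\<^sup>2 + w\<^sup>2)" for x y w :: real
    proof -
      have "0 \<le> (x - y)\<^sup>2 + (y - w)\<^sup>2 + (x - w)\<^sup>2" by simp
      then show ?thesis by (simp add: power2_eq_square algebra_simps)
    qed
    have "cmod (f' z + g' z + h' z) \<le> cmod (f' z) + cmod (g' z) + cmod (h' z)"
      by (meson add_mono norm_triangle_ineq order_refl order_trans)
    then have "(cmod (f' z + g' z + h' z))\<^sup>2 \<le> (cmod (f' z) + cmod (g' z) + cmod (h' z))\<^sup>2"
      by (intro power_mono) auto
    also note sq
    finally have "ennreal ((cmod (f' z + g' z + h' z))\<^sup>2)
        \<le> ennreal (3 * ((cmod (f' z))\<^sup>2 + (cmod (g' z))\<^sup>2 + (cmod (h' z))\<^sup>2))"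
      by (rule ennreal_leI)
    then show "ennreal ((cmod (f' z + g' z + h' z))\<^sup>2)
        \<le> 3 * (ennreal ((cmod (f' z))\<^sup>2) + ennreal ((cmod (g' z))\<^sup>2) + ennreal ((cmod (h' z))\<^sup>2))"
      by (simp add: ennreal_mult')
  qed
  also have "\<dots> = 3 * ((\<integral>\<^sup>+z. ennreal ((cmod (f' z))\<^sup>2) \<partial>disk_measure u)
      + (\<integral>\<^sup>+z. ennreal ((cmod (g' z))\<^sup>2) \<partial>disk_measure u) + (\<integral>\<^sup>+z. ennreal ((cmod (h' z))\<^sup>2) \<partial>disk_measure u))"
    by (simp add: nn_integral_cmult nn_integral_add)
  also have "(\<integral>\<^sup>+z. ennreal ((cmod (f' z))\<^sup>2) \<partial>disk_measure u) = energy u (ball 0 1) f"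
    by (rule energy_eq_disk_measure[OF assms(1) m(1), symmetric]) (simp add: f'_def)
  also have "(\<integral>\<^sup>+z. ennreal ((cmod (g' z))\<^sup>2) \<partial>disk_measure u) = energy u (ball 0 1) g"
    by (rule energy_eq_disk_measure[OF assms(1) m(2), symmetric]) (simp add: g'_def)
  also have "(\<integral>\<^sup>+z. ennreal ((cmod (h' z))\<^sup>2) \<partial>disk_measure u) = energy u (ball 0 1) h"
    by (rule energy_eq_disk_measure[OF assms(1) m(3), symmetric]) (simp add: h'_def)
  finally show ?thesis .
qed

text \<open>The increments are about \<open>1 / j\<close> divided by \<open>harm m\<close>, so their
  squares weighted by \<open>j\<close> sum to order \<open>1 / harm m\<close>, which tends to 0. A
  linear cutoff would leave this sum bounded away from 0.\<close>

definition log_cutoff :: "nat \<Rightarrow> nat \<Rightarrow> real" where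
  "log_cutoff m k = (if k \<le> m then 1 - harm k / harm m else 0)"

lemma log_cutoff_bounds: "0 \<le> log_cutoff m k" "log_cutoff m k \<le> 1"
proof -
  have "harm k \<le> (harm m :: real)" if "k \<le> m"
    using that unfolding harm_def by (intro sum_mono2) auto
  moreover have "0 \<le> (harm k :: real)" "0 \<le> (harm m :: real)" by (simp_all add: harm_nonneg)
  ultimately show "0 \<le> log_cutoff m k" "log_cutoff m k \<le> 1"
    by (auto simp: log_cutoff_def divide_le_eq)
qed

lemma log_cutoff_variation:
  assumes "0 < m"
  shows "(\<Sum>j\<le>m. real j * (log_cutoff m (Suc j) - log_cutoff m j)\<^sup>2) \<le> 1 / harm m"
proof -
  have h: "0 < (harm m :: real)" using assms by (rule harm_pos)
  then have h0: "(harm m :: real) \<noteq> 0" by linarith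
  \<comment> \<open>The summand \<open>j = m\<close> is 0, for the cutoff already vanishes at
    \<open>m\<close>.\<close>
  have "(\<Sum>j\<le>m. real j * (log_cutoff m (Suc j) - log_cutoff m j)\<^sup>2)
     = (\<Sum>j<m. real j * (log_cutoff m (Suc j) - log_cutoff m j)\<^sup>2)"
    using h0 by (simp add: lessThan_Suc_atMost[symmetric] log_cutoff_def)
  also have "\<dots> \<le> (\<Sum>j<m. 1 / (harm m)\<^sup>2 * (1 / real (Suc j)))"
  proof (rule sum_mono)
    fix j assume "j \<in> {..<m}"
    then have "log_cutoff m (Suc j) - log_cutoff m j = - (1 / real (Suc j)) / harm m"
      using h0 by (simp add: log_cutoff_def harm_Suc add_divide_distrib inverse_eq_divide)
    then have "real j * (log_cutoff m (Suc j) - log_cutoff m j)\<^sup>2 = real j / (real (Suc j) * real (Suc j) * (harm m)\<^sup>2)"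
      by (simp add: power2_eq_square)
    also have "\<dots> \<le> real (Suc j) / (real (Suc j) * real (Suc j) * (harm m)\<^sup>2)"
      using h by (intro divide_right_mono) auto
    also have "\<dots> = 1 / (harm m)\<^sup>2 * (1 / real (Suc j))"
      using h0 by (simp add: divide_simps del: of_nat_Suc)
    finally show "real j * (log_cutoff m (Suc j) - log_cutoff m j)\<^sup>2 \<le> 1 / (harm m)\<^sup>2 * (1 / real (Suc j))" .
  qed
  also have "\<dots> = 1 / (harm m)\<^sup>2 * harm m"
    unfolding sum_distrib_left[symmetric] by (simp add: harm_altdef[of m] inverse_eq_divide)
  also have "\<dots> = 1 / harm m" using h0 by (simp add: power2_eq_square)
  finally show ?thesis .
qed

lemma log_cutoff_tendsto: "(\<lambda>m. log_cutoff m k) \<longlonglongrightarrow> 1"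
proof -
  have "(\<lambda>m. 1 - harm k / harm m) \<longlonglongrightarrow> (1 - 0 :: real)"
    by (intro tendsto_diff tendsto_const tendsto_divide_0[OF tendsto_const]
        filterlim_at_top_imp_at_infinity harm_at_top)
  moreover have "\<forall>\<^sub>F m in sequentially. 1 - harm k / harm m = log_cutoff m k"
    using eventually_ge_at_top[of k] by eventually_elim (simp add: log_cutoff_def)
  ultimately show ?thesis
    by (simp add: tendsto_cong)
qed

lemma parallelogram_cmod: "(cmod (x - y))\<^sup>2 + (cmod (x + y))\<^sup>2 = 2 * (cmod x)\<^sup>2 + 2 * (cmod y)\<^sup>2"
  unfolding cmod_power2 by (simp add: power2_eq_square algebra_simps)

text \<open>The operator norms of the logarithmic cutoffs tend to 1, so weak convergence of the truncations
  improves to norm convergence by the parallelogram law and Fatou's lemma.\<close>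

lemma energy_polynomial_dense:
  fixes a :: "nat \<Rightarrow> complex"
  assumes u: "supermean_weight u"
    and fin: "\<And>\<rho>. \<rho> < 1 \<Longrightarrow> (\<integral>\<^sup>+z\<in>ball 0 \<rho>. u z \<partial>lborel) < \<infinity>"
    and F: "\<And>z. z \<in> ball 0 1 \<Longrightarrow> (\<lambda>k. a k * z ^ k) sums F z"
    and EF: "energy u (ball 0 1) F < \<infinity>" and e: "0 < e"
  shows "\<exists>m. energy u (ball 0 1) (\<lambda>z. F z - (\<Sum>k\<le>m. of_real (log_cutoff m k) * a k * z ^ k)) < ennreal e"
proof (rule ccontr)
  assume "\<not> ?thesis"
  then have far: "ennreal e \<le> energy u (ball 0 1) (\<lambda>z. F z - (\<Sum>k\<le>m. of_real (log_cutoff m k) * a k * z ^ k))" for m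
    by (auto simp: not_less)
  have um [measurable]: "u \<in> borel_measurable borel" by (rule supermean_weight_measurable[OF u])
  define d where "d = enn2real (energy u (ball 0 1) F)"
  have d: "energy u (ball 0 1) F = ennreal d" "0 \<le> d"
    using EF by (auto simp: d_def less_top)
  define q where "q m z = (\<Sum>k\<le>m. (of_real (log_cutoff m k) * a k) * z ^ k)" for m z
  define F' where "F' z = (if z \<in> ball 0 1 then deriv F z else 0)" for z
  \<comment> \<open>The extra \<open>1 / harm m\<close> makes the bound strict and does not affect
    the limit 1.\<close>
  define K where "K m = (1 + sqrt (1 / harm m))\<^sup>2 + 1 / harm m" for m
  have Fhol: "F holomorphic_on ball 0 1" by (rule power_series_holomorphic_ball[OF F])
  have Fm [measurable]: "F' \<in> borel_measurable borel" unfolding F'_def by (rule measurable_deriv_on_ball[OF Fhol])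
  have qhol: "q m holomorphic_on S" for m S unfolding q_def by (intro holomorphic_intros)
  have [measurable]: "deriv (q m) \<in> borel_measurable borel" for m
    by (intro borel_measurable_continuous_onI holomorphic_on_imp_continuous_on holomorphic_deriv qhol) auto
  have qF: "energy u (ball 0 1) (q m) \<le> ennreal (K m) * ennreal d" if m: "0 < m" for m
    unfolding q_def d(1)[symmetric]
  proof (rule energy_multiplier[OF u fin F, where M=1 and D="1 / harm m"])
    show "\<bar>log_cutoff m k\<bar> \<le> 1" for k using log_cutoff_bounds[of m k] by simp
    show "log_cutoff m k = 0" if "m < k" for k using that by (simp add: log_cutoff_def)
    show "(\<Sum>j\<le>m. real j * (log_cutoff m (Suc j) - log_cutoff m j)\<^sup>2) \<le> 1 / harm m"
      by (rule log_cutoff_variation[OF m])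
    show "(1 + sqrt (1 / harm m))\<^sup>2 < K m"
      using harm_pos[OF m, where 'a=real] by (simp add: K_def)
  qed auto
  have "deriv (\<lambda>z. F z - (\<Sum>k\<le>m. of_real (log_cutoff m k) * a k * z ^ k)) z = F' z - deriv (q m) z"
    if z: "z \<in> ball 0 1" for z m
  proof -
    have "(F has_field_derivative deriv F z) (at z)"
      using Fhol z by (auto intro: holomorphic_derivI)
    moreover have "(q m has_field_derivative deriv (q m) z) (at z)"
      using qhol[of m UNIV] by (auto intro: holomorphic_derivI)
    ultimately have "((\<lambda>z. F z - q m z) has_field_derivative deriv F z - deriv (q m) z) (at z)"
      by (rule DERIV_diff)
    then show ?thesis
      using z unfolding q_def[abs_def] F'_def by (simp add: DERIV_imp_deriv)
  qed
  then have far': "ennreal e \<le> (\<integral>\<^sup>+z. ennreal ((cmod (F' z - deriv (q m) z))\<^sup>2) \<partial>disk_measure u)" for m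
    using far[of m] by (subst (asm) energy_eq_disk_measure) auto
  have EF': "(\<integral>\<^sup>+z. ennreal ((cmod (F' z))\<^sup>2) \<partial>disk_measure u) = ennreal d"
    unfolding d(1)[symmetric] by (rule energy_eq_disk_measure[OF um Fm, symmetric]) (simp add: F'_def)
  define Y where "Y m = (\<integral>\<^sup>+z. ennreal ((cmod (F' z + deriv (q m) z))\<^sup>2) \<partial>disk_measure u)" for m
  \<comment> \<open>Parallelogram law for \<open>F'\<close> and \<open>deriv (q m)\<close>: if the
    difference keeps energy at least \<open>e\<close>, the energy of the sum is at most
    \<open>2 * d + 2 * (K m * d) - e\<close>.\<close>
  have bnd: "ennreal e + Y m \<le> ennreal (2 * d + 2 * (K m * d))" if m: "0 < m" for m
  proof -
    have K0: "0 \<le> K m" by (simp add: K_def harm_nonneg)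
    have "ennreal e + Y m \<le> (\<integral>\<^sup>+z. ennreal ((cmod (F' z - deriv (q m) z))\<^sup>2) \<partial>disk_measure u) + Y m"
      by (intro add_right_mono far')
    also have "\<dots> = (\<integral>\<^sup>+z. ennreal ((cmod (F' z - deriv (q m) z))\<^sup>2) + ennreal ((cmod (F' z + deriv (q m) z))\<^sup>2) \<partial>disk_measure u)"
      unfolding Y_def by (rule nn_integral_add[symmetric]) measurable
    also have "\<dots> = (\<integral>\<^sup>+z. 2 * ennreal ((cmod (F' z))\<^sup>2) + 2 * ennreal ((cmod (deriv (q m) z))\<^sup>2) \<partial>disk_measure u)"
    proof (rule nn_integral_cong)
      fix z
      have "ennreal ((cmod (F' z - deriv (q m) z))\<^sup>2) + ennreal ((cmod (F' z + deriv (q m) z))\<^sup>2)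
          = ennreal (2 * (cmod (F' z))\<^sup>2 + 2 * (cmod (deriv (q m) z))\<^sup>2)"
        by (simp add: parallelogram_cmod del: ennreal_plus flip: ennreal_plus)
      also have "\<dots> = 2 * ennreal ((cmod (F' z))\<^sup>2) + 2 * ennreal ((cmod (deriv (q m) z))\<^sup>2)"
        by (simp add: ennreal_mult')
      finally show "ennreal ((cmod (F' z - deriv (q m) z))\<^sup>2) + ennreal ((cmod (F' z + deriv (q m) z))\<^sup>2)
          = 2 * ennreal ((cmod (F' z))\<^sup>2) + 2 * ennreal ((cmod (deriv (q m) z))\<^sup>2)" .
    qed
    also have "\<dots> = 2 * ennreal d + 2 * (\<integral>\<^sup>+z. ennreal ((cmod (deriv (q m) z))\<^sup>2) \<partial>disk_measure u)"
      by (simp add: nn_integral_add nn_integral_cmult EF')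
    also have "(\<integral>\<^sup>+z. ennreal ((cmod (deriv (q m) z))\<^sup>2) \<partial>disk_measure u) = energy u (ball 0 1) (q m)"
      by (rule energy_eq_disk_measure[symmetric]) auto
    also have "2 * ennreal d + 2 * energy u (ball 0 1) (q m) \<le> 2 * ennreal d + 2 * (ennreal (K m) * ennreal d)"
      using qF[OF m] by (intro add_left_mono mult_left_mono) auto
    also have "\<dots> = ennreal (2 * d + 2 * (K m * d))"
      using d(2) K0 by (simp add: ennreal_mult')
    finally show ?thesis .
  qed
  have Y_le: "Y m \<le> ennreal (2 * d + 2 * (K m * d) - e)" and e_le: "e \<le> 2 * d + 2 * (K m * d)" if m: "0 < m" for m
  proof -
    have K0: "0 \<le> K m" by (simp add: K_def harm_nonneg)
    have "ennreal e \<le> ennreal (2 * d + 2 * (K m * d))"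
      using bnd[OF m] by (meson le_iff_add order_trans)
    then show le: "e \<le> 2 * d + 2 * (K m * d)"
      using d(2) K0 by (subst (asm) ennreal_le_iff) auto
    have "Y m + ennreal e \<le> ennreal (2 * d + 2 * (K m * d) - e) + ennreal e"
      using bnd[OF m] le e by (simp add: add.commute flip: ennreal_plus)
    then show "Y m \<le> ennreal (2 * d + 2 * (K m * d) - e)"
      using ennreal_add_left_cancel_le[of "ennreal e"] by (simp add: add.commute)
  qed
  have inv_harm: "(\<lambda>m. 1 / harm m) \<longlonglongrightarrow> (0::real)"
    by (intro tendsto_divide_0[OF tendsto_const] filterlim_at_top_imp_at_infinity harm_at_top)
  have "K \<longlonglongrightarrow> (1 + sqrt 0)\<^sup>2 + 0"
    unfolding K_def by (intro tendsto_intros inv_harm)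
  then have lim: "(\<lambda>m. 2 * d + 2 * (K m * d) - e) \<longlonglongrightarrow> 2 * d + 2 * (1 * d) - e"
    by (intro tendsto_intros) simp
  have ev: "\<forall>\<^sub>F m in sequentially. 0 < (m::nat)" by (rule eventually_gt_at_top)
  have nonneg: "0 \<le> 2 * d + 2 * (1 * d) - e"
    by (rule tendsto_lowerbound[OF lim]) (use eventually_mono[OF ev e_le] in auto)
  have "\<forall>\<^sub>F m in sequentially. Y m \<le> ennreal (2 * d + 2 * (K m * d) - e)"
    using ev by eventually_elim (rule Y_le)
  then have "liminf Y \<le> liminf (\<lambda>m. ennreal (2 * d + 2 * (K m * d) - e))"
    by (rule Liminf_mono)
  also have "\<dots> = ennreal (2 * d + 2 * (1 * d) - e)"
    by (intro lim_imp_Liminf tendsto_ennrealI lim) simp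
  finally have up: "liminf Y \<le> ennreal (2 * d + 2 * (1 * d) - e)" .
  have conv: "(\<lambda>m. deriv (q m) z) \<longlonglongrightarrow> F' z" if z: "z \<in> ball 0 1" for z
  proof -
    define w where "w k = of_nat (Suc k) * a (Suc k) * z ^ k" for k
    have sw: "summable (\<lambda>k. norm (w k))" and dF: "deriv F z = (\<Sum>k. w k)"
      using power_series_deriv[OF F z] by (auto simp: w_def sums_iff)
    have "(\<lambda>m. \<Sum>k. of_real (log_cutoff m (Suc k)) * w k) \<longlonglongrightarrow> (\<Sum>k. of_real 1 * w k)"
    proof (rule tannerys_theorem[THEN conjunct2, THEN conjunct2])
      show "(\<lambda>m. of_real (log_cutoff m (Suc k)) * w k) \<longlonglongrightarrow> of_real 1 * w k" for k
        by (intro tendsto_intros log_cutoff_tendsto)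
      show "\<forall>\<^sub>F (k, m) in sequentially \<times>\<^sub>F sequentially. norm (of_real (log_cutoff m (Suc k)) * w k) \<le> norm (w k)"
        using log_cutoff_bounds by (intro always_eventually) (auto simp: norm_mult intro!: mult_left_le_one_le)
    qed (use sw in auto)
    moreover have "(\<Sum>k. of_real (log_cutoff m (Suc k)) * w k) = deriv (q m) z" for m
    proof -
      have "(\<Sum>k. of_real (log_cutoff m (Suc k)) * w k) = (\<Sum>k<m. of_real (log_cutoff m (Suc k)) * w k)"
        by (rule suminf_finite) (auto simp: log_cutoff_def)
      then show ?thesis
        unfolding q_def deriv_polynomial by (simp add: w_def mult_ac)
    qed
    ultimately show ?thesis using z by (simp add: F'_def dF)
  qed
  \<comment> \<open>The sum converges pointwise to \<open>2 * F'\<close>, so Fatou gives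
    \<open>4 * d\<close> as a lower bound for the limit inferior of \<open>Y\<close>, against the
    upper bound \<open>4 * d - e\<close>.\<close>
  have "ennreal (4 * d) = (\<integral>\<^sup>+z. ennreal (4 * (cmod (F' z))\<^sup>2) \<partial>disk_measure u)"
    using d(2) by (simp add: ennreal_mult' nn_integral_cmult EF')
  also have "\<dots> = (\<integral>\<^sup>+z. liminf (\<lambda>m. ennreal ((cmod (F' z + deriv (q m) z))\<^sup>2)) \<partial>disk_measure u)"
  proof (rule nn_integral_cong_AE)
    have "AE z in disk_measure u. z \<in> ball 0 1"
      unfolding disk_measure_def by (subst AE_density) (auto simp: indicator_def)
    then show "AE z in disk_measure u. ennreal (4 * (cmod (F' z))\<^sup>2) = liminf (\<lambda>m. ennreal ((cmod (F' z + deriv (q m) z))\<^sup>2))"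
    proof eventually_elim
      case (elim z)
      have "(\<lambda>m. ennreal ((cmod (F' z + deriv (q m) z))\<^sup>2)) \<longlonglongrightarrow> ennreal ((cmod (F' z + F' z))\<^sup>2)"
        by (intro tendsto_intros conv elim)
      also have "(cmod (F' z + F' z))\<^sup>2 = 4 * (cmod (F' z))\<^sup>2"
        by (simp add: norm_mult power_mult_distrib flip: mult_2)
      finally show ?case by (intro lim_imp_Liminf[symmetric]) auto
    qed
  qed
  also have "\<dots> \<le> liminf Y"
    unfolding Y_def by (rule nn_integral_liminf) measurable
  also note up
  finally have "4 * d \<le> 2 * d + 2 * (1 * d) - e"
    using nonneg by (subst (asm) ennreal_le_iff) auto
  with e show False by simp
qed

lemma ennreal_tendsto_0_iff:
  fixes f :: "'a \<Rightarrow> ennreal"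
  shows "(f \<longlongrightarrow> 0) G \<longleftrightarrow> (\<forall>e>0. \<forall>\<^sub>F x in G. f x \<le> ennreal e)"
proof
  assume f: "(f \<longlongrightarrow> 0) G"
  show "\<forall>e>0. \<forall>\<^sub>F x in G. f x \<le> ennreal e"
  proof (intro allI impI)
    fix e :: real assume "0 < e"
    then have "\<forall>\<^sub>F x in G. f x < ennreal e" by (intro order_tendstoD(2)[OF f]) simp
    then show "\<forall>\<^sub>F x in G. f x \<le> ennreal e" by (rule eventually_mono) simp
  qed
next
  assume *: "\<forall>e>0. \<forall>\<^sub>F x in G. f x \<le> ennreal e"
  show "(f \<longlongrightarrow> 0) G"
  proof (rule order_tendstoI)
    fix x :: ennreal assume "0 < x"
    then obtain y where y: "0 < y" "y < x" using dense by blast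
    then have "y < top" by (meson less_le_trans top_greatest)
    then obtain e where e: "y = ennreal e" "0 \<le> e" by (cases y) auto
    with y have "0 < e" by (cases "e = 0") auto
    with * have "\<forall>\<^sub>F z in G. f z \<le> y" by (simp add: e)
    then show "\<forall>\<^sub>F z in G. f z < x" by (rule eventually_mono) (use y in auto)
  qed simp
qed

text \<open>With a cutoff \<open>l\<close>, the error multiplier is
  \<open>c n - 1 = c n * (1 - l) + (c n - 1) * l - (1 - l)\<close>. The outer terms act on a
  remainder of small energy, with a bound uniform in \<open>n\<close>; the middle one involves
  finitely many coefficients and tends to 0.\<close>

lemma energy_multiplier_convergence:
  fixes a :: "nat \<Rightarrow> complex" and c :: "nat \<Rightarrow> nat \<Rightarrow> real"
  assumes u: "supermean_weight u"
    and fin: "\<And>\<rho>. \<rho> < 1 \<Longrightarrow> (\<integral>\<^sup>+z\<in>ball 0 \<rho>. u z \<partial>lborel) < \<infinity>"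
    and F: "\<And>z. z \<in> ball 0 1 \<Longrightarrow> (\<lambda>k. a k * z ^ k) sums F z"
    and EF: "energy u (ball 0 1) F < \<infinity>"
    and c: "\<And>n k. \<bar>c n k\<bar> \<le> 1" "\<And>n k. n < k \<Longrightarrow> c n k = 0"
      "\<And>n. (\<Sum>j\<le>n. real j * (c n (Suc j) - c n j)\<^sup>2) \<le> D" "\<And>k. (\<lambda>n. c n k) \<longlonglongrightarrow> 1"
  shows "(\<lambda>n. energy u (ball 0 1) (\<lambda>z. (\<Sum>k\<le>n. of_real (c n k) * a k * z ^ k) - F z)) \<longlonglongrightarrow> 0"
  unfolding ennreal_tendsto_0_iff
proof (intro allI impI)
  fix e :: real assume e: "0 < e"
  have um: "u \<in> borel_measurable borel" by (rule supermean_weight_measurable[OF u])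
  define d where "d = enn2real (energy u (ball 0 1) F)"
  have d: "energy u (ball 0 1) F = ennreal d" "0 \<le> d"
    using EF by (auto simp: d_def less_top)
  define K where "K = (1 + sqrt D)\<^sup>2 + 1"
  have K: "(1 + sqrt D)\<^sup>2 < K" "0 \<le> K" by (simp_all add: K_def)
  \<comment> \<open>The total will be at most
    \<open>3 * (K * \<delta> + 2 * \<delta>' * d + \<delta>)\<close>; \<delta> and
    \<open>\<delta>'\<close> allot \<open>e / 2\<close> to the outer terms and at most
    \<open>e / 2\<close> to the middle one.\<close>
  define \<delta> where "\<delta> = e / (6 * (K + 1))"
  have \<delta>: "0 < \<delta>" using e K by (simp add: \<delta>_def)
  define \<delta>' where "\<delta>' = e / (12 * (d + 1))"
  have \<delta>': "0 < \<delta>'" using e d by (simp add: \<delta>'_def)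
  obtain m where m: "energy u (ball 0 1) (\<lambda>z. F z - (\<Sum>k\<le>m. of_real (log_cutoff m k) * a k * z ^ k)) < ennreal \<delta>"
    using energy_polynomial_dense[OF u fin F EF \<delta>] by blast
  define l where "l = log_cutoff m"
  have l: "0 \<le> l k" "l k \<le> 1" "m < k \<Longrightarrow> l k = 0" for k
    using log_cutoff_bounds[of m k] by (auto simp: l_def log_cutoff_def)
  define G where "G z = F z - (\<Sum>k\<le>m. of_real (l k) * a k * z ^ k)" for z
  have EG: "energy u (ball 0 1) G < ennreal \<delta>" using m by (simp add: G_def[abs_def] l_def)
  have G: "(\<lambda>k. of_real (1 - l k) * a k * z ^ k) sums G z" if "z \<in> ball 0 1" for z
  proof -
    have "(\<lambda>k. of_real (l k) * a k * z ^ k) sums (\<Sum>k\<le>m. of_real (l k) * a k * z ^ k)"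
      by (rule sums_finite) (auto simp: l(3) not_le)
    from sums_diff[OF F[OF that] this] show ?thesis
      by (simp add: G_def algebra_simps)
  qed
  \<comment> \<open>\<open>s n\<close> bounds the middle multiplier and
    \<open>2 * (real m + 1) * s n\<close> the root of its variation; together they give the factor
    \<open>2 * real m + 3\<close>.\<close>
  define s where "s n = (\<Sum>k\<le>m. \<bar>c n k - 1\<bar>)" for n
  have "(\<lambda>n. ((2 * real m + 3) * s n)\<^sup>2) \<longlonglongrightarrow> ((2 * real m + 3) * (\<Sum>k\<le>m. \<bar>1 - 1\<bar>))\<^sup>2"
    unfolding s_def by (intro tendsto_intros c(4))
  then have "\<forall>\<^sub>F n in sequentially. ((2 * real m + 3) * s n)\<^sup>2 < \<delta>'"
    using \<delta>' by (intro order_tendstoD(2)) auto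
  with eventually_ge_at_top[of m]
  show "\<forall>\<^sub>F n in sequentially. energy u (ball 0 1) (\<lambda>z. (\<Sum>k\<le>n. of_real (c n k) * a k * z ^ k) - F z) \<le> ennreal e"
  proof eventually_elim
    case (elim n)
    define f1 where "f1 z = (\<Sum>k\<le>n. of_real (c n k) * (of_real (1 - l k) * a k) * z ^ k)" for z
    define b where "b k = (c n k - 1) * l k" for k
    define f2 where "f2 z = (\<Sum>k\<le>m. of_real (b k) * a k * z ^ k)" for z
    have E1: "energy u (ball 0 1) f1 \<le> ennreal K * energy u (ball 0 1) G"
      unfolding f1_def by (rule energy_multiplier[OF u fin G c(1,2,3) K(1)])
    have s0: "0 \<le> s n" by (simp add: s_def sum_nonneg)
    have b: "\<bar>b k\<bar> \<le> s n" for k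
    proof (cases "k \<le> m")
      case True
      then have "\<bar>c n k - 1\<bar> \<le> s n" unfolding s_def by (intro member_le_sum) auto
      moreover have "\<bar>b k\<bar> \<le> \<bar>c n k - 1\<bar>"
        using l[of k] by (simp add: b_def abs_mult mult_left_le)
      ultimately show ?thesis by simp
    qed (use l s0 in \<open>simp add: b_def\<close>)
    have E2: "energy u (ball 0 1) f2 \<le> ennreal (2 * \<delta>') * energy u (ball 0 1) F"
      unfolding f2_def
    proof (rule energy_multiplier[OF u fin F b])
      show "(\<Sum>j\<le>m. real j * (b (Suc j) - b j)\<^sup>2) \<le> (2 * (real m + 1) * s n)\<^sup>2"
      proof -
        have "(\<Sum>j\<le>m. real j * (b (Suc j) - b j)\<^sup>2) \<le> (\<Sum>j\<le>m. (real m + 1) * (2 * s n)\<^sup>2)"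
        proof (rule sum_mono)
          fix j assume "j \<in> {..m}"
          have "\<bar>b (Suc j) - b j\<bar> \<le> 2 * s n" using b[of j] b[of "Suc j"] by linarith
          then have "(b (Suc j) - b j)\<^sup>2 \<le> (2 * s n)\<^sup>2"
            using power_mono[of "\<bar>b (Suc j) - b j\<bar>" "2 * s n" 2] by simp
          with \<open>j \<in> {..m}\<close> show "real j * (b (Suc j) - b j)\<^sup>2 \<le> (real m + 1) * (2 * s n)\<^sup>2"
            by (intro mult_mono) auto
        qed
        also have "\<dots> = (2 * (real m + 1) * s n)\<^sup>2"
          by (simp add: power2_eq_square algebra_simps)
        finally show ?thesis .
      qed
      have "sqrt ((2 * (real m + 1) * s n)\<^sup>2) = 2 * (real m + 1) * s n"
        using s0 by (intro real_sqrt_unique) auto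
      then have "s n + sqrt ((2 * (real m + 1) * s n)\<^sup>2) = (2 * real m + 3) * s n"
        by (simp add: algebra_simps)
      then show "(s n + sqrt ((2 * (real m + 1) * s n)\<^sup>2))\<^sup>2 < 2 * \<delta>'"
        using elim \<delta>' by simp
    qed (auto simp: b_def l)
    have split: "(\<Sum>k\<le>n. of_real (c n k) * a k * z ^ k) - F z = f1 z + f2 z + (- G z)" for z
    proof -
      have "f2 z = (\<Sum>k\<le>n. of_real (b k) * a k * z ^ k)"
        unfolding f2_def using elim l(3) by (intro sum.mono_neutral_left) (auto simp: b_def not_le)
      moreover have "(\<Sum>k\<le>m. of_real (l k) * a k * z ^ k) = (\<Sum>k\<le>n. of_real (l k) * a k * z ^ k)"
        using elim l(3) by (intro sum.mono_neutral_left) (auto simp: not_le)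
      ultimately have "f1 z + f2 z + (- G z) = (\<Sum>k\<le>n. of_real (c n k) * (of_real (1 - l k) * a k) * z ^ k
          + of_real (b k) * a k * z ^ k + of_real (l k) * a k * z ^ k) - F z"
        by (simp add: f1_def G_def sum.distrib)
      also have "(\<Sum>k\<le>n. of_real (c n k) * (of_real (1 - l k) * a k) * z ^ k
          + of_real (b k) * a k * z ^ k + of_real (l k) * a k * z ^ k) = (\<Sum>k\<le>n. of_real (c n k) * a k * z ^ k)"
        by (intro sum.cong refl) (simp add: b_def algebra_simps)
      finally show ?thesis by simp
    qed
    have Ghol: "G holomorphic_on ball 0 1" by (rule power_series_holomorphic_ball[OF G])
    have "energy u (ball 0 1) (\<lambda>z. (\<Sum>k\<le>n. of_real (c n k) * a k * z ^ k) - F z)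
      \<le> 3 * (energy u (ball 0 1) f1 + energy u (ball 0 1) f2 + energy u (ball 0 1) (\<lambda>z. - G z))"
    proof (rule energy_add3[OF um])
      show "f1 holomorphic_on ball 0 1" "f2 holomorphic_on ball 0 1"
        unfolding f1_def f2_def by (intro holomorphic_intros)+
      show "(\<lambda>z. - G z) holomorphic_on ball 0 1" by (intro holomorphic_intros Ghol)
    qed (rule split)
    also have "energy u (ball 0 1) (\<lambda>z. - G z) = energy u (ball 0 1) G"
      unfolding energy_def
    proof (intro nn_integral_cong)
      fix z
      show "ennreal ((cmod (deriv (\<lambda>z. - G z) z))\<^sup>2) * u z * indicator (ball 0 1) z
          = ennreal ((cmod (deriv G z))\<^sup>2) * u z * indicator (ball 0 1) z"
      proof (cases "z \<in> ball 0 1")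
        case True
        then have "(G has_field_derivative deriv G z) (at z)"
          using Ghol by (auto intro: holomorphic_derivI)
        then have "deriv (\<lambda>z. - G z) z = - deriv G z"
          by (intro DERIV_imp_deriv DERIV_minus)
        then show ?thesis by simp
      qed simp
    qed
    also have "3 * (energy u (ball 0 1) f1 + energy u (ball 0 1) f2 + energy u (ball 0 1) G)
      \<le> 3 * (ennreal K * ennreal \<delta> + ennreal (2 * \<delta>') * ennreal d + ennreal \<delta>)"
    proof (intro mult_left_mono add_mono)
      show "energy u (ball 0 1) f1 \<le> ennreal K * ennreal \<delta>"
        using EG by (intro order_trans[OF E1] mult_left_mono) auto
    qed (use E2 EG in \<open>auto simp: d(1)\<close>)
    also have "\<dots> = ennreal (3 * (K * \<delta> + 2 * \<delta>' * d + \<delta>))"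
    proof -
      have p: "ennreal (K * \<delta>) = ennreal K * ennreal \<delta>" "ennreal (2 * \<delta>' * d) = ennreal (2 * \<delta>') * ennreal d"
        "ennreal (3 * (K * \<delta> + 2 * \<delta>' * d + \<delta>)) = 3 * ennreal (K * \<delta> + 2 * \<delta>' * d + \<delta>)"
        using K(2) \<delta>' ennreal_mult'[of 3 "K * \<delta> + 2 * \<delta>' * d + \<delta>"] by (auto intro!: ennreal_mult')
      have "0 \<le> K * \<delta>" "0 \<le> 2 * \<delta>' * d" "0 \<le> \<delta>" using K \<delta> \<delta>' d by auto
      then have "ennreal (K * \<delta> + 2 * \<delta>' * d + \<delta>) = ennreal (K * \<delta>) + ennreal (2 * \<delta>' * d) + ennreal \<delta>"
        by (metis add_nonneg_nonneg ennreal_plus)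
      then show ?thesis unfolding p by simp
    qed
    also have "\<dots> \<le> ennreal e"
    proof (rule ennreal_leI)
      have "e / (6 * x) * x = e / 6" if "0 < x" for x
        using that by simp
      from this[of "K + 1"] have "\<delta> * (K + 1) = e / 6"
        using K(2) by (simp only: \<delta>_def)
      then have "3 * (K * \<delta> + \<delta>) = e / 2"
        by (simp add: algebra_simps)
      moreover have "3 * (2 * \<delta>' * d) \<le> e / 2"
        using d e by (simp add: \<delta>'_def field_simps)
      ultimately show "3 * (K * \<delta> + 2 * \<delta>' * d + \<delta>) \<le> e"
        by (simp add: algebra_simps)
    qed
    finally show ?case .
  qed
qed

section \<open>Noerlund multipliers\<close>

lemma bounded_of_eventually_less:
  fixes x :: "nat \<Rightarrow> real"
  assumes "\<forall>\<^sub>F n in sequentially. x n < C"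
  shows "\<exists>B>0. \<forall>n. x n \<le> B"
proof -
  obtain N where N: "\<And>n. N \<le> n \<Longrightarrow> x n < C"
    using assms by (auto simp: eventually_sequentially)
  have "x n \<le> \<bar>C\<bar> + 1 + (\<Sum>k<N. \<bar>x k\<bar>)" for n
  proof (cases "n < N")
    case True
    then have "\<bar>x n\<bar> \<le> (\<Sum>k<N. \<bar>x k\<bar>)" by (intro member_le_sum) auto
    then show ?thesis by linarith
  next
    case False
    moreover have "0 \<le> (\<Sum>k<N. \<bar>x k\<bar>)" by (intro sum_nonneg) auto
    ultimately show ?thesis using N[of n] by linarith
  qed
  moreover have "0 < \<bar>C\<bar> + 1 + (\<Sum>k<N. \<bar>x k\<bar>)"
    by (smt (verit) sum_nonneg abs_ge_zero)
  ultimately show ?thesis by blast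
qed

lemma finite_upper_growth_rate_bound:
  assumes "finite_upper_growth_rate p"
  shows "\<exists>B>0. \<forall>n. real n * p n / psum p n \<le> B"
proof -
  obtain C where C: "limsup (\<lambda>n. ereal (real n * p n / psum p n)) < ereal C"
    using assms unfolding finite_upper_growth_rate_def
    by (metis ereal_dense2 infinity_ereal_def less_PInf_Ex_of_nat)
  then have "\<forall>\<^sub>F n in sequentially. real n * p n / psum p n < C"
    by (auto dest!: Limsup_lessD)
  then show ?thesis by (rule bounded_of_eventually_less)
qed

lemma psum_Suc: "psum p (Suc n) = psum p n + p (Suc n)"
  by (simp add: psum_def)

lemma psum_mono:
  assumes "norlund_weights p" "m \<le> n"
  shows "psum p m \<le> psum p n"
  using assms unfolding psum_def norlund_weights_def by (intro sum_mono2) auto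

text \<open>The averages of a non-decreasing sequence are non-decreasing.\<close>

lemma psum_ratio_le:
  assumes p: "norlund_weights p" and mn: "m \<le> n"
  shows "psum p m / psum p n \<le> real (Suc m) / real (Suc n)"
proof -
  have mono: "p i \<le> p j" if "i \<le> j" for i j
    using p that by (auto simp: norlund_weights_def mono_def)
  have pos: "0 < psum p n" for n using p by (simp add: norlund_weights_def)
  \<comment> \<open>\<open>p m\<close> separates the first \<open>m + 1\<close> terms from the later
    ones.\<close>
  have le: "psum p m \<le> real (Suc m) * p m"
    unfolding psum_def using sum_bounded_above[of "{..m}" p "p m"] mono by simp
  have "{..n} = {..m} \<union> {m<..n}" "{..m} \<inter> {m<..n} = {}" using mn by auto
  then have eq: "psum p n = psum p m + (\<Sum>k\<in>{m<..n}. p k)"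
    unfolding psum_def by (simp only:) (rule sum.union_disjoint, auto)
  have "real (n - m) * p m \<le> (\<Sum>k\<in>{m<..n}. p k)"
    using sum_bounded_below[of "{m<..n}" "p m" p] mono by simp
  then have "real (n - m) * p m * real (Suc m) \<le> (\<Sum>k\<in>{m<..n}. p k) * real (Suc m)"
    by (rule mult_right_mono) simp
  then have "psum p m * real (Suc m) + real (n - m) * (real (Suc m) * p m) \<le> psum p n * real (Suc m)"
    unfolding eq by (simp add: algebra_simps)
  moreover have "real (n - m) * psum p m \<le> real (n - m) * (real (Suc m) * p m)"
    using le by (intro mult_left_mono) auto
  ultimately have "psum p m * (real (Suc m) + real (n - m)) \<le> psum p n * real (Suc m)"
    by (simp add: algebra_simps)
  moreover have "real (Suc m) + real (n - m) = real (Suc n)" using mn by simp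
  ultimately show ?thesis using pos[of n] by (simp add: field_simps)
qed

text \<open>For exponents at least 1 the mean value theorem gives slope at most \<alpha>. Below 1
  the derivative blows up at 0, but \<open>(1 - x) powr \<alpha> \<ge> 1 - x\<close> still bounds
  the chord.\<close>

lemma one_minus_powr_le:
  fixes x \<alpha> :: real
  assumes x: "0 \<le> x" "x < 1" and \<alpha>: "0 < \<alpha>"
  shows "1 - (1 - x) powr \<alpha> \<le> max 1 \<alpha> * x"
proof (cases "1 \<le> \<alpha>")
  case True
  show ?thesis
  proof (cases "x = 0")
    case False
    then have "\<exists>z. 1 - x < z \<and> z < 1 \<and> 1 powr \<alpha> - (1 - x) powr \<alpha> = (1 - (1 - x)) * (\<alpha> * z powr (\<alpha> - 1))"
      using x by (intro MVT2) (auto intro!: derivative_eq_intros)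
    then obtain z where z: "1 - x < z" "z < 1" "1 - (1 - x) powr \<alpha> = x * (\<alpha> * z powr (\<alpha> - 1))" by auto
    have "z powr (\<alpha> - 1) \<le> 1" using z x True by (intro powr_le1) auto
    then have "x * (\<alpha> * z powr (\<alpha> - 1)) \<le> x * (\<alpha> * 1)" using x \<alpha> by (intro mult_left_mono) auto
    with z True show ?thesis by (simp add: mult.commute max_def)
  qed simp
next
  case False
  then have "(1 - x) powr 1 \<le> (1 - x) powr \<alpha>" using x by (intro powr_mono') auto
  then show ?thesis using x False by (simp add: max_def)
qed

text \<open>Comparison with an integral, carried out by telescoping. It is applied with
  \<open>s = 2 * \<alpha> - 1\<close>, so this is where \<alpha> > 1/2 enters; at
  \<open>s = 0\<close> the sum already grows logarithmically.\<close>

lemma sum_powr_le: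
  fixes s :: real
  assumes s: "0 < s"
  shows "(\<Sum>m=1..n. real (Suc m) powr (s - 1)) \<le> max 1 (1 / s) * real (Suc n) powr s"
proof (cases "1 \<le> s")
  case True
  have "(\<Sum>m=1..n. real (Suc m) powr (s - 1)) \<le> (\<Sum>m=1..n. real (Suc n) powr (s - 1))"
    using True by (intro sum_mono powr_mono2) auto
  also have "\<dots> = real n * real (Suc n) powr (s - 1)" by simp
  also have "\<dots> \<le> real (Suc n) * real (Suc n) powr (s - 1)" by (intro mult_right_mono) auto
  also have "\<dots> = real (Suc n) powr s" by (simp add: powr_diff)
  also have "\<dots> \<le> max 1 (1 / s) * real (Suc n) powr s"
    using mult_right_mono[of 1 "max 1 (1 / s)" "real (Suc n) powr s"] by simp
  finally show ?thesis .
next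
  case False
  have step: "real (Suc m) powr (s - 1) \<le> 1 / s * (real (Suc m) powr s - real m powr s)" if "1 \<le> m" for m
  proof -
    have "\<exists>z. real m < z \<and> z < real (Suc m) \<and> real (Suc m) powr s - real m powr s = (real (Suc m) - real m) * (s * z powr (s - 1))"
      using that by (intro MVT2) (auto intro!: derivative_eq_intros)
    then obtain z where z: "real m < z" "z < real (Suc m)" "real (Suc m) powr s - real m powr s = s * z powr (s - 1)"
      by auto
    have "real (Suc m) powr (s - 1) \<le> z powr (s - 1)"
      using z that False by (intro powr_mono2') auto
    then show ?thesis unfolding z(3) using s by simp
  qed
  have "(\<Sum>m=1..n. real (Suc m) powr (s - 1)) \<le> (\<Sum>m=1..n. 1 / s * (real (Suc m) powr s - real m powr s))"
    by (intro sum_mono step) auto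
  also have "\<dots> = 1 / s * (\<Sum>m=1..n. real (Suc m) powr s - real m powr s)"
    by (rule sum_distrib_left[symmetric])
  also have "(\<Sum>m=1..n. real (Suc m) powr s - real m powr s) = real (Suc n) powr s - 1"
    by (induction n) auto
  also have "1 / s * (real (Suc n) powr s - 1) \<le> max 1 (1 / s) * real (Suc n) powr s"
  proof (rule mult_mono)
    have "1 \<le> real (Suc n) powr s"
      using s by (intro ge_one_powr_ge_zero) auto
    then show "0 \<le> real (Suc n) powr s - 1" by simp
  qed (use s in auto)
  finally show ?thesis .
qed

text \<open>The case distinction is essential: natural subtraction would give the positive value
  \<open>psum p 0\<close> beyond \<open>n\<close>.\<close>

definition norlund_mult :: "(nat \<Rightarrow> real) \<Rightarrow> real \<Rightarrow> nat \<Rightarrow> nat \<Rightarrow> real" where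
  "norlund_mult p \<alpha> n k = (if k \<le> n then (psum p (n - k) / psum p n) powr \<alpha> else 0)"

lemma norlund_mult_bounds:
  assumes "norlund_weights p" "0 < \<alpha>"
  shows "0 \<le> norlund_mult p \<alpha> n k" "norlund_mult p \<alpha> n k \<le> 1"
proof -
  have "0 < psum p n" "0 < psum p (n - k)" using assms by (auto simp: norlund_weights_def)
  moreover have "psum p (n - k) \<le> psum p n" by (rule psum_mono[OF assms(1)]) simp
  ultimately show "0 \<le> norlund_mult p \<alpha> n k" "norlund_mult p \<alpha> n k \<le> 1"
    using assms(2) by (auto simp: norlund_mult_def intro!: powr_le1)
qed

text \<open>Counted from the end by \<open>m\<close>, the decrement is
  \<open>(psum p m / psum p n) powr \<alpha>\<close> times \<open>1 - (1 - x) powr \<alpha>\<close>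
  with \<open>x = p m / psum p m\<close>. The growth rate gives \<open>x \<le> B / m\<close>, and
  monotonicity of \<open>p\<close> bounds the ratio of partial sums.\<close>

lemma norlund_mult_diff:
  assumes p: "norlund_weights p" and B: "\<And>n. real n * p n / psum p n \<le> B" and \<alpha>: "0 < \<alpha>"
    and m: "1 \<le> m" "m \<le> n"
  shows "\<bar>norlund_mult p \<alpha> n (Suc (n - m)) - norlund_mult p \<alpha> n (n - m)\<bar>
    \<le> max 1 \<alpha> * (B / real m) * (real (Suc m) / real (Suc n)) powr \<alpha>"
proof -
  have pos: "0 < psum p k" for k using p by (simp add: norlund_weights_def)
  have p0: "0 \<le> p k" for k using p by (simp add: norlund_weights_def)
  obtain m' where m': "m = Suc m'" using m by (cases m) auto
  define x where "x = p m / psum p m"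
  have x0: "0 \<le> x" using p0 pos[of m] by (simp add: x_def)
  have pm: "psum p m' = psum p m * (1 - x)"
    using pos[of m] by (simp add: x_def m' psum_Suc field_simps)
  have x1: "x < 1" using pos[of m'] pos[of m] unfolding pm by (simp add: zero_less_mult_iff)
  have xB: "x \<le> B / real m" using B[of m] m by (simp add: x_def field_simps)
  have "n - Suc (n - m) = m'" "n - (n - m) = m" using m m' by auto
  then have "norlund_mult p \<alpha> n (Suc (n - m)) - norlund_mult p \<alpha> n (n - m)
      = (psum p m' / psum p n) powr \<alpha> - (psum p m / psum p n) powr \<alpha>"
    using m by (simp add: norlund_mult_def)
  also have "(psum p m' / psum p n) powr \<alpha> = (psum p m / psum p n) powr \<alpha> * (1 - x) powr \<alpha>"
  proof -
    have "psum p m' / psum p n = (psum p m / psum p n) * (1 - x)" by (simp add: pm)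
    then show ?thesis using pos[of m] pos[of n] x1 by (simp only: powr_mult)
  qed
  finally have eq: "norlund_mult p \<alpha> n (Suc (n - m)) - norlund_mult p \<alpha> n (n - m)
      = - ((psum p m / psum p n) powr \<alpha> * (1 - (1 - x) powr \<alpha>))"
    by (simp add: algebra_simps)
  have le1: "(1 - x) powr \<alpha> \<le> 1" using x0 x1 \<alpha> by (intro powr_le1) auto
  have "(psum p m / psum p n) powr \<alpha> * (1 - (1 - x) powr \<alpha>)
      \<le> (real (Suc m) / real (Suc n)) powr \<alpha> * (max 1 \<alpha> * (B / real m))"
  proof (rule mult_mono)
    show "(psum p m / psum p n) powr \<alpha> \<le> (real (Suc m) / real (Suc n)) powr \<alpha>"
      using psum_ratio_le[OF p m(2)] \<alpha> pos[of m] pos[of n] by (intro powr_mono2) auto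
    have "max 1 \<alpha> * x \<le> max 1 \<alpha> * (B / real m)" using xB by (intro mult_left_mono) auto
    with one_minus_powr_le[OF x0 x1 \<alpha>] show "1 - (1 - x) powr \<alpha> \<le> max 1 \<alpha> * (B / real m)" by linarith
  qed (use le1 in auto)
  then show ?thesis
    unfolding eq using le1 by (simp add: abs_mult mult_ac)
qed

text \<open>Up to constants the squared increments are \<open>m powr (2 * \<alpha> - 2)\<close>
  times \<open>n powr (- 2 * \<alpha>)\<close>, each with weight at most \<open>n\<close>. Summing
  over \<open>m\<close> gives \<open>n powr (2 * \<alpha> - 1)\<close>, so all powers of
  \<open>n\<close> cancel.\<close>

lemma norlund_mult_variation:
  assumes p: "norlund_weights p" and B: "\<And>n. real n * p n / psum p n \<le> B" and \<alpha>: "1 / 2 < \<alpha>"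
  shows "(\<Sum>j\<le>n. real j * (norlund_mult p \<alpha> n (Suc j) - norlund_mult p \<alpha> n j)\<^sup>2)
    \<le> 4 * (max 1 \<alpha> * B)\<^sup>2 * max 1 (1 / (2 * \<alpha> - 1)) + 1"
proof -
  let ?c = "norlund_mult p \<alpha> n"
  define s where "s = 2 * \<alpha> - 1"
  define A where "A = (max 1 \<alpha> * B)\<^sup>2"
  have s: "0 < s" using \<alpha> by (simp add: s_def)
  have bound_term: "real (n - m) * (?c (Suc (n - m)) - ?c (n - m))\<^sup>2
     \<le> 4 * A * (real n * real (Suc n) powr - (s + 1)) * real (Suc m) powr (s - 1)" if m: "m \<in> {1..n}" for m
  proof -
    have m1: "1 \<le> m" "m \<le> n" using m by auto
    have "(?c (Suc (n - m)) - ?c (n - m))\<^sup>2 \<le> (max 1 \<alpha> * (B / real m) * (real (Suc m) / real (Suc n)) powr \<alpha>)\<^sup>2"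
      using power_mono[OF norlund_mult_diff[OF p B _ m1, of \<alpha>], of 2] \<alpha> by simp
    also have "\<dots> = A / (real m)\<^sup>2 * (real (Suc m) powr (s + 1) * real (Suc n) powr - (s + 1))"
    proof -
      have "((real (Suc m) / real (Suc n)) powr \<alpha>)\<^sup>2 = (real (Suc m) / real (Suc n)) powr (s + 1)"
        by (simp add: s_def power2_eq_square flip: powr_add)
      also have "\<dots> = real (Suc m) powr (s + 1) * real (Suc n) powr - (s + 1)"
        by (simp only: powr_divide of_nat_0_le_iff) (simp only: powr_minus divide_inverse)
      finally show ?thesis by (simp add: A_def power_mult_distrib power_divide)
    qed
    also have "real (Suc m) powr (s + 1) = (real (Suc m))\<^sup>2 * real (Suc m) powr (s - 1)"
      by (simp add: powr_add powr_diff power2_eq_square)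
    finally have 1: "(?c (Suc (n - m)) - ?c (n - m))\<^sup>2
       \<le> A * ((real (Suc m))\<^sup>2 / (real m)\<^sup>2) * (real (Suc m) powr (s - 1) * real (Suc n) powr - (s + 1))"
      by (simp add: mult_ac)
    \<comment> \<open>Source of the factor 4: the ratio of partial sums involves
      \<open>Suc m\<close>, the growth rate involves \<open>m\<close>.\<close>
    have "(real (Suc m))\<^sup>2 \<le> (2 * real m)\<^sup>2" using m1 by (intro power_mono) auto
    then have "(real (Suc m))\<^sup>2 / (real m)\<^sup>2 \<le> 4" using m1 by (simp add: divide_le_eq power_mult_distrib)
    then have "A * ((real (Suc m))\<^sup>2 / (real m)\<^sup>2) * (real (Suc m) powr (s - 1) * real (Suc n) powr - (s + 1))
       \<le> A * 4 * (real (Suc m) powr (s - 1) * real (Suc n) powr - (s + 1))"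
      by (intro mult_right_mono mult_left_mono) (auto simp: A_def)
    with 1 have 2: "(?c (Suc (n - m)) - ?c (n - m))\<^sup>2 \<le> A * 4 * (real (Suc m) powr (s - 1) * real (Suc n) powr - (s + 1))"
      by linarith
    have "real (n - m) * (?c (Suc (n - m)) - ?c (n - m))\<^sup>2
       \<le> real n * (A * 4 * (real (Suc m) powr (s - 1) * real (Suc n) powr - (s + 1)))"
      using 2 by (intro mult_mono) auto
    then show ?thesis by (simp add: mult_ac)
  qed
  have "(\<Sum>j<n. real j * (?c (Suc j) - ?c j)\<^sup>2) = (\<Sum>m=1..n. real (n - m) * (?c (Suc (n - m)) - ?c (n - m))\<^sup>2)"
    by (rule sum.reindex_bij_witness[of _ "\<lambda>m. n - m" "\<lambda>j. n - j"]) auto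
  also have "\<dots> \<le> (\<Sum>m=1..n. 4 * A * (real n * real (Suc n) powr - (s + 1)) * real (Suc m) powr (s - 1))"
    by (intro sum_mono bound_term)
  also have "\<dots> = 4 * A * (real n * real (Suc n) powr - (s + 1)) * (\<Sum>m=1..n. real (Suc m) powr (s - 1))"
    by (rule sum_distrib_left[symmetric])
  also have "\<dots> \<le> 4 * A * (real n * real (Suc n) powr - (s + 1)) * (max 1 (1 / s) * real (Suc n) powr s)"
    using sum_powr_le[OF s] by (intro mult_left_mono) (auto simp: A_def)
  also have "\<dots> = 4 * A * max 1 (1 / s) * (real n * (real (Suc n) powr - (s + 1) * real (Suc n) powr s))"
    by (simp add: mult_ac)
  also have "real (Suc n) powr - (s + 1) * real (Suc n) powr s = real (Suc n) powr (- 1)"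
    by (simp flip: powr_add)
  also have "\<dots> = 1 / real (Suc n)"
    by (simp add: powr_minus_divide)
  also have "4 * A * max 1 (1 / s) * (real n * (1 / real (Suc n))) \<le> 4 * A * max 1 (1 / s) * 1"
    by (intro mult_left_mono) (auto simp: A_def)
  finally have main: "(\<Sum>j<n. real j * (?c (Suc j) - ?c j)\<^sup>2) \<le> 4 * A * max 1 (1 / s)" by simp
  \<comment> \<open>The summand 1 of the bound: the final jump from
    \<open>(psum p 0 / psum p n) powr \<alpha>\<close> to 0. Again the exponent
    \<open>2 * \<alpha> \<ge> 1\<close> compensates the weight \<open>n\<close>.\<close>
  have "real n * (?c (Suc n) - ?c n)\<^sup>2 \<le> 1"
  proof -
    have pos: "0 < psum p k" for k using p by (simp add: norlund_weights_def)
    have "(psum p 0 / psum p n) powr \<alpha> \<le> (1 / real (Suc n)) powr \<alpha>"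
      using psum_ratio_le[OF p, of 0 n] \<alpha> pos[of 0] pos[of n] by (intro powr_mono2) auto
    then have "((psum p 0 / psum p n) powr \<alpha>)\<^sup>2 \<le> ((1 / real (Suc n)) powr \<alpha>)\<^sup>2"
      by (intro power_mono) auto
    also have "\<dots> = (1 / real (Suc n)) powr (2 * \<alpha>)"
      by (simp add: power2_eq_square flip: powr_add)
    also have "\<dots> \<le> (1 / real (Suc n)) powr 1"
      using \<alpha> by (intro powr_mono') auto
    finally have "(?c (Suc n) - ?c n)\<^sup>2 \<le> 1 / real (Suc n)"
      by (simp add: norlund_mult_def)
    then have "real n * (?c (Suc n) - ?c n)\<^sup>2 \<le> real n * (1 / real (Suc n))"
      by (intro mult_left_mono) auto
    also have "\<dots> \<le> 1" by simp
    finally show ?thesis .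
  qed
  with main show ?thesis
    by (simp add: lessThan_Suc_atMost[symmetric] A_def s_def)
qed

text \<open>Consecutive partial sums have ratio \<open>1 - p (Suc n) / psum p (Suc n)\<close>, which
  tends to 1 because \<open>p n / psum p n\<close> is at most \<open>B / n\<close>; a fixed number
  \<open>k\<close> of such ratios is multiplied.\<close>

lemma norlund_mult_tendsto:
  assumes p: "norlund_weights p" and B: "\<And>n. real n * p n / psum p n \<le> B"
  shows "(\<lambda>n. norlund_mult p \<alpha> n k) \<longlonglongrightarrow> 1"
proof -
  have pos: "0 < psum p n" for n using p by (simp add: norlund_weights_def)
  have p0: "0 \<le> p n" for n using p by (simp add: norlund_weights_def)
  have "(\<lambda>n. p n / psum p n) \<longlonglongrightarrow> 0"
  proof (rule tendsto_sandwich[OF _ _ tendsto_const lim_const_over_n[of B]])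
    show "\<forall>\<^sub>F n in sequentially. 0 \<le> p n / psum p n"
      using p0 pos by (simp add: less_imp_le)
    show "\<forall>\<^sub>F n in sequentially. p n / psum p n \<le> B / real n"
      using eventually_gt_at_top[of 0]
    proof eventually_elim
      case (elim n)
      then show ?case using B[of n] by (simp add: field_simps)
    qed
  qed
  then have "(\<lambda>n. p (Suc n) / psum p (Suc n)) \<longlonglongrightarrow> 0"
    by (rule LIMSEQ_Suc)
  then have "(\<lambda>n. 1 - p (Suc n) / psum p (Suc n)) \<longlonglongrightarrow> 1 - 0"
    by (intro tendsto_intros)
  moreover have "1 - p (Suc n) / psum p (Suc n) = psum p n / psum p (Suc n)" for n
    using pos[of "Suc n"] by (simp add: field_simps psum_Suc)
  ultimately have r: "(\<lambda>n. psum p n / psum p (Suc n)) \<longlonglongrightarrow> 1" by simp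
  have q: "(\<lambda>n. psum p n / psum p (n + k)) \<longlonglongrightarrow> 1" for k
  proof (induction k)
    case 0
    then show ?case using pos by (simp add: less_imp_neq[symmetric])
  next
    case (Suc k)
    have "(\<lambda>n. psum p n / psum p (n + k) * (psum p (n + k) / psum p (Suc (n + k)))) \<longlonglongrightarrow> 1 * 1"
      by (intro tendsto_mult Suc LIMSEQ_ignore_initial_segment[OF r])
    moreover have eq: "psum p n / psum p (n + k) * (psum p (n + k) / psum p (Suc (n + k))) = psum p n / psum p (n + Suc k)" for n
      using less_imp_neq[OF pos[of "n + k"]] by simp
    ultimately show ?case by (simp only: eq mult_1_left)
  qed
  have "(\<lambda>n. (psum p n / psum p (n + k)) powr \<alpha>) \<longlonglongrightarrow> 1 powr \<alpha>"
    by (intro tendsto_powr q tendsto_const) auto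
  then have "(\<lambda>n. norlund_mult p \<alpha> (n + k) k) \<longlonglongrightarrow> 1"
    by (simp add: norlund_mult_def)
  then show ?thesis by (rule LIMSEQ_offset)
qed

lemma norlund_sum_eq:
  assumes p: "norlund_weights p"
  shows "norlund_sum p \<alpha> n f z = (\<Sum>k\<le>n. of_real (norlund_mult p \<alpha> n k) * fps_nth (fps_expansion f 0) k * z ^ k)"
proof -
  have pos: "0 < psum p n" for n using p by (simp add: norlund_weights_def)
  show ?thesis
    unfolding norlund_sum_def sum_divide_distrib
  proof (rule sum.cong)
    fix k assume "k \<in> {..n}"
    then have "norlund_mult p \<alpha> n k = psum p (n - k) powr \<alpha> / psum p n powr \<alpha>"
      using pos[of n] pos[of "n - k"] by (simp add: norlund_mult_def powr_divide)
    then show "of_real (psum p (n - k) powr \<alpha>) * fps_nth (fps_expansion f 0) k * z ^ k / of_real (psum p n powr \<alpha>)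
        = of_real (norlund_mult p \<alpha> n k) * fps_nth (fps_expansion f 0) k * z ^ k"
      by simp
  qed simp
qed

section \<open>Convergence in weighted Dirichlet spaces\<close>

lemma holomorphic_sums_fps_expansion:
  assumes "f holomorphic_on ball 0 1" "z \<in> ball 0 1"
  shows "(\<lambda>k. fps_nth (fps_expansion f 0) k * z ^ k) sums f z"
  using holomorphic_power_series[OF assms] by (simp add: fps_expansion_def)

lemma dirichlet_integral_eq_energy:
  assumes \<omega>: "positive_superharmonic \<omega>" and f: "f holomorphic_on ball 0 1"
  shows "dirichlet_integral \<omega> f = energy (disk_weight \<omega>) (ball 0 1) f / ennreal pi"
proof -
  define g where "g z = (if z \<in> ball 0 1 then deriv f z else 0)" for z
  have [measurable]: "g \<in> borel_measurable borel" unfolding g_def by (rule measurable_deriv_on_ball[OF f])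
  have [measurable]: "disk_weight \<omega> \<in> borel_measurable borel"
    by (rule supermean_weight_measurable[OF supermean_weight_disk_weight[OF \<omega>]])
  have "dirichlet_integral \<omega> f = (\<integral>\<^sup>+z. ennreal ((cmod (g z))\<^sup>2) * disk_weight \<omega> z \<partial>uniform_measure lborel (ball 0 1))"
    unfolding dirichlet_integral_def
    by (intro nn_integral_cong_AE AE_uniform_measureI) (auto simp: g_def disk_weight_def)
  also have "\<dots> = (\<integral>\<^sup>+z\<in>ball 0 1. ennreal ((cmod (g z))\<^sup>2) * disk_weight \<omega> z \<partial>lborel) / emeasure lborel (ball (0::complex) 1)"
    by (rule nn_integral_uniform_measure) auto
  also have "emeasure lborel (ball (0::complex) 1) = ennreal pi"
    by (simp add: emeasure_ball unit_ball_vol_2)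
  also have "(\<integral>\<^sup>+z\<in>ball 0 1. ennreal ((cmod (g z))\<^sup>2) * disk_weight \<omega> z \<partial>lborel) = energy (disk_weight \<omega>) (ball 0 1) f"
    unfolding energy_def by (intro nn_integral_cong) (auto simp: g_def indicator_def)
  finally show ?thesis .
qed

text \<open>If the weight were infinite on a ball, finite energy would exclude a non-zero derivative
  on any smaller ball inside it; by analytic continuation the derivative would vanish on the whole
  disk.\<close>

lemma nonconstant_energy_imp_dense_finite:
  assumes f: "f holomorphic_on ball 0 1" and E: "energy u (ball 0 1) f < \<infinity>"
    and w: "w \<in> ball 0 1" "deriv f w \<noteq> 0" and z: "z \<in> ball 0 1" and e: "0 < e"
  shows "\<exists>a. dist a z < e \<and> u a < (\<infinity>::ennreal)"
proof (rule ccontr)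
  assume "\<not> ?thesis"
  then have inf: "u a = \<infinity>" if "a \<in> ball z e" for a
    using that by (auto simp: dist_commute top.not_eq_extremum[symmetric])
  define U where "U = ball z e \<inter> ball 0 1"
  have U: "open U" "z \<in> U" using z e by (auto simp: U_def)
  have holf': "deriv f holomorphic_on ball 0 1" by (intro holomorphic_deriv f) auto
  have "\<exists>a\<in>U. deriv f a \<noteq> 0"
  proof (rule ccontr)
    assume "\<not> ?thesis"
    moreover have "U \<subseteq> ball 0 1" by (simp add: U_def)
    moreover have "U \<noteq> {}" using U(2) by blast
    ultimately have "deriv f w = 0"
      using analytic_continuation_open[OF U(1) open_ball, of 0 1 "deriv f" "\<lambda>_. 0" w] holf' w(1)
      by (simp add: holomorphic_on_const)
    with w show False by simp
  qed
  then obtain a where a: "a \<in> U" "deriv f a \<noteq> 0" by blast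
  have "continuous_on U (deriv f)"
    using holf' by (auto simp: U_def intro: holomorphic_on_imp_continuous_on continuous_on_subset)
  then have "open (U \<inter> deriv f -` (- {0}))"
    using U(1) by (rule continuous_open_preimage) auto
  moreover have "a \<in> U \<inter> deriv f -` (- {0})" using a by auto
  ultimately obtain r where r: "0 < r" "ball a r \<subseteq> U \<inter> deriv f -` (- {0})"
    by (rule openE)
  have "(\<integral>\<^sup>+x. \<infinity> * indicator (ball a r) x \<partial>lborel) \<le> energy u (ball 0 1) f"
    unfolding energy_def
  proof (rule nn_integral_mono)
    fix x
    show "\<infinity> * indicator (ball a r) x \<le> ennreal ((cmod (deriv f x))\<^sup>2) * u x * indicator (ball 0 1) x"
    proof (cases "x \<in> ball a r")
      case True
      then have "x \<in> ball z e" "x \<in> ball 0 1" "deriv f x \<noteq> 0" using r by (auto simp: U_def)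
      then show ?thesis using inf by (simp add: ennreal_mult_top)
    qed simp
  qed
  moreover have "(\<integral>\<^sup>+x. \<infinity> * indicator (ball a r) x \<partial>lborel) = \<infinity>"
    using r(1) by (subst nn_integral_cmult_indicator) (auto simp: emeasure_ball unit_ball_vol_2 ennreal_top_mult)
  ultimately show False using E by simp
qed

lemma deriv_zero_imp_constant_on_ball:
  assumes f: "f holomorphic_on ball 0 1" and "\<And>w. w \<in> ball 0 1 \<Longrightarrow> deriv f w = 0" and z: "z \<in> ball 0 1"
  shows "f z = f (0::complex)"
proof -
  have "(f has_field_derivative 0) (at w within ball 0 1)" if "w \<in> ball 0 1" for w
    using holomorphic_derivI[OF f _ that] assms(2)[OF that] by (auto intro: has_field_derivative_at_within)
  then obtain c where "\<And>w. w \<in> ball 0 1 \<Longrightarrow> f w = c"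
    using has_field_derivative_zero_constant[OF convex_ball] by blast
  with z show ?thesis by simp
qed

lemma energy_cong:
  assumes "\<And>z. z \<in> ball 0 1 \<Longrightarrow> f z = g z"
  shows "energy u (ball 0 1) f = energy u (ball 0 1) g"
  unfolding energy_def
proof (rule nn_integral_cong)
  fix z
  show "ennreal ((cmod (deriv f z))\<^sup>2) * u z * indicator (ball 0 1) z = ennreal ((cmod (deriv g z))\<^sup>2) * u z * indicator (ball 0 1) z"
  proof (cases "z \<in> ball 0 1")
    case True
    then have "\<forall>\<^sub>F w in nhds z. f w = g w"
      using eventually_nhds_in_open[of "ball 0 1" z] assms by (auto elim: eventually_mono)
    then have "deriv f z = deriv g z" by (rule deriv_cong_ev) simp
    then show ?thesis by simp
  qed simp
qed

text \<open>A non-constant \<open>f\<close> supplies local integrability of the weight. For constant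
  \<open>f\<close> the weight may be infinite everywhere, but the sums reproduce constants exactly
  and the error has zero energy.\<close>

lemma norlund_energy_tendsto:
  assumes \<omega>: "positive_superharmonic \<omega>" and p: "norlund_weights p" and up: "finite_upper_growth_rate p"
    and \<alpha>: "1 / 2 < \<alpha>" and f: "f holomorphic_on ball 0 1" and E: "energy (disk_weight \<omega>) (ball 0 1) f < \<infinity>"
  shows "(\<lambda>n. energy (disk_weight \<omega>) (ball 0 1) (\<lambda>z. norlund_sum p \<alpha> n f z - f z)) \<longlonglongrightarrow> 0"
proof (cases "\<forall>w\<in>ball 0 1. deriv f w = 0")
  case True
  have const: "f z = f 0" if "z \<in> ball 0 1" for z
    using deriv_zero_imp_constant_on_ball[OF f _ that] True by blast
  have coeff: "fps_nth (fps_expansion f 0) k = (if k = 0 then f 0 else 0)" for k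
  proof -
    have "(deriv ^^ k) f 0 = (deriv ^^ k) (\<lambda>_. f 0) 0"
    proof (rule higher_deriv_transform_within_open[where S="ball 0 1"])
      show "f z = f 0" if "z \<in> ball 0 1" for z by (rule const[OF that])
    qed (use f in auto)
    then show ?thesis by (simp add: fps_expansion_def)
  qed
  have "norlund_sum p \<alpha> n f z - f z = 0" if "z \<in> ball 0 1" for n z
  proof -
    have "psum p n / psum p n = 1"
      using p less_imp_neq[of 0 "psum p n"] by (simp add: norlund_weights_def)
    then have "norlund_mult p \<alpha> n 0 = 1" by (simp add: norlund_mult_def)
    with coeff const[OF that] show ?thesis
      unfolding norlund_sum_eq[OF p] by (simp add: sum.atMost_shift)
  qed
  then have "energy (disk_weight \<omega>) (ball 0 1) (\<lambda>z. norlund_sum p \<alpha> n f z - f z)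
      = energy (disk_weight \<omega>) (ball 0 1) (\<lambda>z. 0)" for n
    by (intro energy_cong) auto
  then show ?thesis by (simp add: energy_def)
next
  case False
  then obtain w where w: "w \<in> ball 0 1" "deriv f w \<noteq> 0" by blast
  have u: "supermean_weight (disk_weight \<omega>)" by (rule supermean_weight_disk_weight[OF \<omega>])
  have fin: "(\<integral>\<^sup>+z\<in>ball 0 \<rho>. disk_weight \<omega> z \<partial>lborel) < \<infinity>" if "\<rho> < 1" for \<rho>
    using nonconstant_energy_imp_dense_finite[OF f E w]
    by (intro supermean_weight_locally_integrable[OF u that]) auto
  obtain B where B: "0 < B" "\<And>n. real n * p n / psum p n \<le> B"
    using finite_upper_growth_rate_bound[OF up] by blast
  show ?thesis
    unfolding norlund_sum_eq[OF p]
  proof (rule energy_multiplier_convergence[OF u fin holomorphic_sums_fps_expansion[OF f] E])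
    show "\<bar>norlund_mult p \<alpha> n k\<bar> \<le> 1" for n k
      using norlund_mult_bounds[OF p, of \<alpha> n k] \<alpha> by simp
    show "norlund_mult p \<alpha> n k = 0" if "n < k" for n k
      using that by (simp add: norlund_mult_def)
    show "(\<lambda>n. norlund_mult p \<alpha> n k) \<longlonglongrightarrow> 1" for k
      by (rule norlund_mult_tendsto[OF p B(2)])
    show "(\<Sum>j\<le>n. real j * (norlund_mult p \<alpha> n (Suc j) - norlund_mult p \<alpha> n j)\<^sup>2)
       \<le> 4 * (max 1 \<alpha> * B)\<^sup>2 * max 1 (1 / (2 * \<alpha> - 1)) + 1" for n
      by (rule norlund_mult_variation[OF p B(2) \<alpha>])
  qed
qed

lemma norlund_sum_at_0:
  assumes p: "norlund_weights p"
  shows "norlund_sum p \<alpha> n f 0 = f 0"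
proof -
  have "0 < psum p n" using p by (simp add: norlund_weights_def)
  then show ?thesis
    unfolding norlund_sum_eq[OF p]
    by (simp add: sum.atMost_shift norlund_mult_def fps_expansion_def)
qed

lemma norlund_sum_holomorphic: "norlund_sum p \<alpha> n f holomorphic_on S"
  unfolding norlund_sum_def[abs_def]
proof (cases "psum p n powr \<alpha> = 0")
  case True
  then show "(\<lambda>z. (\<Sum>k\<le>n. of_real (psum p (n - k) powr \<alpha>) * fps_nth (fps_expansion f 0) k * z ^ k)
     / of_real (psum p n powr \<alpha>)) holomorphic_on S" by simp
qed (intro holomorphic_intros, simp)

text \<open>Functions vanishing at 0 have as norm the square root of their Dirichlet integral, with
  infinite values corresponding.\<close>

lemma dirichlet_norm_tendsto_0_iff:
  assumes "\<And>n. F n 0 = 0"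
  shows "(\<lambda>n. dirichlet_norm \<omega> (F n)) \<longlonglongrightarrow> 0 \<longleftrightarrow> (\<lambda>n. dirichlet_integral \<omega> (F n)) \<longlonglongrightarrow> 0"
proof -
  have norm_le: "dirichlet_norm \<omega> (F n) \<le> ennreal e \<longleftrightarrow> dirichlet_integral \<omega> (F n) \<le> ennreal (e\<^sup>2)" if e: "0 < e" for n e
  proof (cases "dirichlet_integral \<omega> (F n)")
    case (real r)
    have "sqrt r \<le> e \<longleftrightarrow> r \<le> e\<^sup>2"
      using e by (auto intro: real_le_lsqrt dest: sqrt_le_D)
    then show ?thesis
      using real e by (simp add: dirichlet_norm_def assms ennreal_le_iff)
  next
    case top
    then show ?thesis by (simp add: dirichlet_norm_def top_unique)
  qed
  show ?thesis
    unfolding ennreal_tendsto_0_iff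
  proof (intro iffI allI impI)
    fix e :: real assume *: "\<forall>e>0. \<forall>\<^sub>F n in sequentially. dirichlet_norm \<omega> (F n) \<le> ennreal e" and e: "0 < e"
    then have "\<forall>\<^sub>F n in sequentially. dirichlet_norm \<omega> (F n) \<le> ennreal (sqrt e)" by simp
    then show "\<forall>\<^sub>F n in sequentially. dirichlet_integral \<omega> (F n) \<le> ennreal e"
      using e norm_le[of "sqrt e"] by simp
  next
    fix e :: real assume *: "\<forall>e>0. \<forall>\<^sub>F n in sequentially. dirichlet_integral \<omega> (F n) \<le> ennreal e" and e: "0 < e"
    then have "\<forall>\<^sub>F n in sequentially. dirichlet_integral \<omega> (F n) \<le> ennreal (e\<^sup>2)" by simp
    then show "\<forall>\<^sub>F n in sequentially. dirichlet_norm \<omega> (F n) \<le> ennreal e"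
      using norm_le[OF e] by simp
  qed
qed

lemma norlund_converges_if_finite_upper_growth_rate:
  assumes p: "norlund_weights p" and \<alpha>: "1 / 2 < \<alpha>" and \<omega>: "positive_superharmonic \<omega>"
    and up: "finite_upper_growth_rate p"
  shows "norlund_converges p \<alpha> \<omega>"
  unfolding norlund_converges_def
proof
  fix f assume "f \<in> dirichlet_space \<omega>"
  then have f: "f holomorphic_on ball 0 1" and D: "dirichlet_integral \<omega> f < \<infinity>"
    by (auto simp: dirichlet_space_def)
  have hol: "(\<lambda>z. norlund_sum p \<alpha> n f z - f z) holomorphic_on ball 0 1" for n
    by (intro holomorphic_intros norlund_sum_holomorphic f)
  have "energy (disk_weight \<omega>) (ball 0 1) f < \<infinity>"
    using D unfolding dirichlet_integral_eq_energy[OF \<omega> f]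
    by (metis ennreal_divide_eq_top_iff ennreal_neq_top infinity_ennreal_def less_top)
  from norlund_energy_tendsto[OF \<omega> p up \<alpha> f this]
  have "(\<lambda>n. inverse (ennreal pi) * energy (disk_weight \<omega>) (ball 0 1) (\<lambda>z. norlund_sum p \<alpha> n f z - f z))
      \<longlonglongrightarrow> inverse (ennreal pi) * 0"
    by (intro ennreal_tendsto_cmult) (auto simp: inverse_ennreal)
  then have "(\<lambda>n. dirichlet_integral \<omega> (\<lambda>z. norlund_sum p \<alpha> n f z - f z)) \<longlonglongrightarrow> 0"
    unfolding dirichlet_integral_eq_energy[OF \<omega> hol] by (simp add: divide_ennreal_def mult.commute)
  then show "(\<lambda>n. dirichlet_norm \<omega> (\<lambda>z. norlund_sum p \<alpha> n f z - f z)) \<longlonglongrightarrow> 0"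
    by (subst dirichlet_norm_tendsto_0_iff) (auto simp: norlund_sum_at_0[OF p])
qed

text \<open>Monotonicity bounds \<open>real n * p n\<close> by the block of terms from
  \<open>n + 1\<close> to \<open>2 * n\<close>, hence by \<open>psum p (2 * n)\<close>; the growth
  condition bounds this by a multiple of \<open>psum p (n - 1)\<close>, which is at most
  \<open>psum p n\<close>.\<close>

lemma growth_condition_imp_finite_lower_growth_rate:
  assumes p: "norlund_weights p" and g: "growth_condition p"
  shows "finite_lower_growth_rate p"
proof -
  have mono: "p i \<le> p j" if "i \<le> j" for i j
    using p that by (auto simp: norlund_weights_def mono_def)
  have pos: "0 < psum p n" for n using p by (simp add: norlund_weights_def)
  obtain d where d: "0 < d" "ereal d < liminf (\<lambda>n. ereal (psum p (n - 1) / psum p (2 * n)))"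
    using g ereal_dense2[of 0] unfolding growth_condition_def by (auto simp: ereal_less(2))
  then have "\<forall>\<^sub>F n in sequentially. d < psum p (n - 1) / psum p (2 * n)"
    by (auto dest!: less_LiminfD)
  then have "\<forall>\<^sub>F n in sequentially. ereal (real n * p n / psum p n) \<le> ereal (1 / d)"
  proof eventually_elim
    case (elim n)
    have "real n * p n \<le> (\<Sum>k\<in>{n<..2*n}. p k)"
      using sum_bounded_below[of "{n<..2*n}" "p n" p] mono by simp
    also have "\<dots> \<le> psum p (2 * n)"
      unfolding psum_def using p by (intro sum_mono2) (auto simp: norlund_weights_def)
    finally have "real n * p n \<le> psum p (2 * n)" .
    moreover have "d * psum p (2 * n) < psum p (n - 1)"
      using elim pos[of "2 * n"] by (simp add: less_divide_eq)
    moreover have "psum p (n - 1) \<le> psum p n" by (rule psum_mono[OF p]) simp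
    ultimately have "d * (real n * p n) \<le> psum p n"
      using d(1) mult_left_mono[of "real n * p n" "psum p (2 * n)" d] by linarith
    then show ?case using d(1) pos[of n] by (simp add: field_simps)
  qed
  then have "limsup (\<lambda>n. ereal (real n * p n / psum p n)) \<le> ereal (1 / d)"
    by (rule Limsup_bounded)
  then show ?thesis
    unfolding finite_lower_growth_rate_def
    using Liminf_le_Limsup[OF trivial_limit_sequentially, of "\<lambda>n. ereal (real n * p n / psum p n)"]
    by (auto intro: le_less_trans[OF order_trans])
qed

section \<open>Sharpness of the exponent\<close>

definition poisson :: "complex \<Rightarrow> real" where
  "poisson z = (1 - (cmod z)\<^sup>2) / (cmod (1 - z))\<^sup>2"

lemma poisson_eq_Re:
  assumes "z \<noteq> 1"
  shows "poisson z = Re ((1 + z) / (1 - z))"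
proof -
  have "(1 + z) / (1 - z) = (1 + z) * cnj (1 - z) / of_real ((cmod (1 - z))\<^sup>2)"
    by (rule complex_div_cnj)
  then have "Re ((1 + z) / (1 - z)) = Re ((1 + z) * cnj (1 - z)) / (cmod (1 - z))\<^sup>2"
    by (simp only: Re_divide_of_real)
  also have "Re ((1 + z) * cnj (1 - z)) = 1 - (cmod z)\<^sup>2"
    unfolding cmod_power2 by (simp add: power2_eq_square algebra_simps)
  finally show ?thesis by (simp add: poisson_def)
qed

lemma poisson_pos: "z \<in> ball 0 1 \<Longrightarrow> 0 < poisson z"
  unfolding poisson_def by (intro divide_pos_pos) (auto simp: power_less_one_iff abs_square_less_1)

lemma measurable_poisson [measurable]: "poisson \<in> borel_measurable borel"
  unfolding poisson_def[abs_def] by measurable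

lemma continuous_on_poisson: "continuous_on (ball 0 1) poisson"
  unfolding poisson_def[abs_def] by (intro continuous_intros) auto

lemma ball_subset_unit_ball: "ball z (1 - norm z) \<subseteq> ball (0 :: 'a :: real_normed_vector) 1"
proof
  fix w assume "w \<in> ball z (1 - norm z)"
  then show "w \<in> ball 0 1" using norm_triangle_ineq[of z "w - z"] by (simp add: dist_norm norm_minus_commute)
qed

lemma poisson_mean:
  assumes z: "z \<in> ball 0 1" and r: "0 \<le> r" "r < 1 - cmod z"
  shows "(\<integral>\<^sup>+t. ennreal (poisson (z + of_real r * cis t)) \<partial>circ) = ennreal (poisson z)"
proof -
  define h where "h w = (1 + w) / (1 - w)" for w :: complex
  note sub = ball_subset_unit_ball[of z]
  have mem: "z + of_real r * cis t \<in> ball 0 1" for t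
    by (rule subsetD[OF sub]) (use r in \<open>simp add: dist_norm norm_mult\<close>)
  have P: "poisson w = Re (h w)" if "w \<in> ball 0 1" for w
    using that unfolding h_def by (intro poisson_eq_Re) auto
  have hol: "h holomorphic_on ball 0 1"
    unfolding h_def by (intro holomorphic_intros) auto
  have cb: "cball z r \<subseteq> ball 0 1"
    using sub r by (intro subset_trans[OF _ sub]) auto
  have "compact (h ` cball z r)"
    by (intro compact_continuous_image holomorphic_on_imp_continuous_on holomorphic_on_subset[OF hol cb]) auto
  then have "bounded (h ` cball z r)" by (rule compact_imp_bounded)
  then obtain B where B: "\<And>w. w \<in> cball z r \<Longrightarrow> cmod (h w) \<le> B"
    unfolding bounded_iff by blast
  have int: "integrable circ (\<lambda>t. h (z + of_real r * cis t))"
  proof (rule integrable_circ_bounded)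
    show "norm (h (z + of_real r * cis t)) \<le> B" for t
      using r by (intro B) (simp add: dist_norm norm_mult)
    show "(\<lambda>t. h (z + of_real r * cis t)) \<in> borel_measurable borel"
      unfolding h_def by measurable
  qed
  have "(\<integral>t. h (z + of_real r * cis t) \<partial>circ) = h z"
    by (rule holomorphic_circle_mean[OF holomorphic_on_subset[OF hol sub]]) (use r in simp)
  then have "(\<integral>t. Re (h (z + of_real r * cis t)) \<partial>circ) = Re (h z)"
    using integral_Re[OF int] by simp
  then have "(\<integral>t. poisson (z + of_real r * cis t) \<partial>circ) = poisson z"
    using P[OF mem] P[OF z] by simp
  moreover have "integrable circ (\<lambda>t. poisson (z + of_real r * cis t))"
    using integrable_Re[OF int] P[OF mem] by simp
  ultimately show ?thesis
    using poisson_pos[OF mem] by (subst nn_integral_eq_integral) (auto simp: less_imp_le)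
qed

lemma positive_superharmonic_poisson: "positive_superharmonic (\<lambda>z. ereal (poisson z))"
  unfolding positive_superharmonic_def superharmonic_on_def
proof (intro conjI ballI)
  show "lsc_on (ball 0 1) (\<lambda>z. ereal (poisson z))"
    unfolding lsc_on_def
  proof
    fix c :: ereal
    have "continuous_on (ball 0 1) (\<lambda>z. ereal (poisson z))"
      by (intro continuous_intros continuous_on_poisson)
    from continuous_openin_preimage_gen[OF this open_greaterThan[of c]]
    have "openin (top_of_set (ball 0 1)) (ball 0 1 \<inter> (\<lambda>z. ereal (poisson z)) -` {c<..})" .
    moreover have "ball 0 1 \<inter> (\<lambda>z. ereal (poisson z)) -` {c<..} = {z \<in> ball 0 1. c < ereal (poisson z)}"
      by auto
    ultimately show "openin (top_of_set (ball 0 1)) {z \<in> ball 0 1. c < ereal (poisson z)}"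
      by (simp only:)
  qed
  fix z :: complex assume z: "z \<in> ball 0 1"
  show "\<exists>R>0. ball z R \<subseteq> ball 0 1 \<and> (\<forall>r. 0 \<le> r \<and> r < R \<longrightarrow> circle_mean (\<lambda>z. ereal (poisson z)) z r \<le> ereal (poisson z))"
  proof (intro exI[of _ "1 - cmod z"] conjI allI impI)
    show sub: "ball z (1 - cmod z) \<subseteq> ball 0 1" by (rule ball_subset_unit_ball)
    fix r assume r: "0 \<le> r \<and> r < 1 - cmod z"
    have mem: "z + of_real r * cis t \<in> ball 0 1" for t
      by (rule subsetD[OF sub]) (use r in \<open>simp add: dist_norm norm_mult\<close>)
    have neg: "e2ennreal (- ereal (poisson (z + of_real r * cis t))) = 0" for t
      using poisson_pos[OF mem[of t]] by (intro e2ennreal_neg) simp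
    define I where "I = (\<integral>\<^sup>+t\<in>{0..2*pi}. ennreal (poisson (z + of_real r * cis t)) \<partial>lborel)"
    have "circle_mean (\<lambda>z. ereal (poisson z)) z r = enn2ereal I / ereal (2 * pi)"
      unfolding circle_mean_def neg I_def ennreal_def[symmetric] e2ennreal_ereal by (simp add: zero_ennreal.rep_eq)
    also have "\<dots> = enn2ereal (I / ennreal (2 * pi))"
      by (simp add: divide_ennreal_def divide_ereal_def times_ennreal.rep_eq inverse_ennreal.rep_eq)
    also have "I / ennreal (2 * pi) = ennreal (poisson z)"
    proof -
      have "I / ennreal (2 * pi) = (\<integral>\<^sup>+t. ennreal (poisson (z + of_real r * cis t)) \<partial>circ)"
        unfolding I_def by (rule nn_integral_circ[symmetric]) measurable
      then show ?thesis using poisson_mean[OF z, of r] r by simp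
    qed
    finally show "circle_mean (\<lambda>z. ereal (poisson z)) z r \<le> ereal (poisson z)"
      using poisson_pos[OF z] by simp
  qed (use z in simp)
qed (use poisson_pos in auto)

section \<open>Moments of the disk and weighted area integrals of power series\<close>

lemma nn_integral_disk_power:
  "(\<integral>\<^sup>+z\<in>ball 0 1. ennreal (cmod z ^ (2 * n)) \<partial>lborel) = ennreal (pi / real (Suc n))"
proof (cases "n = 0")
  case True
  then show ?thesis by (simp add: emeasure_ball unit_ball_vol_2)
next
  case False
  \<comment> \<open>Layer-cake formula: the power is the integral of \<open>g\<close> from 0 to
    \<open>cmod z\<close>, and Tonelli reduces the claim to areas of annuli. The case
    \<open>n = 0\<close> is apart since \<open>0 ^ 0 = 1\<close>.\<close>
  define g where "g s = 2 * real n * s ^ (2 * n - 1)" for s :: real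
  have gd: "((\<lambda>s. s ^ (2 * n)) has_real_derivative g s) (at s)" for s
    unfolding g_def by (auto intro!: derivative_eq_intros)
  have g0: "0 \<le> g s" if "0 \<le> s" for s using that by (simp add: g_def)
  have [measurable]: "g \<in> borel_measurable borel" unfolding g_def by measurable
  have pw: "ennreal (cmod z ^ (2 * n)) = (\<integral>\<^sup>+s. ennreal (g s) * indicator {0..cmod z} s \<partial>lborel)" for z
    using False by (subst nn_integral_FTC_Icc[where F="\<lambda>s. s ^ (2 * n)"]) (auto simp: g0 gd)
  have "(\<integral>\<^sup>+z\<in>ball 0 1. ennreal (cmod z ^ (2 * n)) \<partial>lborel)
      = (\<integral>\<^sup>+z. (\<integral>\<^sup>+s. ennreal (g s) * (if 0 \<le> s \<and> s \<le> cmod z \<and> cmod z < 1 then 1 else 0) \<partial>lborel) \<partial>lborel)"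
    unfolding pw by (intro nn_integral_cong)
      (auto simp: indicator_def intro!: nn_integral_cong)
  also have "\<dots> = (\<integral>\<^sup>+s. (\<integral>\<^sup>+z. ennreal (g s) * (if 0 \<le> s \<and> s \<le> cmod z \<and> cmod z < 1 then 1 else 0) \<partial>lborel) \<partial>lborel)"
    by (rule lborel_pair.Fubini') measurable
  also have "\<dots> = (\<integral>\<^sup>+s. ennreal (pi * (g s - g s * s\<^sup>2)) * indicator {0..1} s \<partial>lborel)"
  proof (rule nn_integral_cong)
    fix s :: real
    show "(\<integral>\<^sup>+z. ennreal (g s) * (if 0 \<le> s \<and> s \<le> cmod z \<and> cmod z < 1 then 1 else 0) \<partial>lborel)
        = ennreal (pi * (g s - g s * s\<^sup>2)) * indicator {0..1} s"
    proof (cases "s \<in> {0..1}")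
      case True
      have "(\<integral>\<^sup>+z. ennreal (g s) * (if 0 \<le> s \<and> s \<le> cmod z \<and> cmod z < 1 then 1 else 0) \<partial>lborel)
          = (\<integral>\<^sup>+z. ennreal (g s) * indicator (ball 0 1 - ball (0::complex) s) z \<partial>lborel)"
        using True by (intro nn_integral_cong) (auto simp: indicator_def)
      also have "\<dots> = ennreal (g s) * emeasure lborel (ball 0 1 - ball (0::complex) s)"
        by (rule nn_integral_cmult_indicator) simp
      also have "emeasure lborel (ball 0 1 - ball (0::complex) s) = ennreal pi - ennreal (pi * s\<^sup>2)"
        using True by (subst emeasure_Diff) (auto simp: emeasure_ball unit_ball_vol_2 subset_ball)
      also have "\<dots> = ennreal (pi - pi * s\<^sup>2)"
        by (rule ennreal_minus) simp
      also have "ennreal (g s) * ennreal (pi - pi * s\<^sup>2) = ennreal (g s * (pi - pi * s\<^sup>2))"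
        using g0[of s] True by (simp add: ennreal_mult')
      finally show ?thesis using True by (simp add: algebra_simps)
    next
      case False
      then have n: "(0 \<le> s \<and> s \<le> cmod z \<and> cmod z < 1) = False" for z :: complex by auto
      show ?thesis unfolding n using False by simp
    qed
  qed
  also have "\<dots> = ennreal (pi * (1 ^ (2 * n) - real n / real (Suc n) * 1 ^ (2 * n + 2)) - pi * (0 ^ (2 * n) - real n / real (Suc n) * 0 ^ (2 * n + 2)))"
  proof (rule nn_integral_FTC_Icc)
    fix s :: real assume "s \<in> {0..1}"
    then have s: "0 \<le> s" "s \<le> 1" by auto
    have "((\<lambda>s. pi * (s ^ (2 * n) - real n / real (Suc n) * s ^ (2 * n + 2))) has_real_derivative
       pi * (g s - real n / real (Suc n) * (real (2 * n + 2) * s ^ (2 * n + 1)))) (at s)"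
      by (intro derivative_eq_intros gd refl) (auto simp: g_def)
    moreover have "real n / real (Suc n) * (real (2 * n + 2) * s ^ (2 * n + 1)) = g s * s\<^sup>2"
    proof -
      have "real (2 * n + 2) = 2 * real (Suc n)" by simp
      moreover have "s ^ (2 * n + 1) = s ^ (2 * n - 1) * s\<^sup>2"
        using False by (simp flip: power_add)
      ultimately show ?thesis by (simp add: g_def del: of_nat_Suc)
    qed
    ultimately show "((\<lambda>s. pi * (s ^ (2 * n) - real n / real (Suc n) * s ^ (2 * n + 2))) has_real_derivative
       pi * (g s - g s * s\<^sup>2)) (at s)" by simp
    have "g s * s\<^sup>2 \<le> g s * 1"
      using s g0[of s] by (intro mult_left_mono) (auto simp: power_le_one)
    then show "0 \<le> pi * (g s - g s * s\<^sup>2)" by simp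
  qed auto
  also have "pi * (1 ^ (2 * n) - real n / real (Suc n) * 1 ^ (2 * n + 2)) - pi * (0 ^ (2 * n) - real n / real (Suc n) * 0 ^ (2 * n + 2))
      = pi / real (Suc n)"
    using False by (simp add: field_simps zero_power)
  finally show ?thesis .
qed

text \<open>Difference of two consecutive moments, written additively and then cancelled.\<close>

lemma nn_integral_disk_power_weight:
  "(\<integral>\<^sup>+z\<in>ball 0 1. ennreal (cmod z ^ (2 * n) * (1 - (cmod z)\<^sup>2)) \<partial>lborel) = ennreal (pi / (real (n + 1) * real (n + 2)))"
    (is "?X = _")
proof -
  have "?X + ennreal (pi / real (Suc (Suc n))) = (\<integral>\<^sup>+z. ennreal (cmod z ^ (2 * n) * (1 - (cmod z)\<^sup>2)) * indicator (ball 0 1) z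
       + ennreal (cmod z ^ (2 * Suc n)) * indicator (ball 0 1) z \<partial>lborel)"
    unfolding nn_integral_disk_power[symmetric] by (rule nn_integral_add[symmetric]) measurable
  also have "\<dots> = (\<integral>\<^sup>+z\<in>ball 0 1. ennreal (cmod z ^ (2 * n)) \<partial>lborel)"
  proof (rule nn_integral_cong)
    fix z :: complex
    have "ennreal (cmod z ^ (2 * n) * (1 - (cmod z)\<^sup>2)) + ennreal (cmod z ^ (2 * Suc n)) = ennreal (cmod z ^ (2 * n))"
      if "cmod z < 1"
    proof -
      have "0 \<le> 1 - (cmod z)\<^sup>2" using that by (simp add: power_le_one)
      then have "ennreal (cmod z ^ (2 * n) * (1 - (cmod z)\<^sup>2)) + ennreal (cmod z ^ (2 * Suc n))
         = ennreal (cmod z ^ (2 * n) * (1 - (cmod z)\<^sup>2) + cmod z ^ (2 * Suc n))"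
        by (intro ennreal_plus[symmetric]) auto
      also have "cmod z ^ (2 * n) * (1 - (cmod z)\<^sup>2) + cmod z ^ (2 * Suc n) = cmod z ^ (2 * n)"
        by (simp add: algebra_simps power2_eq_square)
      finally show ?thesis .
    qed
    then show "ennreal (cmod z ^ (2 * n) * (1 - (cmod z)\<^sup>2)) * indicator (ball 0 1) z
       + ennreal (cmod z ^ (2 * Suc n)) * indicator (ball 0 1) z = ennreal (cmod z ^ (2 * n)) * indicator (ball 0 1) z"
      by (auto simp: indicator_def)
  qed
  also have "\<dots> = ennreal (pi / real (Suc n))" by (rule nn_integral_disk_power)
  also have "pi / real (Suc n) = pi / (real (n + 1) * real (n + 2)) + pi / real (Suc (Suc n))"
    by (simp add: divide_simps) (simp add: algebra_simps)
  also have "ennreal \<dots> = ennreal (pi / (real (n + 1) * real (n + 2))) + ennreal (pi / real (Suc (Suc n)))"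
    by (rule ennreal_plus) auto
  finally show ?thesis
    using ennreal_add_left_cancel[of "ennreal (pi / real (Suc (Suc n)))"] by (simp add: add.commute)
qed

text \<open>Averaging over rotations turns the area integral into an integral of circle means;
  Parseval separates the powers on each circle, and the moments are summed termwise.\<close>

lemma nn_integral_disk_power_series:
  fixes s :: "nat \<Rightarrow> complex"
  assumes h: "\<And>z. z \<in> ball 0 1 \<Longrightarrow> (\<lambda>n. s n * z ^ n) sums h z"
  shows "(\<integral>\<^sup>+z\<in>ball 0 1. ennreal ((cmod (h z))\<^sup>2 * (1 - (cmod z)\<^sup>2)) \<partial>lborel)
    = (\<Sum>n. ennreal ((cmod (s n))\<^sup>2 * (pi / (real (n + 1) * real (n + 2)))))"
proof -
  interpret pair_sigma_finite "lborel :: complex measure" circ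
    by (rule pair_sigma_finite_lborel_circ)
  define G where "G z = ennreal ((cmod (if z \<in> ball 0 1 then h z else 0))\<^sup>2 * (1 - (cmod z)\<^sup>2))" for z
  have "continuous_on (ball 0 1) h"
    by (intro holomorphic_on_imp_continuous_on power_series_holomorphic_ball[OF h])
  then have "(\<lambda>z. if z \<in> ball 0 1 then h z else 0) \<in> borel_measurable borel"
    by (intro borel_measurable_continuous_on_if) auto
  then have [measurable]: "G \<in> borel_measurable borel" unfolding G_def by measurable
  have "(\<integral>\<^sup>+z\<in>ball 0 1. ennreal ((cmod (h z))\<^sup>2 * (1 - (cmod z)\<^sup>2)) \<partial>lborel) = (\<integral>\<^sup>+z. G z \<partial>lborel)"
    by (intro nn_integral_cong) (auto simp: G_def indicator_def)
  also have "\<dots> = (\<integral>\<^sup>+t. (\<integral>\<^sup>+z. G (cis t * z) \<partial>lborel) \<partial>circ)"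
    by (subst nn_integral_lborel_rotate) (auto simp: emeasure_circ)
  also have "\<dots> = (\<integral>\<^sup>+z. (\<integral>\<^sup>+t. G (cis t * z) \<partial>circ) \<partial>lborel)"
    by (rule Fubini') measurable
  also have "\<dots> = (\<integral>\<^sup>+z. (\<Sum>n. ennreal ((cmod (s n))\<^sup>2) * (ennreal (cmod z ^ (2 * n) * (1 - (cmod z)\<^sup>2)) * indicator (ball 0 1) z)) \<partial>lborel)"
  proof (rule nn_integral_cong)
    fix z :: complex
    show "(\<integral>\<^sup>+t. G (cis t * z) \<partial>circ)
        = (\<Sum>n. ennreal ((cmod (s n))\<^sup>2) * (ennreal (cmod z ^ (2 * n) * (1 - (cmod z)\<^sup>2)) * indicator (ball 0 1) z))"
    proof (cases "z \<in> ball 0 1")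
      case True
      have q: "0 \<le> 1 - (cmod z)\<^sup>2" using True by (simp add: power_le_one)
      define e where "e n = s n * z ^ n" for n
      define w where "w = complex_of_real ((1 + cmod z) / 2)"
      have w: "cmod z < cmod w" "w \<in> ball 0 1" using True by (auto simp: w_def norm_divide simp flip: of_real_add)
      have sume: "summable (\<lambda>n. norm (e n))"
        unfolding e_def by (rule powser_insidea[OF sums_summable[OF h[OF w(2)]] w(1)])
      have he: "h (cis t * z) = (\<Sum>n. e n * cis (real n * t))" for t
      proof -
        have "cis t * z \<in> ball 0 1" using True by (simp add: norm_mult)
        from h[OF this] show ?thesis
          by (simp add: sums_iff e_def power_mult_distrib Complex.DeMoivre mult_ac)
      qed
      have "(\<integral>\<^sup>+t. G (cis t * z) \<partial>circ) = (\<integral>\<^sup>+t. ennreal ((cmod (\<Sum>n. e n * cis (real n * t)))\<^sup>2 * (1 - (cmod z)\<^sup>2)) \<partial>circ)"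
        using True by (intro nn_integral_cong) (simp add: G_def norm_mult he)
      also have "\<dots> = ennreal (\<integral>t. (cmod (\<Sum>n. e n * cis (real n * t)))\<^sup>2 * (1 - (cmod z)\<^sup>2) \<partial>circ)"
      proof (rule nn_integral_eq_integral)
        have "cmod (\<Sum>n. e n * cis (real n * t)) \<le> (\<Sum>n. norm (e n))" for t
          using summable_norm[of "\<lambda>n. e n * cis (real n * t)"] sume by (simp add: norm_mult)
        then show "integrable circ (\<lambda>t. (cmod (\<Sum>n. e n * cis (real n * t)))\<^sup>2 * (1 - (cmod z)\<^sup>2))"
          using q by (intro integrable_mult_left integrable_circ_bounded[where B="(\<Sum>n. norm (e n))\<^sup>2"]) (auto intro: power_mono)
      qed (use q in simp)
      also have "(\<integral>t. (cmod (\<Sum>n. e n * cis (real n * t)))\<^sup>2 * (1 - (cmod z)\<^sup>2) \<partial>circ)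
          = (\<Sum>n. (cmod (e n))\<^sup>2) * (1 - (cmod z)\<^sup>2)"
        by (simp add: circ_parseval[OF sume])
      also have "\<dots> = (\<Sum>n. (cmod (e n))\<^sup>2 * (1 - (cmod z)\<^sup>2))"
        by (rule suminf_mult2[OF summable_norm_square[OF sume]])
      also have "ennreal \<dots> = (\<Sum>n. ennreal ((cmod (e n))\<^sup>2 * (1 - (cmod z)\<^sup>2)))"
        using q summable_norm_square[OF sume] by (intro suminf_ennreal2[symmetric] summable_mult2) auto
      also have "\<dots> = (\<Sum>n. ennreal ((cmod (s n))\<^sup>2) * (ennreal (cmod z ^ (2 * n) * (1 - (cmod z)\<^sup>2)) * indicator (ball 0 1) z))"
        using True by (intro suminf_cong)
          (simp add: e_def norm_mult norm_power power_mult_distrib power_mult[symmetric] mult_ac flip: ennreal_mult')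
      finally show ?thesis .
    next
      case False
      then show ?thesis by (simp add: G_def norm_mult)
    qed
  qed
  also have "\<dots> = (\<Sum>n. \<integral>\<^sup>+z. ennreal ((cmod (s n))\<^sup>2) * (ennreal (cmod z ^ (2 * n) * (1 - (cmod z)\<^sup>2)) * indicator (ball 0 1) z) \<partial>lborel)"
    by (rule nn_integral_suminf) measurable
  also have "\<dots> = (\<Sum>n. ennreal ((cmod (s n))\<^sup>2 * (pi / (real (n + 1) * real (n + 2)))))"
  proof (rule suminf_cong)
    fix n
    have "(\<integral>\<^sup>+z. ennreal ((cmod (s n))\<^sup>2) * (ennreal (cmod z ^ (2 * n) * (1 - (cmod z)\<^sup>2)) * indicator (ball 0 1) z) \<partial>lborel)
        = ennreal ((cmod (s n))\<^sup>2) * ennreal (pi / (real (n + 1) * real (n + 2)))"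
      unfolding nn_integral_disk_power_weight[symmetric] by (rule nn_integral_cmult) measurable
    also have "\<dots> = ennreal ((cmod (s n))\<^sup>2 * (pi / (real (n + 1) * real (n + 2))))"
      by (rule ennreal_mult'[symmetric]) simp
    finally show "(\<integral>\<^sup>+z. ennreal ((cmod (s n))\<^sup>2) * (ennreal (cmod z ^ (2 * n) * (1 - (cmod z)\<^sup>2)) * indicator (ball 0 1) z) \<partial>lborel)
        = ennreal ((cmod (s n))\<^sup>2 * (pi / (real (n + 1) * real (n + 2))))" .
  qed
  finally show ?thesis .
qed

text \<open>Writing \<open>f' / (1 - z) = \<Sum> s\<^sub>n z\<^sup>n\<close> turns the local Dirichlet integral at the boundary point 1
  into a weighted square sum.\<close>

lemma dirichlet_integral_poisson:
  fixes a :: "nat \<Rightarrow> complex"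
  assumes f: "\<And>z. z \<in> ball 0 1 \<Longrightarrow> (\<lambda>k. a k * z ^ k) sums f z"
  shows "dirichlet_integral (\<lambda>z. ereal (poisson z)) f
    = (\<Sum>n. ennreal ((cmod (\<Sum>i\<le>n. of_nat (Suc i) * a (Suc i)))\<^sup>2 / (real (n + 1) * real (n + 2))))"
proof -
  define s where "s n = (\<Sum>i\<le>n. of_nat (Suc i) * a (Suc i))" for n
  have sums: "(\<lambda>n. s n * z ^ n) sums (deriv f z / (1 - z))" if z: "z \<in> ball 0 1" for z
  proof -
    \<comment> \<open>The denominator of the Poisson kernel is absorbed into
      \<open>deriv f z / (1 - z)\<close>; the Cauchy product with the geometric series replaces
      coefficients by partial sums.\<close>
    have "(\<lambda>n. \<Sum>i\<le>n. (of_nat (Suc i) * a (Suc i) * z ^ i) * z ^ (n - i)) sums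
        ((\<Sum>i. of_nat (Suc i) * a (Suc i) * z ^ i) * (\<Sum>i. z ^ i))"
      using z by (intro Cauchy_product_sums power_series_deriv(2)[OF f z])
        (auto simp: norm_power intro: summable_geometric)
    moreover have "(\<Sum>i\<le>n. (of_nat (Suc i) * a (Suc i) * z ^ i) * z ^ (n - i)) = s n * z ^ n" for n
      unfolding s_def sum_distrib_right
      by (intro sum.cong refl) (simp add: mult.assoc flip: power_add)
    moreover have "(\<Sum>i. of_nat (Suc i) * a (Suc i) * z ^ i) = deriv f z"
      using power_series_deriv(1)[OF f z] by (simp add: sums_iff)
    moreover have "(\<Sum>i. z ^ i) = 1 / (1 - z)"
      using z by (intro suminf_geometric) simp
    ultimately show ?thesis by simp
  qed
  have "dirichlet_integral (\<lambda>z. ereal (poisson z)) f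
      = energy (disk_weight (\<lambda>z. ereal (poisson z))) (ball 0 1) f / ennreal pi"
    by (rule dirichlet_integral_eq_energy[OF positive_superharmonic_poisson power_series_holomorphic_ball[OF f]])
  also have "energy (disk_weight (\<lambda>z. ereal (poisson z))) (ball 0 1) f
     = (\<integral>\<^sup>+z\<in>ball 0 1. ennreal ((cmod (deriv f z / (1 - z)))\<^sup>2 * (1 - (cmod z)\<^sup>2)) \<partial>lborel)"
    unfolding energy_def
  proof (rule nn_integral_cong)
    fix z :: complex
    show "ennreal ((cmod (deriv f z))\<^sup>2) * disk_weight (\<lambda>z. ereal (poisson z)) z * indicator (ball 0 1) z
        = ennreal ((cmod (deriv f z / (1 - z)))\<^sup>2 * (1 - (cmod z)\<^sup>2)) * indicator (ball 0 1) z"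
      by (auto simp: disk_weight_def poisson_def indicator_def norm_divide power_divide mult_ac
          e2ennreal_ereal simp flip: ennreal_mult')
  qed
  also have "\<dots> = (\<Sum>n. ennreal ((cmod (s n))\<^sup>2 * (pi / (real (n + 1) * real (n + 2)))))"
    by (rule nn_integral_disk_power_series[OF sums])
  also have "\<dots> = (\<Sum>n. ennreal pi * ennreal ((cmod (s n))\<^sup>2 / (real (n + 1) * real (n + 2))))"
    by (intro suminf_cong) (simp add: mult_ac flip: ennreal_mult')
  also have "\<dots> = ennreal pi * (\<Sum>n. ennreal ((cmod (s n))\<^sup>2 / (real (n + 1) * real (n + 2))))"
    by (rule ennreal_suminf_cmult)
  also have "\<dots> / ennreal pi = (\<Sum>n. ennreal ((cmod (s n))\<^sup>2 / (real (n + 1) * real (n + 2))))"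
    by (subst mult.commute) (simp add: ennreal_mult_divide_eq)
  finally show ?thesis by (simp only: s_def)
qed

text \<open>Finite form of the equality between the local Dirichlet integral at 1 and the squared
  Hardy norm of the difference quotient. The term with \<open>S N\<close> is the boundary term of
  the truncation.\<close>

lemma square_sum_telescope:
  fixes b :: "nat \<Rightarrow> real"
  defines "S \<equiv> \<lambda>n. \<Sum>i\<le>n. b i"
  shows "(\<Sum>n<N. (S n - real (Suc n) * b (Suc n))\<^sup>2 / (real (n + 1) * real (n + 2))) + (S N)\<^sup>2 / real (Suc N)
    = (\<Sum>n\<le>N. (b n)\<^sup>2)"
proof (induction N)
  case 0
  then show ?case by (simp add: S_def)
next
  case (Suc N)
  have SS: "S (Suc N) = S N + b (Suc N)" by (simp add: S_def)
  define x where "x = real (Suc N)"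
  have x: "0 < x" "real (Suc (Suc N)) = x + 1" "real (N + 1) = x" "real (N + 2) = x + 1" by (auto simp: x_def)
  have "(S N - x * b (Suc N))\<^sup>2 / (x * (x + 1)) + (S N + b (Suc N))\<^sup>2 / (x + 1) - (S N)\<^sup>2 / x = (b (Suc N))\<^sup>2"
    using x(1) by (simp add: divide_simps) (simp add: power2_eq_square algebra_simps)
  with Suc.IH show ?case
    unfolding sum.lessThan_Suc sum.atMost_Suc SS x(2-4) x_def[symmetric] by linarith
qed

lemma sum_weighted_differences:
  fixes b :: "nat \<Rightarrow> real"
  shows "(\<Sum>i\<le>n. real (Suc i) * (b i - b (Suc i))) = (\<Sum>i\<le>n. b i) - real (Suc n) * b (Suc n)"
  by (induction n) (auto simp: algebra_simps)

definition diff_coeff :: "(nat \<Rightarrow> real) \<Rightarrow> nat \<Rightarrow> real" where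
  "diff_coeff b k = (case k of 0 \<Rightarrow> 0 | Suc i \<Rightarrow> b i - b (Suc i))"

lemma diff_coeff_simps [simp]: "diff_coeff b 0 = 0" "diff_coeff b (Suc i) = b i - b (Suc i)"
  by (simp_all add: diff_coeff_def)

text \<open>Up to its value at 0, the function \<open>f\<close> is \<open>(z - 1) g\<close> where \<open>g\<close> has coefficients \<open>b\<close>, and its
  Dirichlet integral at the boundary point 1 is the squared Hardy norm of \<open>g\<close>.\<close>

lemma dirichlet_integral_poisson_diff:
  assumes f: "\<And>z. z \<in> ball 0 1 \<Longrightarrow> (\<lambda>k. of_real (diff_coeff b k) * z ^ k) sums f z"
  shows "dirichlet_integral (\<lambda>z. ereal (poisson z)) f
    = (\<Sum>n. ennreal (((\<Sum>i\<le>n. b i) - real (Suc n) * b (Suc n))\<^sup>2 / (real (n + 1) * real (n + 2))))"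
proof -
  have "(\<Sum>i\<le>n. of_nat (Suc i) * complex_of_real (diff_coeff b (Suc i)))
      = of_real ((\<Sum>i\<le>n. b i) - real (Suc n) * b (Suc n))" for n
    unfolding sum_weighted_differences[symmetric] by simp
  moreover have "dirichlet_integral (\<lambda>z. ereal (poisson z)) f
    = (\<Sum>n. ennreal ((cmod (\<Sum>i\<le>n. of_nat (Suc i) * of_real (diff_coeff b (Suc i))))\<^sup>2 / (real (n + 1) * real (n + 2))))"
    by (rule dirichlet_integral_poisson[OF f])
  ultimately show ?thesis by (simp only: norm_of_real power2_abs)
qed

lemma dirichlet_integral_poisson_diff_le:
  assumes f: "\<And>z. z \<in> ball 0 1 \<Longrightarrow> (\<lambda>k. of_real (diff_coeff b k) * z ^ k) sums f z"
    and b: "\<And>N. (\<Sum>n\<le>N. (b n)\<^sup>2) \<le> \<beta>"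
  shows "dirichlet_integral (\<lambda>z. ereal (poisson z)) f \<le> ennreal \<beta>"
proof (subst dirichlet_integral_poisson_diff[OF f])
  show "(\<Sum>n. ennreal (((\<Sum>i\<le>n. b i) - real (Suc n) * b (Suc n))\<^sup>2 / (real (n + 1) * real (n + 2)))) \<le> ennreal \<beta>"
  proof (rule suminf_le_const)
    fix N
    have "(\<Sum>n<N. ((\<Sum>i\<le>n. b i) - real (Suc n) * b (Suc n))\<^sup>2 / (real (n + 1) * real (n + 2))) \<le> \<beta>"
      using square_sum_telescope[where b=b and N=N] b[of N]
      by (smt (verit) divide_nonneg_nonneg of_nat_0_le_iff zero_le_power2)
    then show "(\<Sum>n<N. ennreal (((\<Sum>i\<le>n. b i) - real (Suc n) * b (Suc n))\<^sup>2 / (real (n + 1) * real (n + 2)))) \<le> ennreal \<beta>"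
      by (subst sum_ennreal) (auto intro: ennreal_leI)
  qed simp
qed

text \<open>For finitely supported \<open>b\<close> the sum in the boundary term is eventually
  constant, so after division by \<open>Suc N\<close> it disappears in the limit.\<close>

lemma dirichlet_integral_poisson_diff_ge:
  assumes f: "\<And>z. z \<in> ball 0 1 \<Longrightarrow> (\<lambda>k. of_real (diff_coeff b k) * z ^ k) sums f z"
    and b: "\<And>k. n \<le> k \<Longrightarrow> b k = 0"
  shows "ennreal (\<Sum>k<n. (b k)\<^sup>2) \<le> dirichlet_integral (\<lambda>z. ereal (poisson z)) f"
proof -
  define t where "t m = ((\<Sum>i\<le>m. b i) - real (Suc m) * b (Suc m))\<^sup>2 / (real (m + 1) * real (m + 2))" for m
  define S where "S = (\<Sum>i<n. b i)"
  have part: "ennreal ((\<Sum>k<n. (b k)\<^sup>2) - S\<^sup>2 / real (Suc N)) \<le> dirichlet_integral (\<lambda>z. ereal (poisson z)) f"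
    if N: "n \<le> N" for N
  proof -
    have "(\<Sum>i\<le>N. b i) = S" unfolding S_def
      using N b by (intro sum.mono_neutral_right) auto
    moreover have "(\<Sum>i\<le>N. (b i)\<^sup>2) = (\<Sum>k<n. (b k)\<^sup>2)"
      using N b by (intro sum.mono_neutral_right) auto
    ultimately have "(\<Sum>m<N. t m) = (\<Sum>k<n. (b k)\<^sup>2) - S\<^sup>2 / real (Suc N)"
      using square_sum_telescope[where b=b and N=N] unfolding t_def by simp
    then have "ennreal ((\<Sum>k<n. (b k)\<^sup>2) - S\<^sup>2 / real (Suc N)) = (\<Sum>m<N. ennreal (t m))"
      by (subst sum_ennreal) (auto simp: t_def)
    also have "\<dots> \<le> (\<Sum>m. ennreal (t m))"
      by (rule sum_le_suminf) auto
    also have "\<dots> = dirichlet_integral (\<lambda>z. ereal (poisson z)) f"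
      unfolding t_def by (rule dirichlet_integral_poisson_diff[OF f, symmetric])
    finally show ?thesis .
  qed
  have "(\<lambda>N. ennreal ((\<Sum>k<n. (b k)\<^sup>2) - S\<^sup>2 / real (Suc N))) \<longlonglongrightarrow> ennreal ((\<Sum>k<n. (b k)\<^sup>2) - 0)"
    by (intro tendsto_ennrealI tendsto_diff tendsto_const LIMSEQ_Suc[OF lim_const_over_n])
  then have "ennreal ((\<Sum>k<n. (b k)\<^sup>2) - 0) \<le> dirichlet_integral (\<lambda>z. ereal (poisson z)) f"
    by (rule LIMSEQ_le_const2) (use part in blast)
  then show ?thesis by simp
qed

section \<open>The constant sequence and the failure of uniform boundedness\<close>

lemma psum_const_1 [simp]: "psum (\<lambda>_. 1) n = real (Suc n)"
  by (simp add: psum_def)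

lemma norlund_weights_const_1: "norlund_weights (\<lambda>_. 1)"
  by (simp add: norlund_weights_def mono_def)

lemma finite_upper_growth_rate_const_1: "finite_upper_growth_rate (\<lambda>_. 1)"
proof -
  have "limsup (\<lambda>n. ereal (real n * 1 / psum (\<lambda>_. 1) n)) \<le> ereal 1"
    by (rule Limsup_bounded) simp
  then show ?thesis
    unfolding finite_upper_growth_rate_def by (rule le_less_trans) simp
qed

lemma growth_condition_const_1: "growth_condition (\<lambda>_. 1)"
proof -
  have "\<forall>\<^sub>F n in sequentially. ereal (1 / 3) \<le> ereal (psum (\<lambda>_. 1) (n - 1) / psum (\<lambda>_. 1) (2 * n))"
    using eventually_ge_at_top[of 1]
  proof eventually_elim
    case (elim n)
    then have "real (Suc (n - 1)) = real n" by simp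
    with elim show ?case by (simp add: divide_simps)
  qed
  then have "ereal (1 / 3) \<le> liminf (\<lambda>n. ereal (psum (\<lambda>_. 1) (n - 1) / psum (\<lambda>_. 1) (2 * n)))"
    by (rule Liminf_bounded)
  then show ?thesis
    unfolding growth_condition_def by (rule less_le_trans[rotated]) simp
qed

text \<open>With the weight \<open>j = n - m\<close> the squares of these lower bounds sum to at least a multiple of \<open>log n\<close>.\<close>

lemma cesaro_mult_decrement:
  assumes \<alpha>: "0 < \<alpha>" "\<alpha> \<le> 1 / 2" and m: "m \<le> n"
  shows "\<alpha> / (sqrt (real (Suc m)) * sqrt (real (Suc n)))
    \<le> norlund_mult (\<lambda>_. 1) \<alpha> n (n - m) - norlund_mult (\<lambda>_. 1) \<alpha> n (Suc (n - m))"
proof -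
  have c: "norlund_mult (\<lambda>_. 1) \<alpha> n (n - m) - norlund_mult (\<lambda>_. 1) \<alpha> n (Suc (n - m))
     = (real (Suc m) powr \<alpha> - real m powr \<alpha>) / real (Suc n) powr \<alpha>"
  proof (cases "m = 0")
    case True
    then show ?thesis by (simp add: norlund_mult_def powr_divide)
  next
    case False
    then have "n - (n - m) = m" "Suc (n - m) \<le> n" "Suc (n - Suc (n - m)) = m" using m by auto
    then show ?thesis using m by (simp add: norlund_mult_def powr_divide diff_divide_distrib del: of_nat_Suc)
  qed
  have "\<alpha> * real (Suc m) powr (\<alpha> - 1) \<le> real (Suc m) powr \<alpha> - real m powr \<alpha>"
  proof (cases "m = 0")
    case True
    then show ?thesis using \<alpha> by simp
  next
    case False
    then have "\<exists>z. real m < z \<and> z < real (Suc m) \<and> real (Suc m) powr \<alpha> - real m powr \<alpha> = (real (Suc m) - real m) * (\<alpha> * z powr (\<alpha> - 1))"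
      by (intro MVT2) (auto intro!: derivative_eq_intros)
    then obtain z where z: "real m < z" "z < real (Suc m)" "real (Suc m) powr \<alpha> - real m powr \<alpha> = \<alpha> * z powr (\<alpha> - 1)"
      by auto
    have "real (Suc m) powr (\<alpha> - 1) \<le> z powr (\<alpha> - 1)"
      using z False \<alpha> by (intro powr_mono2') auto
    then show ?thesis unfolding z(3) using \<alpha> by simp
  qed
  then have "\<alpha> * real (Suc m) powr (\<alpha> - 1) / real (Suc n) powr \<alpha>
     \<le> norlund_mult (\<lambda>_. 1) \<alpha> n (n - m) - norlund_mult (\<lambda>_. 1) \<alpha> n (Suc (n - m))"
    unfolding c by (rule divide_right_mono) simp
  \<comment> \<open>Because \<open>\<alpha> - 1 / 2\<close> is not positive, replacing
    \<open>Suc n\<close> by the smaller \<open>Suc m\<close> under this exponent does not decrease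
    the power.\<close>
  moreover have "1 / (sqrt (real (Suc m)) * sqrt (real (Suc n))) \<le> real (Suc m) powr (\<alpha> - 1) / real (Suc n) powr \<alpha>"
  proof -
    have "real (Suc n) powr (\<alpha> - 1 / 2) \<le> real (Suc m) powr (\<alpha> - 1 / 2)"
      using m \<alpha> by (intro powr_mono2') auto
    then have "real (Suc n) powr (\<alpha> - 1 / 2) * (real (Suc m) powr (- (1 / 2)) * real (Suc n) powr (- \<alpha>))
       \<le> real (Suc m) powr (\<alpha> - 1 / 2) * (real (Suc m) powr (- (1 / 2)) * real (Suc n) powr (- \<alpha>))"
      by (rule mult_right_mono) simp
    moreover have "real (Suc n) powr (\<alpha> - 1 / 2) * (real (Suc m) powr (- (1 / 2)) * real (Suc n) powr (- \<alpha>))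
       = real (Suc m) powr (- (1 / 2)) * real (Suc n) powr (- (1 / 2))"
    proof -
      have "real (Suc n) powr (\<alpha> - 1 / 2) * real (Suc n) powr (- \<alpha>) = real (Suc n) powr (- (1 / 2))"
        by (simp only: powr_add[symmetric]) simp
      then show ?thesis by (metis mult.left_commute mult.commute)
    qed
    moreover have "real (Suc m) powr (\<alpha> - 1 / 2) * (real (Suc m) powr (- (1 / 2)) * real (Suc n) powr (- \<alpha>))
       = real (Suc m) powr (\<alpha> - 1) * real (Suc n) powr (- \<alpha>)"
    proof -
      have "real (Suc m) powr (\<alpha> - 1 / 2) * real (Suc m) powr (- (1 / 2)) = real (Suc m) powr (\<alpha> - 1)"
        by (simp only: powr_add[symmetric]) simp
      then show ?thesis by (metis mult.assoc)
    qed
    moreover have "real (Suc m) powr (- (1 / 2)) * real (Suc n) powr (- (1 / 2)) = 1 / (sqrt (real (Suc m)) * sqrt (real (Suc n)))"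
      by (simp only: powr_minus powr_half_sqrt of_nat_0_le_iff) (simp add: divide_inverse)
    moreover have "real (Suc m) powr (\<alpha> - 1) * real (Suc n) powr (- \<alpha>) = real (Suc m) powr (\<alpha> - 1) / real (Suc n) powr \<alpha>"
      by (simp only: powr_minus divide_inverse)
    ultimately show ?thesis by (simp only:)
  qed
  then have "\<alpha> * (1 / (sqrt (real (Suc m)) * sqrt (real (Suc n)))) \<le> \<alpha> * (real (Suc m) powr (\<alpha> - 1) / real (Suc n) powr \<alpha>)"
    using \<alpha> by (intro mult_left_mono) auto
  ultimately show ?thesis by simp
qed

text \<open>Coefficients of the difference quotient at 1 after applying the multiplier: the
  triangular matrix of \<open>tail_multiplier\<close> at \<open>\<eta> = 1\<close>, with the
  increments written as decrements.\<close>

definition cesaro_tail :: "(nat \<Rightarrow> real) \<Rightarrow> real \<Rightarrow> nat \<Rightarrow> nat \<Rightarrow> real" where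
  "cesaro_tail b \<alpha> n k = norlund_mult (\<lambda>_. 1) \<alpha> n (Suc k) * b k
     - (\<Sum>j\<in>{k<..n}. (norlund_mult (\<lambda>_. 1) \<alpha> n j - norlund_mult (\<lambda>_. 1) \<alpha> n (Suc j)) * b j)"

lemma cesaro_tail_eq_0: "n \<le> k \<Longrightarrow> cesaro_tail b \<alpha> n k = 0"
  by (simp add: cesaro_tail_def norlund_mult_def)

lemma diff_coeff_cesaro_tail:
  "diff_coeff (cesaro_tail b \<alpha> n) k = norlund_mult (\<lambda>_. 1) \<alpha> n k * diff_coeff b k"
proof (cases k)
  case (Suc i)
  let ?c = "norlund_mult (\<lambda>_. 1) \<alpha> n"
  show ?thesis
  proof (cases "i < n")
    case True
    then have "{i<..n} = insert (Suc i) {Suc i<..n}" by auto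
    then have "(\<Sum>j\<in>{i<..n}. (?c j - ?c (Suc j)) * b j)
        = (?c (Suc i) - ?c (Suc (Suc i))) * b (Suc i) + (\<Sum>j\<in>{Suc i<..n}. (?c j - ?c (Suc j)) * b j)"
      by simp
    then show ?thesis by (simp add: Suc cesaro_tail_def algebra_simps)
  next
    case False
    then show ?thesis by (simp add: Suc cesaro_tail_eq_0 norlund_mult_def)
  qed
qed simp

text \<open>All rows \<open>k < M\<close> share the columns in the upper half. There the decrements
  and the lower bounds for \<open>b\<close> both behave like \<open>1 / sqrt (Suc m)\<close>, so
  each row collects a harmonic sum \<tau>; the diagonal contributions cost at most \<beta> in
  total.\<close>

lemma cesaro_tail_lower_bound:
  assumes \<alpha>: "0 < \<alpha>" "\<alpha> \<le> 1 / 2" and M: "0 < M" and b: "\<And>j. 0 \<le> b j" "\<And>N. (\<Sum>n\<le>N. (b n)\<^sup>2) \<le> \<beta>"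
    and w: "0 \<le> w" "\<And>m. m < M \<Longrightarrow> w / sqrt (real (Suc m)) \<le> b (2 * M - m)"
  shows "(\<alpha> * w * harm M)\<^sup>2 / 6 - \<beta> \<le> (\<Sum>k<2 * M. (cesaro_tail b \<alpha> (2 * M) k)\<^sup>2)"
proof -
  define n where "n = 2 * M"
  let ?c = "norlund_mult (\<lambda>_. 1) \<alpha> n"
  define \<tau> where "\<tau> = \<alpha> * w * harm M / sqrt (real (Suc n))"
  have dec: "0 \<le> ?c j - ?c (Suc j)" if "j \<le> n" for j
  proof -
    have "0 \<le> \<alpha> / (sqrt (real (Suc (n - j))) * sqrt (real (Suc n)))" using \<alpha> by simp
    also have "\<dots> \<le> ?c (n - (n - j)) - ?c (Suc (n - (n - j)))"
      by (rule cesaro_mult_decrement[OF \<alpha>]) simp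
    finally show ?thesis using that by simp
  qed
  have \<tau>: "\<tau> \<le> (\<Sum>j\<in>{k<..n}. (?c j - ?c (Suc j)) * b j)" if k: "k < M" for k
  proof -
    have "\<tau> = (\<Sum>m<M. \<alpha> / (sqrt (real (Suc m)) * sqrt (real (Suc n))) * (w / sqrt (real (Suc m))))"
    proof -
      have "(\<Sum>m<M. \<alpha> / (sqrt (real (Suc m)) * sqrt (real (Suc n))) * (w / sqrt (real (Suc m))))
          = (\<Sum>m<M. \<alpha> * w / sqrt (real (Suc n)) * inverse (real (Suc m)))"
      proof (intro sum.cong refl)
        fix m
        have "sqrt (real (Suc m)) * sqrt (real (Suc m)) = real (Suc m)" by simp
        then show "\<alpha> / (sqrt (real (Suc m)) * sqrt (real (Suc n))) * (w / sqrt (real (Suc m)))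
          = \<alpha> * w / sqrt (real (Suc n)) * inverse (real (Suc m))"
          by (simp add: divide_inverse mult_ac del: of_nat_Suc real_sqrt_mult_self) 
             (simp flip: inverse_mult_distrib del: of_nat_Suc)
      qed
      also have "\<dots> = \<tau>"
        by (simp only: \<tau>_def harm_altdef sum_distrib_left sum_divide_distrib times_divide_eq_left)
      finally show ?thesis by simp
    qed
    also have "\<dots> \<le> (\<Sum>m<M. (?c (n - m) - ?c (Suc (n - m))) * b (n - m))"
    proof (rule sum_mono)
      fix m assume "m \<in> {..<M}"
      then have m: "m < M" "m \<le> n" by (auto simp: n_def)
      show "\<alpha> / (sqrt (real (Suc m)) * sqrt (real (Suc n))) * (w / sqrt (real (Suc m)))
          \<le> (?c (n - m) - ?c (Suc (n - m))) * b (n - m)"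
      proof (rule mult_mono)
        show "w / sqrt (real (Suc m)) \<le> b (n - m)" using w(2)[OF m(1)] by (simp add: n_def)
      qed (use cesaro_mult_decrement[OF \<alpha> m(2)] dec[of "n - m"] w in auto)
    qed
    also have "\<dots> = (\<Sum>j\<in>{M<..n}. (?c j - ?c (Suc j)) * b j)"
      by (rule sum.reindex_bij_witness[of _ "\<lambda>j. n - j" "\<lambda>m. n - m"]) (auto simp: n_def)
    also have "\<dots> \<le> (\<Sum>j\<in>{k<..n}. (?c j - ?c (Suc j)) * b j)"
      using k dec b by (intro sum_mono2) auto
    finally show ?thesis .
  qed
  have \<tau>0: "0 \<le> \<tau>" using \<alpha> w by (simp add: \<tau>_def harm_nonneg)
  have "\<tau>\<^sup>2 / 2 - (b k)\<^sup>2 \<le> (cesaro_tail b \<alpha> n k)\<^sup>2" if k: "k < M" for k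
  proof -
    define T where "T = (\<Sum>j\<in>{k<..n}. (?c j - ?c (Suc j)) * b j)"
    define y where "y = ?c (Suc k) * b k"
    have "\<tau>\<^sup>2 \<le> T\<^sup>2" using \<tau>[OF k] \<tau>0 unfolding T_def by (rule power_mono)
    moreover have "y\<^sup>2 \<le> (b k)\<^sup>2"
      using norlund_mult_bounds[OF norlund_weights_const_1 \<alpha>(1), of n "Suc k"] b(1)[of k]
      unfolding y_def by (intro power_mono) (auto intro: mult_left_le_one_le)
    moreover have "T\<^sup>2 / 2 - y\<^sup>2 \<le> (y - T)\<^sup>2"
    proof -
      have "0 \<le> (T - 2 * y)\<^sup>2" by simp
      then show ?thesis by (simp add: power2_eq_square algebra_simps)
    qed
    moreover have "cesaro_tail b \<alpha> n k = y - T"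
      by (simp add: cesaro_tail_def y_def T_def)
    ultimately show ?thesis by simp
  qed
  then have "(\<Sum>k<M. \<tau>\<^sup>2 / 2 - (b k)\<^sup>2) \<le> (\<Sum>k<M. (cesaro_tail b \<alpha> n k)\<^sup>2)"
    by (intro sum_mono) auto
  also have "\<dots> \<le> (\<Sum>k<n. (cesaro_tail b \<alpha> n k)\<^sup>2)"
    by (intro sum_mono2) (auto simp: n_def)
  finally have "real M * (\<tau>\<^sup>2 / 2) - (\<Sum>k<M. (b k)\<^sup>2) \<le> (\<Sum>k<n. (cesaro_tail b \<alpha> n k)\<^sup>2)"
    by (simp add: sum_subtractf)
  moreover have "(\<Sum>k<M. (b k)\<^sup>2) \<le> \<beta>"
    using b(2)[of M] sum_mono2[of "{..M}" "{..<M}" "\<lambda>k. (b k)\<^sup>2"] by fastforce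
  moreover have "(\<alpha> * w * harm M)\<^sup>2 / 6 \<le> real M * (\<tau>\<^sup>2 / 2)"
  proof -
    have "\<tau>\<^sup>2 = (\<alpha> * w * harm M)\<^sup>2 / real (Suc n)"
      by (simp add: \<tau>_def power_divide del: of_nat_Suc)
    then have "real M * (\<tau>\<^sup>2 / 2) = (\<alpha> * w * harm M)\<^sup>2 * (real M / (2 * real (Suc n)))"
      by (simp add: mult_ac)
    \<comment> \<open>Here \<open>n = 2 * M\<close>, and the ratio is smallest at
      \<open>M = 1\<close>, where it equals 1/6.\<close>
    moreover have "1 / 6 \<le> real M / (2 * real (Suc n))"
      using M by (simp add: n_def divide_simps)
    then have "(\<alpha> * w * harm M)\<^sup>2 * (1 / 6) \<le> (\<alpha> * w * harm M)\<^sup>2 * (real M / (2 * real (Suc n)))"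
      by (rule mult_left_mono) simp
    ultimately show ?thesis by linarith
  qed
  ultimately show ?thesis by (simp add: n_def)
qed

text \<open>A gliding hump: the \<open>i\<close>-th summand is extremal for the decrements of the \<open>2 M\<^sub>i\<close>-th multiplier.
  Superposing the squares instead of the functions makes the square sums add up exactly.\<close>

lemma gliding_hump:
  obtains b :: "nat \<Rightarrow> real" and M :: "nat \<Rightarrow> nat" where
    "\<And>j. 0 \<le> b j" "\<And>N. (\<Sum>n\<le>N. (b n)\<^sup>2) \<le> 2" "\<And>i. i < M i" "\<And>i. 16 ^ i \<le> (harm (M i) :: real)"
    "\<And>i m. m < M i \<Longrightarrow> (1 / 2) ^ i / sqrt (harm (M i)) / sqrt (real (Suc m)) \<le> b (2 * M i - m)"
proof -
  \<comment> \<open>The squared amplitude of hump \<open>i\<close> is \<open>(1 / 4) ^ i\<close>, so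
    logarithmic size \<open>16 ^ i\<close> still leaves growth \<open>4 ^ i\<close>.\<close>
  have "\<exists>M>i. 16 ^ i \<le> (harm M :: real)" for i :: nat
  proof -
    have "\<forall>\<^sub>F M in sequentially. 16 ^ i \<le> (harm M :: real)"
      using harm_at_top by (simp add: filterlim_at_top)
    with eventually_gt_at_top[of i] have "\<forall>\<^sub>F M in sequentially. i < M \<and> 16 ^ i \<le> (harm M :: real)"
      by (rule eventually_conj)
    then show ?thesis by (auto dest: eventually_happens)
  qed
  then obtain M where M: "\<And>i. i < M i" "\<And>i. 16 ^ i \<le> (harm (M i) :: real)" by metis
  have M0: "0 < M i" for i using M(1)[of i] by simp
  have h: "0 < (harm (M i) :: real)" for i using M0 by (rule harm_pos)
  \<comment> \<open>Squared profile of hump \<open>i\<close>, normalized to total mass 1; the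
    weights \<open>(1 / 4) ^ i\<close> then keep the square sum of \<open>b\<close> below 2.\<close>
  define v where "v i j = (if M i < j \<and> j \<le> 2 * M i then 1 / (real (Suc (2 * M i - j)) * harm (M i)) else 0)" for i j
  have v0: "0 \<le> v i j" for i j using h[of i] by (simp add: v_def less_imp_le)
  have vsum: "(\<Sum>j\<le>N. v i j) \<le> 1" for i N
  proof -
    have "(\<Sum>j\<le>N. v i j) = (\<Sum>j\<in>{..N} \<inter> {M i<..2 * M i}. v i j)"
      by (rule sum.mono_neutral_right) (auto simp: v_def)
    also have "\<dots> \<le> (\<Sum>j\<in>{M i<..2 * M i}. v i j)"
      by (rule sum_mono2) (auto simp: v0)
    also have "\<dots> = (\<Sum>m<M i. 1 / (real (Suc m) * harm (M i)))"
      by (rule sum.reindex_bij_witness[of _ "\<lambda>m. 2 * M i - m" "\<lambda>j. 2 * M i - j"]) (auto simp: v_def)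
    also have "\<dots> = (\<Sum>m<M i. inverse (real (Suc m))) / harm (M i)"
      unfolding sum_divide_distrib by (intro sum.cong refl) (simp add: divide_inverse)
    also have "(\<Sum>m<M i. inverse (real (Suc m))) = harm (M i)"
      by (rule harm_altdef[symmetric])
    also have "harm (M i) / harm (M i) = (1 :: real)"
      by (rule divide_self) (use h[of i] in linarith)
    finally show ?thesis .
  qed
  have v1: "v i j \<le> 1" for i j
    using vsum[of i j] member_le_sum[of j "{..j}" "v i"] v0 by force
  have sm: "summable (\<lambda>i. (1 / 4) ^ i * v i j)" for j
    by (rule summable_comparison_test'[of "\<lambda>i. (1 / 4 :: real) ^ i" 0])
       (auto simp: v0 v1 mult_left_le intro!: summable_geometric)
  define b where "b j = sqrt (\<Sum>i. (1 / 4) ^ i * v i j)" for j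
  have b2: "(b j)\<^sup>2 = (\<Sum>i. (1 / 4) ^ i * v i j)" for j
    unfolding b_def using sm v0 by (simp add: suminf_nonneg)
  have "(\<Sum>n\<le>N. (b n)\<^sup>2) \<le> 2" for N
  proof -
    have "(\<Sum>n\<le>N. (b n)\<^sup>2) = (\<Sum>i. \<Sum>n\<le>N. (1 / 4) ^ i * v i n)"
      unfolding b2 by (rule suminf_sum[symmetric]) (rule sm)
    also have "\<dots> \<le> (\<Sum>i. (1 / 4) ^ i)"
    proof (rule suminf_le)
      show "(\<Sum>n\<le>N. (1 / 4) ^ i * v i n) \<le> (1 / 4) ^ i" for i
        using vsum[of i N] by (simp add: sum_distrib_left[symmetric] mult_left_le)
      show "summable (\<lambda>i. \<Sum>n\<le>N. (1 / 4) ^ i * v i n)" by (rule summable_sum) (rule sm)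
    qed (simp add: summable_geometric)
    also have "\<dots> \<le> 2" by (subst suminf_geometric) auto
    finally show ?thesis .
  qed
  moreover have "0 \<le> b j" for j
    unfolding b_def using sm v0 by (simp add: suminf_nonneg)
  moreover have "(1 / 2) ^ i / sqrt (harm (M i)) / sqrt (real (Suc m)) \<le> b (2 * M i - m)" if m: "m < M i" for i m
  proof -
    have "((1 / 2) ^ i / sqrt (harm (M i)) / sqrt (real (Suc m)))\<^sup>2 = (1 / 4) ^ i * v i (2 * M i - m)"
    proof -
      have gen: "(x / sqrt y / sqrt s)\<^sup>2 = x\<^sup>2 * (1 / (s * y))" if "0 \<le> y" "0 \<le> s" for x y s :: real
        using that by (simp add: power_divide power_mult_distrib mult.commute)
      have "((1 / 2 :: real) ^ i)\<^sup>2 = (1 / 4) ^ i"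
        by (simp add: power_mult[symmetric] mult.commute[of i] power_mult power_divide)
      moreover have "v i (2 * M i - m) = 1 / (real (Suc m) * harm (M i))"
        using m by (simp add: v_def)
      ultimately show ?thesis
        by (subst gen) (use h[of i] in \<open>simp_all add: less_imp_le\<close>)
    qed
    also have "\<dots> \<le> (\<Sum>l. (1 / 4) ^ l * v l (2 * M i - m))"
      using sum_le_suminf[OF sm, of "{i}" "2 * M i - m"] v0 by simp
    also have "\<dots> = (b (2 * M i - m))\<^sup>2" by (rule b2[symmetric])
    finally show ?thesis
      by (rule power2_le_imp_le) (simp add: b_def sm v0 suminf_nonneg)
  qed
  ultimately show ?thesis using that M by blast
qed

text \<open>Convergence would keep the Dirichlet integrals of the Noerlund sums of \<open>f\<close>
  bounded for large \<open>n\<close>, whereas at \<open>n = 2 * M i\<close> hump \<open>i\<close>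
  alone forces growth like \<open>4 ^ i\<close>.\<close>

lemma norlund_not_convergent_poisson:
  assumes \<alpha>: "0 < \<alpha>" "\<alpha> \<le> 1 / 2"
  shows "\<not> norlund_converges (\<lambda>_. 1) \<alpha> (\<lambda>z. ereal (poisson z))"
proof
  let ?\<omega> = "\<lambda>z. ereal (poisson z)"
  let ?N = "\<lambda>n f. norlund_sum (\<lambda>_. 1) \<alpha> n f"
  assume conv: "norlund_converges (\<lambda>_. 1) \<alpha> ?\<omega>"
  obtain b :: "nat \<Rightarrow> real" and M :: "nat \<Rightarrow> nat" where b: "\<And>j. 0 \<le> b j" "\<And>N. (\<Sum>n\<le>N. (b n)\<^sup>2) \<le> 2"
    and M: "\<And>i. i < M i" "\<And>i. 16 ^ i \<le> (harm (M i) :: real)"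
    and hump: "\<And>i m. m < M i \<Longrightarrow> (1 / 2) ^ i / sqrt (harm (M i)) / sqrt (real (Suc m)) \<le> b (2 * M i - m)"
    using gliding_hump by metis
  have b2: "b j \<le> 2" for j
  proof (rule power2_le_imp_le)
    have "(b j)\<^sup>2 \<le> (\<Sum>n\<le>j. (b n)\<^sup>2)" by (rule member_le_sum) auto
    with b(2)[of j] show "(b j)\<^sup>2 \<le> 2\<^sup>2" by simp
  qed simp
  define a where "a k = complex_of_real (diff_coeff b k)" for k
  define f where "f z = (\<Sum>k. a k * z ^ k)" for z
  have a_bound: "norm (a k) \<le> 2" for k
  proof (cases k)
    case (Suc i)
    have "\<bar>b i - b (Suc i)\<bar> \<le> 2"
      using b(1)[of i] b(1)[of "Suc i"] b2[of i] b2[of "Suc i"] by linarith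
    then show ?thesis by (simp only: a_def Suc diff_coeff_simps norm_of_real)
  qed (simp add: a_def)
  have f: "(\<lambda>k. a k * z ^ k) sums f z" if z: "z \<in> ball 0 1" for z
    unfolding f_def
  proof (rule summable_sums, rule summable_comparison_test)
    show "\<exists>N. \<forall>n\<ge>N. norm (a n * z ^ n) \<le> 2 * norm z ^ n"
      using a_bound by (auto simp: norm_mult norm_power intro!: mult_right_mono)
    show "summable (\<lambda>n. 2 * norm z ^ n)"
      using z by (intro summable_mult summable_geometric) simp
  qed
  note fb = f[unfolded a_def]
  have fhol: "f holomorphic_on ball 0 1" by (rule power_series_holomorphic_ball[OF f])
  have Df: "dirichlet_integral ?\<omega> f \<le> ennreal 2"
    by (rule dirichlet_integral_poisson_diff_le[OF fb b(2)])
  have "f \<in> dirichlet_space ?\<omega>"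
    using fhol Df by (auto simp: dirichlet_space_def intro: le_less_trans)
  with conv have "(\<lambda>n. dirichlet_norm ?\<omega> (\<lambda>z. ?N n f z - f z)) \<longlonglongrightarrow> 0"
    by (auto simp: norlund_converges_def)
  then have lim: "(\<lambda>n. dirichlet_integral ?\<omega> (\<lambda>z. ?N n f z - f z)) \<longlonglongrightarrow> 0"
    by (subst (asm) dirichlet_norm_tendsto_0_iff) (auto simp: norlund_sum_at_0[OF norlund_weights_const_1])
  have "f has_fps_expansion Abs_fps a"
  proof (rule has_fps_expansionI)
    have "\<forall>\<^sub>F z in nhds 0. z \<in> ball (0::complex) 1"
      by (intro eventually_nhds_in_open) auto
    then show "\<forall>\<^sub>F z in nhds 0. (\<lambda>n. fps_nth (Abs_fps a) n * z ^ n) sums f z"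
      by eventually_elim (use f in simp)
  qed
  then have coeff: "fps_nth (fps_expansion f 0) k = a k" for k
    using fps_nth_fps_expansion[of f "Abs_fps a" k] by (simp add: fps_expansion_def)
  have N_sums: "(\<lambda>k. of_real (diff_coeff (cesaro_tail b \<alpha> n) k) * z ^ k) sums ?N n f z" for n z
  proof -
    have "(\<lambda>k. of_real (diff_coeff (cesaro_tail b \<alpha> n) k) * z ^ k) sums
        (\<Sum>k\<le>n. of_real (diff_coeff (cesaro_tail b \<alpha> n) k) * z ^ k)"
      by (rule sums_finite) (auto simp: diff_coeff_cesaro_tail norlund_mult_def)
    then show ?thesis
      unfolding norlund_sum_eq[OF norlund_weights_const_1] coeff a_def diff_coeff_cesaro_tail by simp
  qed
  have tri: "dirichlet_integral ?\<omega> (?N n f)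
      \<le> 3 * (dirichlet_integral ?\<omega> (\<lambda>z. ?N n f z - f z) + dirichlet_integral ?\<omega> f)" for n
  proof -
    have hol: "?N n f holomorphic_on ball 0 1" "(\<lambda>z. ?N n f z - f z) holomorphic_on ball 0 1"
      by (intro holomorphic_intros norlund_sum_holomorphic fhol)+
    let ?E = "energy (disk_weight ?\<omega>) (ball 0 1)"
    have "?E (?N n f) \<le> 3 * (?E (\<lambda>z. ?N n f z - f z) + ?E f + ?E (\<lambda>z. 0))"
      by (rule energy_add3[OF supermean_weight_measurable[OF supermean_weight_disk_weight[OF positive_superharmonic_poisson]]])
         (use hol fhol in auto)
    also have "?E (\<lambda>z. 0) = 0" by (simp add: energy_def)
    finally have "?E (?N n f) / ennreal pi \<le> 3 * (?E (\<lambda>z. ?N n f z - f z) + ?E f) / ennreal pi"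
      by (intro divide_right_mono_ennreal) simp
    also have "\<dots> = 3 * (?E (\<lambda>z. ?N n f z - f z) / ennreal pi + ?E f / ennreal pi)"
      by (simp add: divide_ennreal_def distrib_left distrib_right mult.assoc)
    finally show ?thesis
      by (simp only: dirichlet_integral_eq_energy[OF positive_superharmonic_poisson hol(1)]
          dirichlet_integral_eq_energy[OF positive_superharmonic_poisson hol(2)]
          dirichlet_integral_eq_energy[OF positive_superharmonic_poisson fhol])
  qed
  have "\<forall>\<^sub>F n in sequentially. dirichlet_integral ?\<omega> (\<lambda>z. ?N n f z - f z) \<le> ennreal 1"
    using lim unfolding ennreal_tendsto_0_iff by (meson zero_less_one)
  then obtain n0 where n0: "\<And>n. n0 \<le> n \<Longrightarrow> dirichlet_integral ?\<omega> (\<lambda>z. ?N n f z - f z) \<le> ennreal 1"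
    by (auto simp: eventually_sequentially)
  \<comment> \<open>\<open>9 = 3 * (1 + 2)\<close>: the factor from \<open>energy_add3\<close>,
    error at most 1, Dirichlet integral of \<open>f\<close> at most 2.\<close>
  have upper: "(\<Sum>k<n. (cesaro_tail b \<alpha> n k)\<^sup>2) \<le> 9" if n: "n0 \<le> n" for n
  proof -
    have "ennreal (\<Sum>k<n. (cesaro_tail b \<alpha> n k)\<^sup>2) \<le> dirichlet_integral ?\<omega> (?N n f)"
      by (rule dirichlet_integral_poisson_diff_ge[OF N_sums cesaro_tail_eq_0])
    also have "\<dots> \<le> 3 * (ennreal 1 + ennreal 2)"
      using n0[OF n] Df by (intro order_trans[OF tri] mult_left_mono add_mono) auto
    also have "\<dots> = ennreal 9"
      by (simp flip: ennreal_numeral ennreal_1 ennreal_plus ennreal_mult')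
    finally show ?thesis
      by (rule ennreal_le_iff[THEN iffD1, rotated]) simp
  qed
  \<comment> \<open>\<open>66 = 6 * (9 + 2)\<close>, from the divisor 6 and the loss
    \<open>\<beta> = 2\<close> in the lower bound.\<close>
  have "\<alpha>\<^sup>2 * 4 ^ i \<le> 66" if i: "n0 \<le> i" for i
  proof -
    define h where "h = (harm (M i) :: real)"
    define w where "w = (1 / 2) ^ i / sqrt h"
    have M0: "0 < M i" using M(1)[of i] by simp
    have h0: "0 < h" unfolding h_def using M0 by (rule harm_pos)
    have "(\<alpha> * w * harm (M i))\<^sup>2 / 6 - 2 \<le> (\<Sum>k<2 * M i. (cesaro_tail b \<alpha> (2 * M i) k)\<^sup>2)"
    proof (rule cesaro_tail_lower_bound[OF \<alpha> M0 b])
      show "0 \<le> w" using h0 by (simp add: w_def)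
      show "w / sqrt (real (Suc m)) \<le> b (2 * M i - m)" if "m < M i" for m
        using hump[OF that] by (simp only: w_def h_def)
    qed
    also have "\<dots> \<le> 9"
      by (rule upper) (use i M(1)[of i] in simp)
    finally have "(\<alpha> * w * h)\<^sup>2 \<le> 66" by (simp add: h_def)
    moreover have "(\<alpha> * w * h)\<^sup>2 = \<alpha>\<^sup>2 * ((1 / 4) ^ i * h)"
    proof -
      have "(w * h)\<^sup>2 = ((1 / 2) ^ i)\<^sup>2 * h"
      proof -
        have "(x / sqrt y * y)\<^sup>2 = x\<^sup>2 * y" if "0 < y" for x y :: real
          using that by (simp add: power_mult_distrib power_divide power2_eq_square[of y])
        from this[OF h0] show ?thesis by (simp only: w_def)
      qed
      also have "((1 / 2 :: real) ^ i)\<^sup>2 = (1 / 4) ^ i"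
        by (simp add: power_mult[symmetric] mult.commute[of i] power_mult power_divide)
      finally show ?thesis by (simp add: power_mult_distrib mult.assoc)
    qed
    moreover have "4 ^ i \<le> (1 / 4) ^ i * h"
    proof -
      have "(4::real) ^ i = (1 / 4) ^ i * 16 ^ i" by (simp flip: power_mult_distrib)
      also have "\<dots> \<le> (1 / 4) ^ i * h" using M(2)[of i] by (intro mult_left_mono) (auto simp: h_def)
      finally show ?thesis .
    qed
    ultimately show ?thesis
      using mult_left_mono[of "4 ^ i" "(1 / 4) ^ i * h" "\<alpha>\<^sup>2"] by simp
  qed
  then have "\<alpha>\<^sup>2 * 4 ^ max n0 i \<le> 66" for i by simp
  moreover obtain i0 where "66 / \<alpha>\<^sup>2 < 4 ^ i0"
    using real_arch_pow[of 4 "66 / \<alpha>\<^sup>2"] by auto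
  moreover have "(4::real) ^ i0 \<le> 4 ^ max n0 i0" by (intro power_increasing) auto
  ultimately have "66 / \<alpha>\<^sup>2 < 4 ^ max n0 i0" "\<alpha>\<^sup>2 * 4 ^ max n0 i0 \<le> 66"
    using less_le_trans by blast+
  with \<alpha> show False by (simp add: divide_less_eq mult.commute)
qed

theorem theorem3p1:
  shows "(\<forall>(p :: nat \<Rightarrow> real) (\<alpha> :: real) (\<omega> :: complex \<Rightarrow> ereal).
            norlund_weights p \<and> 1 / 2 < \<alpha> \<and> positive_superharmonic \<omega> \<longrightarrow>
              (finite_upper_growth_rate p \<longrightarrow> norlund_converges p \<alpha> \<omega>) \<and>
              (growth_condition p \<longrightarrow> norlund_converges p \<alpha> \<omega> \<longrightarrow> finite_lower_growth_rate p))
       \<and> (\<forall>\<alpha> :: real. 0 < \<alpha> \<and> \<alpha> \<le> 1 / 2 \<longrightarrow>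
            (\<exists>(p :: nat \<Rightarrow> real) (\<omega> :: complex \<Rightarrow> ereal).
               norlund_weights p \<and> finite_upper_growth_rate p \<and> growth_condition p \<and>
               positive_superharmonic \<omega> \<and> \<not> norlund_converges p \<alpha> \<omega>))"
  using norlund_converges_if_finite_upper_growth_rate growth_condition_imp_finite_lower_growth_rate
    norlund_weights_const_1 finite_upper_growth_rate_const_1 growth_condition_const_1
    positive_superharmonic_poisson norlund_not_convergent_poisson
  by blast

end
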